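(* Let $P$, $N$, $\zeta_P$, $\Lambda_P$, $d$, $d_1$, $\mathrm{Norm}(P)$ and $m(N)$ be as described in the context. Let $\rho\leq 1$ and $1\leq\alpha\leq 2$ be real numbers such that $\zeta_P(s)$ has at most finitely many singular points (zeros or poles) in the half-plane $\{\Re s\geq\rho\}$, and such that for every $\epsilon>0$ \[ x^{\alpha-\epsilon}\ll \sum_{\substack{N\in\mathrm{Norm}(P)\\ N<x}} m(N)^2\ll x^{\alpha+\epsilon}\qquad (x\to\infty). \] Then \[ d+d_1\geq \max\Big\{1,\frac{2-2\rho}{2-\alpha}\Big\}. \]
   Context: Let $P$ be an infinite countable set and $N:P\to\mathbb{R}_{>1}$ a map such that $\sum_{p\in P}N(p)^{-a}<\infty$ for some $a>0$; assume $a_P:=\inf\{a>0 : \sum_{p\in P}N(p)^{-a}<\infty\}$ is positive and normalize so that $a_P=1$. Define $\zeta_P(s):=\prod_{p\in P}(1-N(p)^{-s})^{-1}$ for $\Re s>1$. Assume: (i) $\zeta_P(s)$ is non-zero and holomorphic in $\{\Re s\geq 1\}$ except for a simple pole at $s=1$; (ii) $\zeta_P(s)$ extends to all of $\mathbb{C}$ as a meromorphic function of finite order $d\geq 0$, in the sense that, writing $\Lambda_P$ for the set of singular points (zeros and poles) of $\zeta_P$ counted with multiplicity, $T^{d-\epsilon}\ll\#\{\sigma\in\Lambda_P : |\sigma|<T\}\ll T^{d+\epsilon}$ for every $\epsilon>0$. Let $d_1\in[0,d]$ be a number such that $\#\{\sigma\in\Lambda_P : T-1<|\sigma|<T+1\}\ll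 T^{d_1+\epsilon}$ for every $\epsilon>0$. Let $\mathrm{Norm}(P):=\{N(p):p\in P\}$ and, for $N\in\mathrm{Norm}(P)$, let $m(N)$ be the number of $p\in P$ with $N(p)=N$.
   Formalization: "Finite order d" is taken to mean that zeta_P is a quotient of two entire functions of finite growth order and also satisfies the stated counting bounds for its zeros and poles; with the counting bounds alone the claim fails, e.g. for some zeta_P = e^g/(s-1) with g entire. *)

theory Defs
  imports "HOL-Complex_Analysis.Complex_Analysis" "HOL-Library.Landau_Symbols"
    "HOL-Library.Extended_Real"
begin

definition abscissa_set :: "'a set \<Rightarrow> ('a \<Rightarrow> real) \<Rightarrow> real set" where
  "abscissa_set P N = {a. a > 0 \<and> (\<lambda>p. N p powr (- a)) summable_on P}"

text \<open>
  The unordered product over \<open>P\<close>, i.e. the multiplicative analogue of \<^const>\<open>infsum\<close>.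
  Only its values for real part greater than 1 are meaningful.
\<close>
definition euler_product :: "'a set \<Rightarrow> ('a \<Rightarrow> real) \<Rightarrow> complex \<Rightarrow> complex" where
  "euler_product P N s =
     Lim (finite_subsets_at_top P)
       (\<lambda>F. \<Prod>p\<in>F. inverse (1 - complex_of_real (N p) powr (- s)))"

definition singular_points :: "(complex \<Rightarrow> complex) \<Rightarrow> complex set" where
  "singular_points f = {\<sigma>. isolated_zero f \<sigma> \<or> is_pole f \<sigma>}"

text \<open>
  The number of zeros and poles in \<open>A\<close>, counted with multiplicity; \<^const>\<open>zorder\<close> is negative
  at poles. For a function that is meromorphic on the whole plane, the sum is finite whenever
  \<open>A\<close> is bounded.
\<close>
definition sing_count :: "(complex \<Rightarrow> complex) \<Rightarrow> complex set \<Rightarrow> nat" where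
  "sing_count f A = (\<Sum>\<sigma> \<in> singular_points f \<inter> A. nat \<bar>zorder f \<sigma>\<bar>)"

definition entire_finite_order :: "(complex \<Rightarrow> complex) \<Rightarrow> bool" where
  "entire_finite_order f \<longleftrightarrow>
     f holomorphic_on UNIV \<and>
     (\<exists>k::real. eventually (\<lambda>z. norm (f z) \<le> exp (norm z powr k)) at_infinity)"

text \<open>
  A meromorphic function has finite order if it is a quotient of two entire functions of finite
  order. Values at zeros of the denominator are left open here; for functions satisfying
  \<^const>\<open>nicely_meromorphic_on\<close> they are determined by the remaining values.
\<close>
definition meromorphic_finite_order :: "(complex \<Rightarrow> complex) \<Rightarrow> bool" where
  "meromorphic_finite_order f \<longleftrightarrow>
     f nicely_meromorphic_on UNIV \<and>
     (\<exists>g h. entire_finite_order g \<and> entire_finite_order h \<and> (\<exists>z. h z \<noteq> 0) \<and>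
            (\<forall>z. h z \<noteq> 0 \<longrightarrow> f z = g z / h z))"

text \<open>
  The order is read off from the distribution of zeros and poles: it is the exponent of growth of
  the counting function. This alone does not bound the growth of the function (it is insensitive
  to multiplication by \<open>exp \<circ> g\<close> with \<open>g\<close> entire), which is why finiteness of the order is a
  separate conjunct.
\<close>
definition meromorphic_of_order :: "(complex \<Rightarrow> complex) \<Rightarrow> real \<Rightarrow> bool" where
  "meromorphic_of_order f d \<longleftrightarrow>
     meromorphic_finite_order f \<and>
     (\<forall>\<epsilon>>0. (\<lambda>T::real. T powr (d - \<epsilon>)) \<in> O[at_top](\<lambda>T. real (sing_count f {\<sigma>. norm \<sigma> < T}))) \<and>
     (\<forall>\<epsilon>>0. (\<lambda>T::real. real (sing_count f {\<sigma>. norm \<sigma> < T})) \<in> O[at_top](\<lambda>T. T powr (d + \<epsilon>)))"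

definition norm_mult :: "'a set \<Rightarrow> ('a \<Rightarrow> real) \<Rightarrow> real \<Rightarrow> nat" where
  "norm_mult P N n = card {p \<in> P. N p = n}"

definition mult_square_sum :: "'a set \<Rightarrow> ('a \<Rightarrow> real) \<Rightarrow> real \<Rightarrow> real" where
  "mult_square_sum P N x = (\<Sum>n \<in> {n \<in> N ` P. n < x}. (real (norm_mult P N n))\<^sup>2)"

end

theory Submission
  imports Defs "HOL-Probability.Sinc_Integral" "HOL-Real_Asymp.Real_Asymp"
begin

text \<open>
  Count the prime powers in a multiplicative window of width \<open>h\<close> around \<open>exp u\<close> with a smooth
  (spline) weight, and compare two evaluations of the mean square over \<open>ln Y \<le> u \<le> ln X\<close>. From
  below, the diagonal alone contributes \<open>h\<close> times the sum of \<open>m(n)\<^sup>2\<close>. From above, an explicit formula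
  expresses the count as a sum of \<open>exp (\<sigma> * u)\<close> over the singular points. The finitely many with
  real part at least \<open>\<rho>\<close> contribute \<open>h\<^sup>2 X\<^sup>2\<close> to the mean square. The others are effectively
  truncated at \<open>norm \<sigma> \<le> 1 / h\<close>, and as only pairs with
  \<open>norm \<sigma>\<close> close to \<open>norm \<sigma>'\<close> matter, they contribute at most \<open>h\<^sup>2 X powr (2 \<rho>) h powr (- (d + d1))\<close>,
  up to small powers. Letting \<open>h \<rightarrow> 0\<close> gives \<open>d + d1 \<ge> 1\<close>, and \<open>h\<close> slightly smaller than
  \<open>X powr (\<alpha> - 2)\<close> gives the other bound.

  The explicit formula needs no contour shift: both sides are continuous in \<open>u\<close>, and their Laplace
  transforms agree along an arithmetic progression by Hadamard's partial fraction expansion of the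
  logarithmic derivative, so that they coincide by Lerch's theorem.
\<close>

section \<open>Logarithmic derivatives of entire functions of finite order\<close>

text \<open>A sharp cutoff would leave a sum over \<sigma> without absolute convergence, and
  Hadamard's expansion brings a polynomial with unknown coefficients. One integer \<open>k\<close>
  deals with both. Dividing the Laplace transform by \<open>s ^ k\<close> makes the sum over
  \<sigma> absolutely convergent. A \<open>k\<close>-fold difference with step \<open>h\<close> then
  removes polynomials of degree less than \<open>k\<close> and turns the coefficient
  \<open>1 / \<sigma> ^ k\<close> into \<open>((exp (\<sigma> * h) - 1) / \<sigma>) ^ k\<close>,
  which is of size at most \<open>h ^ k\<close> and decays once the norm of \<sigma> exceeds
  \<open>1 / h\<close>. All this is done with \<open>\<sigma> - c\<close> in place of \<sigma>, for
  a fixed real \<open>c \<ge> 2\<close>, so that no exponential grows and no denominator vanishes.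
  The exponent \<open>d + d1\<close> arises asymmetrically: in a pair of singular points one is
  controlled by the total count, with exponent \<open>d\<close>, the other by the count in annuli of
  bounded width, with exponent \<open>d1\<close>. The lower endpoint \<open>Y\<close> is kept
  because \<rho> may be negative, and then \<open>exp (2 * \<rho> * u)\<close> is largest at the
  left end.\<close>

lemma entire_factor_zero:
  assumes f: "f holomorphic_on UNIV" and nz: "f w0 \<noteq> 0"
  obtains q where "q holomorphic_on UNIV" "q b \<noteq> 0"
    "\<And>z. f z = q z * (z - b) ^ nat (zorder f b)"
proof -
  define n where "n = nat (zorder f b)"
  define g where "g = zor_poly f b"
  obtain r where r: "r > 0" "g holomorphic_on cball b r"
    "\<And>w. w \<in> cball b r \<Longrightarrow> f w = g w * (w - b) ^ n \<and> g w \<noteq> 0"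
  proof -
    have "\<exists>w\<in>UNIV. f w \<noteq> 0" using nz by blast
    from zorder_exist_zero[OF f open_UNIV connected_UNIV UNIV_I[of b] this]
    show ?thesis using that unfolding n_def g_def by blast
  qed
  define q where "q w = (if w = b then g b else f w / (w - b) ^ n)" for w
  have q_ball: "q w = g w" if "w \<in> ball b r" for w
    using r(3)[of w] that by (auto simp: q_def)
  have "q holomorphic_on ball b r"
    by (rule holomorphic_transform[OF holomorphic_on_subset[OF r(2)]]) (auto simp: q_ball)
  moreover have "q holomorphic_on - {b}"
  proof -
    have "(\<lambda>w. f w / (w - b) ^ n) holomorphic_on - {b}"
      by (intro holomorphic_intros holomorphic_on_subset[OF f]) auto
    then show ?thesis
      by (rule holomorphic_transform) (auto simp: q_def)
  qed
  ultimately have "q holomorphic_on (ball b r \<union> - {b})"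
    by (rule holomorphic_on_Un) auto
  moreover have "ball b r \<union> - {b} = UNIV" using r(1) by auto
  ultimately have "q holomorphic_on UNIV" by simp
  moreover have "q b \<noteq> 0" using r(1) r(3)[of b] by (simp add: q_def)
  moreover have "f z = q z * (z - b) ^ n" for z
    using r(1) r(3)[of b] by (auto simp: q_def)
  ultimately show ?thesis using that unfolding n_def by blast
qed

lemma entire_nonzero_eventually:
  assumes f: "f holomorphic_on UNIV" and nz: "f w0 \<noteq> 0"
  shows "eventually (\<lambda>w. f w \<noteq> 0) (at z)"
proof (cases "f z = 0")
  case False
  have "isCont f z" using holomorphic_on_imp_continuous_on[OF f] by (simp add: continuous_on_eq_continuous_at)
  then have "\<forall>\<^sub>F w in at z. f w \<noteq> 0" using False
    by (simp add: continuous_at tendsto_imp_eventually_ne)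
  then show ?thesis .
next
  case True
  obtain q where q: "q holomorphic_on UNIV" "q z \<noteq> 0"
    "\<And>w. f w = q w * (w - z) ^ nat (zorder f z)"
    using entire_factor_zero[OF f nz] by blast
  have "isCont q z" using holomorphic_on_imp_continuous_on[OF q(1)] by (simp add: continuous_on_eq_continuous_at)
  then have "\<forall>\<^sub>F w in at z. q w \<noteq> 0" using q(2)
    by (simp add: continuous_at tendsto_imp_eventually_ne)
  moreover have "\<forall>\<^sub>F w in at z. w \<noteq> z" by (simp add: eventually_neq_at_within)
  ultimately show ?thesis by eventually_elim (auto simp: q(3))
qed

lemma entire_factor_zeros:
  assumes f: "f holomorphic_on UNIV" and nz: "f w0 \<noteq> 0" and "finite A"
  shows "\<exists>q. q holomorphic_on UNIV \<and> (\<forall>a\<in>A. q a \<noteq> 0) \<and>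
    (\<forall>z. f z = q z * (\<Prod>a\<in>A. (z - a) ^ nat (zorder f a)))"
  using \<open>finite A\<close>
proof (induction rule: finite_induct)
  case empty
  then show ?case using f by auto
next
  case (insert b A)
  then obtain q where q: "q holomorphic_on UNIV" "\<And>a. a \<in> A \<Longrightarrow> q a \<noteq> 0"
    "\<And>z. f z = q z * (\<Prod>a\<in>A. (z - a) ^ nat (zorder f a))" by auto
  define p where "p z = (\<Prod>a\<in>A. (z - a) ^ nat (zorder f a))" for z
  have p: "p holomorphic_on UNIV" unfolding p_def by (intro holomorphic_intros)
  have q0: "q w0 \<noteq> 0" using nz q(3)[of w0] by auto
  \<comment> \<open>The factors already split off do not vanish at \<open>b\<close>, so the whole
    order of \<open>f\<close> at \<open>b\<close> is left in \<open>q\<close>.\<close>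
  have pb: "p b \<noteq> 0" using insert by (auto simp: p_def)
  have an: "q analytic_on {b}" "p analytic_on {b}"
    using q(1) p by (auto simp: analytic_on_holomorphic)
  have ev: "eventually (\<lambda>z. q z * p z \<noteq> 0) (at b)"
    using entire_nonzero_eventually[OF f nz, of b] by (simp add: q(3) p_def)
  have "f = (\<lambda>z. q z * p z)" by (rule ext) (simp add: q(3) p_def)
  then have "zorder f b = zorder q b + zorder p b"
    using zorder_times_analytic[OF an ev] by simp
  moreover have "zorder p b = 0"
    using zorder_eq_0_iff[OF an(2)] pb entire_nonzero_eventually[OF p pb, of b]
    by (simp add: eventually_frequently)
  ultimately have zb: "zorder q b = zorder f b" by simp
  obtain q' where q': "q' holomorphic_on UNIV" "q' b \<noteq> 0"
    "\<And>z. q z = q' z * (z - b) ^ nat (zorder q b)"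
    using entire_factor_zero[OF q(1) q0] by blast
  have "f z = q' z * (\<Prod>a\<in>insert b A. (z - a) ^ nat (zorder f a))" for z
    using insert by (subst q(3), subst q'(3)) (simp add: zb)
  moreover have "q' a \<noteq> 0" if "a \<in> insert b A" for a
  proof (cases "a = b")
    case False
    then have "a \<in> A" using that by simp
    then have "q a \<noteq> 0" by (rule q(2))
    then show ?thesis by (subst (asm) q'(3)) auto
  qed (use q'(2) in simp)
  ultimately show ?case using q'(1) by blast
qed

text \<open>The map \<open>w \<mapsto> w / (2 * M - w)\<close> sends the half-plane of real part
  below \<open>M\<close> into the unit disc and fixes 0, so Schwarz's lemma applies to its
  composition with the rescaled \<open>L\<close>. At half the radius the result has norm at most
  1/2, and solving for \<open>L\<close> gives \<open>2 * M\<close>.\<close>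

lemma borel_caratheodory_half:
  assumes L: "L holomorphic_on ball c r" and L0: "L c = 0" and r: "r > 0"
    and M: "\<And>z. z \<in> ball c r \<Longrightarrow> Re (L z) < M" and z: "norm (z - c) \<le> r / 2"
  shows "norm (L z) \<le> 2 * M"
proof -
  define l where "l w = L (c + of_real r * w)" for w
  have inb: "c + of_real r * w \<in> ball c r" if "norm w < 1" for w
    using that r by (simp add: dist_norm norm_mult)
  have holl: "l holomorphic_on ball 0 1"
    unfolding l_def using inb
    by (auto intro!: holomorphic_on_compose_gen[OF _ L, unfolded o_def] holomorphic_intros)
  have M0: "M > 0" using M[of c] r L0 by simp
  have ne: "norm (l w) < norm (2 * of_real M - l w)" if "norm w < 1" for w
  proof -
    have "Re (l w) < M" unfolding l_def using M inb that by blast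
    then have "(norm (l w))\<^sup>2 < (norm (2 * of_real M - l w))\<^sup>2"
      using M0 by (simp only: cmod_power2) (simp add: power2_eq_square algebra_simps)
    then show ?thesis by (rule power_less_imp_less_base) simp
  qed
  define \<phi> where "\<phi> w = l w / (2 * of_real M - l w)" for w
  have nz: "2 * of_real M - l w \<noteq> 0" if "norm w < 1" for w
    using ne[OF that] by auto
  have "\<phi> holomorphic_on ball 0 1" unfolding \<phi>_def
    by (intro holomorphic_intros holl) (use nz in auto)
  moreover have "\<phi> 0 = 0" by (simp add: \<phi>_def l_def L0)
  moreover have "norm (\<phi> w) < 1" if "norm w < 1" for w
    using ne[OF that] nz[OF that] by (simp add: \<phi>_def norm_divide divide_less_eq)
  ultimately have S: "norm (\<phi> w) \<le> norm w" if "norm w < 1" for w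
    using that Schwarz_Lemma(1)[of \<phi> w] by blast
  define w where "w = (z - c) / of_real r"
  have w: "norm w \<le> 1 / 2" using z r by (simp add: w_def norm_divide field_simps)
  have lw: "l w = L z" using r by (simp add: l_def w_def)
  have "norm (l w) / norm (2 * of_real M - l w) \<le> 1 / 2"
    using order_trans[OF S[of w] w] w unfolding \<phi>_def by (simp add: norm_divide)
  then have "2 * norm (l w) \<le> norm (2 * of_real M - l w)"
    using nz[of w] w by (simp add: field_simps)
  also have "\<dots> \<le> 2 * M + norm (l w)"
    using norm_triangle_ineq4[of "2 * of_real M" "l w"] M0 by (simp add: norm_mult)
  finally show ?thesis by (simp add: lw)
qed

text \<open>Taylor's formula for \<open>deriv L\<close>, with the next derivative estimated by
  Cauchy on discs of radius \<open>r / 4\<close> around points of \<open>cball c (r / 4)\<close>;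
  these discs stay in \<open>cball c (r / 2)\<close>, where \<open>B\<close> is available. What
  matters is the power \<open>Suc k\<close> of \<open>r\<close> in the denominator: in the
  application \<open>B\<close> grows only like the \<open>k\<close>-th power.\<close>

lemma deriv_taylor_remainder:
  assumes L: "L holomorphic_on ball c r" and r: "r > 0" and k: "0 < k"
    and B: "\<And>z. norm (z - c) \<le> r / 2 \<Longrightarrow> norm (L z) \<le> B" and s: "norm (s - c) \<le> r / 4"
  shows "norm (deriv L s - (\<Sum>i<k. (deriv ^^ i) (deriv L) c * (s - c) ^ i / fact i))
    \<le> fact (Suc k) * B / (r / 4) ^ Suc k * norm (s - c) ^ k / fact (k - 1)"
proof -
  define S where "S = cball c (r / 4)"
  have SB: "S \<subseteq> ball c r" using r by (auto simp: S_def)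
  have higher: "(deriv ^^ Suc i) L = (deriv ^^ i) (deriv L)" for i
    by (simp add: funpow_swap1)
  have der: "((deriv ^^ Suc i) L has_field_derivative (deriv ^^ Suc (Suc i)) L x) (at x within S)"
    if "x \<in> S" for i x
  proof -
    have "(deriv ^^ Suc i) L holomorphic_on ball c r"
      by (rule holomorphic_higher_deriv[OF L]) simp
    then have "((deriv ^^ Suc i) L has_field_derivative deriv ((deriv ^^ Suc i) L) x) (at x)"
      using that SB by (intro holomorphic_derivI[of _ "ball c r"]) auto
    then show ?thesis by (simp add: has_field_derivative_at_within)
  qed
  have bound: "cmod ((deriv ^^ Suc (Suc (k - 1))) L x) \<le> fact (Suc k) * B / (r / 4) ^ Suc k"
    if "x \<in> S" for x
  proof -
    have sub: "cball x (r / 4) \<subseteq> cball c (r / 2)"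
    proof
      fix y assume "y \<in> cball x (r / 4)"
      then show "y \<in> cball c (r / 2)"
        using that dist_triangle[of c y x] by (simp add: S_def)
    qed
    have sub2: "cball x (r / 4) \<subseteq> ball c r"
      using sub r by fastforce
    have hol: "L holomorphic_on cball x (r / 4)" by (rule holomorphic_on_subset[OF L sub2])
    have "cmod ((deriv ^^ Suc k) L x) \<le> fact (Suc k) * B / (r / 4) ^ Suc k"
    proof (rule Cauchy_inequality)
      show "L holomorphic_on ball x (r / 4)"
        by (rule holomorphic_on_subset[OF hol]) auto
      show "continuous_on (cball x (r / 4)) L"
        by (rule holomorphic_on_imp_continuous_on[OF hol])
      show "0 < r / 4" using r by simp
      fix y assume "norm (x - y) = r / 4"
      then have "y \<in> cball x (r / 4)" by (simp add: dist_norm)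
      then have "y \<in> cball c (r / 2)" using sub by auto
      then show "norm (L y) \<le> B" by (intro B) (simp add: dist_norm norm_minus_commute)
    qed
    then show ?thesis using k by simp
  qed
  have "cmod ((deriv ^^ Suc 0) L s - (\<Sum>i\<le>k - 1. (deriv ^^ Suc i) L c * (s - c) ^ i / fact i))
    \<le> fact (Suc k) * B / (r / 4) ^ Suc k * cmod (s - c) ^ Suc (k - 1) / fact (k - 1)"
    by (rule complex_Taylor[where S = S and f = "\<lambda>i. (deriv ^^ Suc i) L"])
       (use der bound s r in \<open>auto simp: S_def dist_norm norm_minus_commute\<close>)
  moreover have "{..k - 1} = {..<k}" using k by auto
  ultimately show ?thesis using k by (simp add: higher del: funpow.simps)
qed

section \<open>Polar parts and their Taylor polynomials\<close>

lemma higher_deriv_inverse_diff: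
  fixes a z :: complex
  assumes "z \<noteq> a"
  shows "(deriv ^^ i) (\<lambda>w. 1 / (w - a)) z = (-1) ^ i * fact i / (z - a) ^ Suc i"
  using assms
proof (induction i arbitrary: z)
  case (Suc i)
  have "(deriv ^^ Suc i) (\<lambda>w. 1 / (w - a)) z = deriv ((deriv ^^ i) (\<lambda>w. 1 / (w - a))) z" by simp
  also have "\<dots> = deriv (\<lambda>w. (-1) ^ i * fact i / (w - a) ^ Suc i) z"
  proof (rule deriv_cong_ev[OF _ refl])
    have "eventually (\<lambda>w. w \<in> - {a}) (nhds z)"
      using Suc.prems by (intro eventually_nhds_in_open) auto
    then show "\<forall>\<^sub>F w in nhds z. (deriv ^^ i) (\<lambda>w. 1 / (w - a)) w = (-1) ^ i * fact i / (w - a) ^ Suc i"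
      by eventually_elim (use Suc.IH in auto)
  qed
  also have "\<dots> = (-1) ^ Suc i * fact (Suc i) / (z - a) ^ Suc (Suc i)"
  proof (rule DERIV_imp_deriv)
    have nz: "z - a \<noteq> 0" using Suc.prems by simp
    have "((\<lambda>w. (w - a) ^ Suc i) has_field_derivative of_nat (Suc i) * (z - a) ^ i) (at z)"
      by (auto intro!: derivative_eq_intros simp del: power_Suc)
    then have "((\<lambda>w. (-1) ^ i * fact i / (w - a) ^ Suc i) has_field_derivative
      (0 * (z - a) ^ Suc i - (-1) ^ i * fact i * (of_nat (Suc i) * (z - a) ^ i)) /
        ((z - a) ^ Suc i * (z - a) ^ Suc i)) (at z)"
      using nz by (intro DERIV_divide DERIV_const) auto
    moreover have "(0 * (z - a) ^ Suc i - (-1) ^ i * fact i * (of_nat (Suc i) * (z - a) ^ i)) /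
        ((z - a) ^ Suc i * (z - a) ^ Suc i) = (-1) ^ Suc i * fact (Suc i) / (z - a) ^ Suc (Suc i)"
      using nz by (simp add: divide_simps)
    ultimately show "((\<lambda>w. (-1) ^ i * fact i / (w - a) ^ Suc i) has_field_derivative
      (-1) ^ Suc i * fact (Suc i) / (z - a) ^ Suc (Suc i)) (at z)" by simp
  qed
  finally show ?case .
qed auto

text \<open>The exact tail of a geometric series. It is the contribution of one zero
  \<open>a\<close> to the logarithmic derivative with its Taylor polynomial at \<open>c\<close>
  removed, and takes the place of the convergence factors in a Hadamard product.\<close>

lemma pole_taylor_remainder:
  fixes s a c :: complex
  assumes "s \<noteq> a" "c \<noteq> a"
  shows "1 / (s - a) - (\<Sum>i<k. (-1) ^ i * fact i / (c - a) ^ Suc i * (s - c) ^ i / fact i)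
    = (s - c) ^ k / ((a - c) ^ k * (s - a))"
proof (induction k)
  case (Suc k)
  define x y where "x = s - c" and "y = a - c"
  have y: "y \<noteq> 0" "x - y \<noteq> 0" "s - a = x - y" "c - a = - y" using assms by (auto simp: x_def y_def)
  have "1 / (s - a) - (\<Sum>i<Suc k. (-1) ^ i * fact i / (c - a) ^ Suc i * (s - c) ^ i / fact i)
    = x ^ k / (y ^ k * (x - y)) - (-1) ^ k / (- y) ^ Suc k * x ^ k"
    using Suc by (simp add: x_def[symmetric] y)(simp add: y_def)
  also have "(-1) ^ k / (- y) ^ Suc k = - 1 / y ^ Suc k"
    by (simp add: power_minus[of y])
  also have "x ^ k / (y ^ k * (x - y)) - - 1 / y ^ Suc k * x ^ k = x ^ Suc k / (y ^ Suc k * (x - y))"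
    using y(1,2) by (simp add: field_simps)
  finally show ?case by (simp add: x_def[symmetric] y_def[symmetric] y(3))
qed auto

lemma prod_power_log_deriv:
  fixes m :: "complex \<Rightarrow> nat"
  assumes "finite A" "z \<notin> A"
  shows "((\<lambda>z. \<Prod>a\<in>A. (z - a) ^ m a) has_field_derivative
    (\<Prod>a\<in>A. (z - a) ^ m a) * (\<Sum>a\<in>A. of_nat (m a) / (z - a))) (at z)"
  using assms
proof (induction rule: finite_induct)
  case (insert b A)
  have zb: "z - b \<noteq> 0" using insert by auto
  have pw: "((\<lambda>z. (z - b) ^ m b) has_field_derivative (z - b) ^ m b * (of_nat (m b) / (z - b))) (at z)"
  proof (cases "m b")
    case (Suc n)
    have "((\<lambda>z. (z - b) ^ Suc n) has_field_derivative of_nat (Suc n) * (z - b) ^ n) (at z)"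
      by (auto intro!: derivative_eq_intros simp del: power_Suc)
    then show ?thesis using zb by (simp add: Suc mult.commute[of "(z - b) ^ n"])
  qed auto
  show ?case
    using DERIV_mult[OF pw insert.IH] insert by (simp add: algebra_simps)
qed auto

lemma entire_finite_zeros:
  assumes f: "f holomorphic_on UNIV" and nz: "f w0 \<noteq> 0"
  shows "finite {z. norm z \<le> R \<and> f z = 0}"
proof (cases "f constant_on UNIV")
  case True
  then have "f z \<noteq> 0" for z using nz by (metis UNIV_I constant_on_def)
  then show ?thesis by simp
next
  case False
  have "finite {z \<in> cball 0 R. f z = 0}"
    by (rule holomorphic_compact_finite_zeros[OF f]) (use False in auto)
  then show ?thesis by simp
qed

lemma higher_deriv_diff_sum_poles:
  fixes c :: complex
  assumes \<phi>: "\<phi> analytic_on {c}" and "finite A" "c \<notin> A"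
  shows "(deriv ^^ i) (\<lambda>z. \<phi> z - (\<Sum>a\<in>A. m a * (1 / (z - a)))) c =
    (deriv ^^ i) \<phi> c - (\<Sum>a\<in>A. m a * ((-1) ^ i * fact i / (c - a) ^ Suc i))"
  using assms(2,3)
proof (induction rule: finite_induct)
  case (insert b A)
  have an: "(\<lambda>z. \<phi> z - (\<Sum>a\<in>A. m a * (1 / (z - a)))) analytic_on {c}"
    using insert.prems by (intro analytic_intros \<phi>) auto
  have an2: "(\<lambda>z. 1 / (z - b)) analytic_on {c}"
    using insert.prems by (intro analytic_intros) auto
  have e1: "(\<lambda>z. \<phi> z - (\<Sum>a\<in>insert b A. m a * (1 / (z - a)))) =
    (\<lambda>z. (\<phi> z - (\<Sum>a\<in>A. m a * (1 / (z - a)))) - m b * (1 / (z - b)))"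
    using insert.hyps by (auto simp: algebra_simps)
  have e2: "(deriv ^^ i) (\<lambda>z. (\<phi> z - (\<Sum>a\<in>A. m a * (1 / (z - a)))) - m b * (1 / (z - b))) c =
    (deriv ^^ i) (\<lambda>z. \<phi> z - (\<Sum>a\<in>A. m a * (1 / (z - a)))) c - (deriv ^^ i) (\<lambda>z. m b * (1 / (z - b))) c"
    by (rule higher_deriv_diff_at[OF an analytic_on_mult[OF analytic_on_const an2]])
  have e3: "(deriv ^^ i) (\<lambda>z. m b * (1 / (z - b))) c = m b * (deriv ^^ i) (\<lambda>z. 1 / (z - b)) c"
    by (rule higher_deriv_cmult'[OF an2])
  have e4: "(deriv ^^ i) (\<lambda>z. 1 / (z - b)) c = (-1) ^ i * fact i / (c - b) ^ Suc i"
    using insert.prems by (intro higher_deriv_inverse_diff) auto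
  have e5: "(deriv ^^ i) (\<lambda>z. \<phi> z - (\<Sum>a\<in>A. m a * (1 / (z - a)))) c =
    (deriv ^^ i) \<phi> c - (\<Sum>a\<in>A. m a * ((-1) ^ i * fact i / (c - a) ^ Suc i))"
    using insert.IH insert.prems by blast
  show ?case unfolding e1 e2 e3 e4 e5 using insert.hyps by simp
qed auto

text \<open>Divide \<open>f\<close> by its zeros in the disc of radius \<open>R\<close> and
  normalise at \<open>c\<close>. On the circle of radius \<open>3 * R\<close> each factor
  \<open>z - a\<close> is at least as large as \<open>c - a\<close>, so the quotient
  \<open>Q\<close> inherits the bound for \<open>f\<close>, and by the maximum principle keeps it
  inside. On a disc around \<open>c\<close> it has a logarithm \<open>L\<close>, to which
  Borel-Caratheodory and the Taylor remainder apply. Once the Taylor polynomials of the polar terms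
  are moved to the other side, the remaining coefficients depend on \<open>f\<close> and
  \<open>c\<close> only, not on \<open>R\<close>.\<close>

lemma entire_log_deriv_expansion_bound:
  fixes f :: "complex \<Rightarrow> complex" and A R k c
  defines "A \<equiv> {a. norm a < R \<and> f a = 0}"
  assumes f: "f holomorphic_on UNIV" and fc: "f c \<noteq> 0" and k: "0 < k"
    and R: "R > 2 * norm c" "norm (s - c) \<le> (R - norm c) / 4" and fs: "f s \<noteq> 0"
    and B: "\<And>z. norm z = 3 * R \<Longrightarrow> norm (f z) \<le> exp B" and B': "ln (norm (f c)) < B"
  shows "norm ((deriv f s / f s - (\<Sum>a\<in>A. of_int (zorder f a) * ((s - c) ^ k / ((a - c) ^ k * (s - a))))) -
     (\<Sum>i<k. (deriv ^^ i) (\<lambda>z. deriv f z / f z) c / fact i * (s - c) ^ i))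
    \<le> fact (Suc k) * (4 * (B - ln (norm (f c)))) / ((R - norm c) / 4) ^ Suc k
        * norm (s - c) ^ k / fact (k - 1)"
proof -
  have finA: "finite A"
    using entire_finite_zeros[OF f fc, of R] by (rule rev_finite_subset) (auto simp: A_def)
  have R0: "R > 0" "R > norm c" using R(1) norm_ge_zero[of c] by linarith+
  define m where "m a = nat (zorder f a)" for a
  have zo: "zorder f a = int (m a)" for a
  proof -
    have "\<exists>w\<in>UNIV. f w \<noteq> 0" using fc by blast
    from zorder_exist_zero[OF f open_UNIV connected_UNIV UNIV_I[of a] this]
    show ?thesis by (auto simp: m_def split: if_splits)
  qed
  obtain q where q: "q holomorphic_on UNIV" "\<And>a. a \<in> A \<Longrightarrow> q a \<noteq> 0"
    "\<And>z. f z = q z * (\<Prod>a\<in>A. (z - a) ^ m a)"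
    using entire_factor_zeros[OF f fc finA] unfolding m_def by blast
  have qnz: "q z \<noteq> 0" if "norm z < R" for z
    using q(2)[of z] q(3)[of z] that by (auto simp: A_def)
  define r where "r = R - norm c"
  have r: "r > 0" using R0 by (simp add: r_def)
  have ballr: "norm z < R" if "z \<in> ball c r" for z
    using that norm_triangle_ineq2[of z c] by (simp add: r_def dist_norm norm_minus_commute)
  have qc: "q c \<noteq> 0" using qnz R0 by simp
  define Q where "Q z = q z / q c" for z
  have Qhol: "Q holomorphic_on UNIV" unfolding Q_def by (intro holomorphic_intros q(1)) (use qc in auto)
  define B1 where "B1 = B - ln (norm (f c))"
  have Qbound: "norm (Q z) \<le> exp B1" if "norm z = 3 * R" for z
  proof -
    have za: "norm (c - a) \<le> norm (z - a)" "norm (c - a) > 0" if a: "a \<in> A" for a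
    proof -
      have "norm a < R" using a by (simp add: A_def)
      then show "norm (c - a) \<le> norm (z - a)"
        using norm_triangle_ineq4[of c a] norm_triangle_ineq2[of z a] \<open>norm z = 3 * R\<close> R0 by linarith
      show "norm (c - a) > 0" using a fc by (auto simp: A_def)
    qed
    define p where "p = (\<lambda>z. \<Prod>a\<in>A. (z - a) ^ m a)"
    have "norm (p c) \<le> norm (p z)" unfolding p_def
      by (auto simp: prod_norm[symmetric] norm_power intro!: prod_mono power_mono za)
    moreover have "norm (p c) > 0" using fc q(3)[of c] by (auto simp: p_def)
    ultimately have "norm (q z) * norm (p c) \<le> norm (f z)"
      unfolding q(3)[of z] norm_mult p_def by (intro mult_left_mono) auto
    also have "\<dots> \<le> exp B" by (rule B[OF that])
    finally have "norm (q z) * norm (p c) / norm (f c) \<le> exp B / norm (f c)"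
      using fc by (simp add: divide_right_mono)
    also have "norm (q z) * norm (p c) / norm (f c) = norm (Q z)"
    proof -
      have "f c = q c * p c" by (simp add: q(3)[of c] p_def)
      then show ?thesis using \<open>norm (p c) > 0\<close> qc by (simp add: norm_mult Q_def norm_divide)
    qed
    also have "exp B / norm (f c) = exp B1" using fc by (simp add: B1_def exp_diff)
    finally show ?thesis .
  qed
  have Qball: "norm (Q z) \<le> exp B1" if "norm z < R" for z
  proof -
    define S where "S = ball (0 :: complex) (3 * R)"
    have 1: "Q holomorphic_on interior S" by (rule holomorphic_on_subset[OF Qhol]) auto
    have 2: "continuous_on (closure S) Q"
      by (rule holomorphic_on_imp_continuous_on[OF holomorphic_on_subset[OF Qhol]]) auto
    have 3: "norm (Q w) \<le> exp B1" if "w \<in> frontier S" for w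
      using that R0 by (intro Qbound) (auto simp: S_def)
    show ?thesis
      by (rule maximum_modulus_frontier[OF 1 2 _ 3]) (use that R0 in \<open>auto simp: S_def\<close>)
  qed
  have Qnz: "Q z \<noteq> 0" if "z \<in> ball c r" for z using qnz[OF ballr[OF that]] qc by (simp add: Q_def)
  obtain L0 where L0: "L0 holomorphic_on ball c r" "\<And>z. z \<in> ball c r \<Longrightarrow> Q z = exp (L0 z)"
    using contractible_imp_holomorphic_log[OF holomorphic_on_subset[OF Qhol subset_UNIV]
      convex_imp_contractible[OF convex_ball] Qnz] by blast
  define L where "L z = L0 z - L0 c" for z
  have cin: "c \<in> ball c r" using r by simp
  have Lhol: "L holomorphic_on ball c r" unfolding L_def by (intro holomorphic_intros L0)
  have expL: "exp (L z) = Q z" if "z \<in> ball c r" for z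
    using L0(2)[OF that] L0(2)[OF cin] qc by (simp add: L_def exp_diff Q_def)
  \<comment> \<open>\<open>B1\<close> is positive by \<open>B'\<close>, and doubling it turns the
    weak inequality into the strict one that Borel-Caratheodory asks for.\<close>
  have ReL: "Re (L z) < 2 * B1" if "z \<in> ball c r" for z
  proof -
    have "exp (Re (L z)) \<le> exp B1"
      using Qball[OF ballr[OF that]] expL[OF that] by (metis norm_exp_eq_Re)
    then show ?thesis using B' by (simp add: B1_def)
  qed
  have Lbound: "norm (L z) \<le> 2 * (2 * B1)" if "norm (z - c) \<le> r / 2" for z
    by (rule borel_caratheodory_half[OF Lhol _ r ReL that]) (simp add: L_def)
  have main: "norm (deriv L s - (\<Sum>i<k. (deriv ^^ i) (deriv L) c * (s - c) ^ i / fact i))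
    \<le> fact (Suc k) * (2 * (2 * B1)) / (r / 4) ^ Suc k * norm (s - c) ^ k / fact (k - 1)"
    by (rule deriv_taylor_remainder[OF Lhol r k Lbound]) (use R(2) in \<open>auto simp: r_def\<close>)
  have derL: "deriv L z = deriv f z / f z - (\<Sum>a\<in>A. of_nat (m a) * (1 / (z - a)))"
    if z: "z \<in> ball c r" "f z \<noteq> 0" for z
  proof -
    define p where "p = (\<lambda>z. \<Prod>a\<in>A. (z - a) ^ m a)"
    have zA: "z \<notin> A" using z by (auto simp: A_def)
    have dp: "(p has_field_derivative p z * (\<Sum>a\<in>A. of_nat (m a) / (z - a))) (at z)"
      unfolding p_def by (rule prod_power_log_deriv[OF finA zA])
    have dL: "(L has_field_derivative deriv L z) (at z)"
      by (rule holomorphic_derivI[OF Lhol _ z(1)]) simp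
    define D where "D = q c * (exp (L z) * deriv L z) * p z +
      p z * (\<Sum>a\<in>A. of_nat (m a) / (z - a)) * (q c * exp (L z))"
    have d1: "((\<lambda>w. q c * exp (L w) * p w) has_field_derivative D) (at z)"
      unfolding D_def by (intro DERIV_mult DERIV_cmult DERIV_chain2[OF DERIV_exp dL] dp)
    have ff: "q c * exp (L w) * p w = f w" if "w \<in> ball c r" for w
      using expL[OF that] qc by (simp add: q(3)[of w] p_def Q_def)
    have "(f has_field_derivative D) (at z)"
      by (rule has_field_derivative_transform_within_open[OF d1 open_ball z(1) ff])
    then have "deriv f z = D" by (rule DERIV_imp_deriv)
    also have "D = f z * (deriv L z + (\<Sum>a\<in>A. of_nat (m a) / (z - a)))"
      unfolding D_def ff[OF z(1), symmetric] by (simp add: algebra_simps)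
    finally show ?thesis using z(2) by simp
  qed
  define \<phi> where "\<phi> = (\<lambda>z. deriv f z / f z)"
  have fan: "f analytic_on {c}" using f by (auto simp: analytic_on_holomorphic)
  have \<phi>an: "\<phi> analytic_on {c}" unfolding \<phi>_def
    by (intro analytic_on_divide analytic_deriv fan) (use fc in auto)
  have cA: "c \<notin> A" using fc by (auto simp: A_def)
  have hd: "(deriv ^^ i) (deriv L) c = (deriv ^^ i) \<phi> c - (\<Sum>a\<in>A. of_nat (m a) * ((-1) ^ i * fact i / (c - a) ^ Suc i))" for i
  proof -
    have "\<forall>\<^sub>F w in nhds c. f w \<noteq> 0"
      using entire_nonzero_eventually[OF f fc, of c] unfolding eventually_at_filter
      by eventually_elim (use fc in auto)
    moreover have "\<forall>\<^sub>F w in nhds c. w \<in> ball c r" using cin by (intro eventually_nhds_in_open) auto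
    ultimately have "\<forall>\<^sub>F w in nhds c. deriv L w = \<phi> w - (\<Sum>a\<in>A. of_nat (m a) * (1 / (w - a)))"
      by eventually_elim (simp add: derL \<phi>_def)
    then have "(deriv ^^ i) (deriv L) c = (deriv ^^ i) (\<lambda>w. \<phi> w - (\<Sum>a\<in>A. of_nat (m a) * (1 / (w - a)))) c"
      by (rule higher_deriv_cong_ev) simp
    then show ?thesis by (simp only: higher_deriv_diff_sum_poles[OF \<phi>an finA cA])
  qed
  have sin: "s \<in> ball c r" using R(2) r by (simp add: r_def dist_norm norm_minus_commute)
  have "deriv L s - (\<Sum>i<k. (deriv ^^ i) (deriv L) c * (s - c) ^ i / fact i) =
    \<phi> s - (\<Sum>i<k. (deriv ^^ i) \<phi> c / fact i * (s - c) ^ i) -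
    (\<Sum>a\<in>A. of_nat (m a) * (1 / (s - a) - (\<Sum>i<k. (-1) ^ i * fact i / (c - a) ^ Suc i * (s - c) ^ i / fact i)))"
  proof -
    have "(\<Sum>i<k. (deriv ^^ i) (deriv L) c * (s - c) ^ i / fact i) =
      (\<Sum>i<k. (deriv ^^ i) \<phi> c / fact i * (s - c) ^ i -
        (\<Sum>a\<in>A. of_nat (m a) * ((-1) ^ i * fact i / (c - a) ^ Suc i * (s - c) ^ i / fact i)))"
      by (rule sum.cong[OF refl])
         (simp add: hd left_diff_distrib diff_divide_distrib sum_distrib_right sum_divide_distrib mult.assoc del: power_Suc)
    also have "\<dots> = (\<Sum>i<k. (deriv ^^ i) \<phi> c / fact i * (s - c) ^ i) -
      (\<Sum>a\<in>A. of_nat (m a) * (\<Sum>i<k. (-1) ^ i * fact i / (c - a) ^ Suc i * (s - c) ^ i / fact i))"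
      unfolding sum_subtractf sum_distrib_left by (subst sum.swap[of _ A]) (rule refl)
    finally show ?thesis
      unfolding derL[OF sin fs] right_diff_distrib sum_subtractf \<phi>_def by simp
  qed
  also have "(\<Sum>a\<in>A. of_nat (m a) * (1 / (s - a) - (\<Sum>i<k. (-1) ^ i * fact i / (c - a) ^ Suc i * (s - c) ^ i / fact i)))
    = (\<Sum>a\<in>A. of_int (zorder f a) * ((s - c) ^ k / ((a - c) ^ k * (s - a))))"
  proof (rule sum.cong[OF refl])
    fix a assume "a \<in> A"
    then have "s \<noteq> a" "c \<noteq> a" using fs cA by (auto simp: A_def)
    from pole_taylor_remainder[OF this] show "of_nat (m a) * (1 / (s - a) - (\<Sum>i<k. (-1) ^ i * fact i / (c - a) ^ Suc i * (s - c) ^ i / fact i)) =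
      of_int (zorder f a) * ((s - c) ^ k / ((a - c) ^ k * (s - a)))"
      by (simp add: zo)
  qed
  finally have "deriv L s - (\<Sum>i<k. (deriv ^^ i) (deriv L) c * (s - c) ^ i / fact i) =
    deriv f s / f s - (\<Sum>a\<in>A. of_int (zorder f a) * ((s - c) ^ k / ((a - c) ^ k * (s - a)))) -
     (\<Sum>i<k. (deriv ^^ i) (\<lambda>z. deriv f z / f z) c / fact i * (s - c) ^ i)"
    by (simp add: \<phi>_def)
  moreover have "2 * (2 * B1) = 4 * (B - ln (norm (f c)))" by (simp add: B1_def)
  ultimately show ?thesis using main by (simp only: r_def)
qed

text \<open>Let the radius \<open>n\<close> tend to infinity in the preceding bound, with
  \<open>B = (3 * n) ^ k\<close>: for fixed \<open>s\<close> the remainder is of order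
  \<open>n ^ k / n ^ Suc k\<close>. The sum over zeros is a limit over discs here; absolute
  convergence comes later, from the counting hypotheses.\<close>

lemma entire_log_deriv_expansion:
  fixes f :: "complex \<Rightarrow> complex"
  assumes f: "f holomorphic_on UNIV" and fc: "f c \<noteq> 0" and k: "0 < k" "\<kappa> \<le> real k"
    and growth: "eventually (\<lambda>z. norm (f z) \<le> exp (norm z powr \<kappa>)) at_infinity" and fs: "f s \<noteq> 0"
  shows "(\<lambda>n. deriv f s / f s - (\<Sum>a | norm a < real n \<and> f a = 0.
       of_int (zorder f a) * ((s - c) ^ k / ((a - c) ^ k * (s - a)))))
    \<longlonglongrightarrow> (\<Sum>i<k. (deriv ^^ i) (\<lambda>z. deriv f z / f z) c / fact i * (s - c) ^ i)"
proof -
  obtain b where b: "\<And>z. norm z \<ge> b \<Longrightarrow> norm (f z) \<le> exp (norm z powr \<kappa>)"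
    using growth by (auto simp: eventually_at_infinity)
  define K where "K = fact (Suc k) * norm (s - c) ^ k / fact (k - 1)"
  define l where "l = ln (norm (f c))"
  define bd where "bd n = fact (Suc k) * (4 * ((3 * real n) ^ k - l)) / ((real n - norm c) / 4) ^ Suc k * norm (s - c) ^ k / fact (k - 1)" for n
  have "(\<lambda>n. bd n) \<longlonglongrightarrow> 0"
  proof -
    have "(\<lambda>n. (4 * ((3 * real n) ^ k - l)) / ((real n - norm c) / 4) ^ Suc k) \<longlonglongrightarrow> 0"
    proof -
      have e: "(\<lambda>n. 4 * (3 ^ k * inverse (real n) - l * inverse (real n) ^ Suc k) / ((1 - norm c * inverse (real n)) / 4) ^ Suc k) \<longlonglongrightarrow>
          4 * (3 ^ k * 0 - l * 0 ^ Suc k) / ((1 - norm c * 0) / 4) ^ Suc k"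
        by (intro tendsto_intros lim_inverse_n) auto
      have G: "4 * (3 ^ k * inverse x - l * inverse x ^ Suc k) / ((1 - norm c * inverse x) / 4) ^ Suc k
         = (4 * ((3 * x) ^ k - l)) / ((x - norm c) / 4) ^ Suc k" if x: "x > 0" for x :: real
      proof -
        have "(1 - norm c * inverse x) / 4 = ((x - norm c) / 4) / x" using x by (simp add: field_simps)
        then have 1: "((1 - norm c * inverse x) / 4) ^ Suc k = ((x - norm c) / 4) ^ Suc k / x ^ Suc k"
          by (simp only: power_divide)
        have "(3 * x) ^ k / x ^ Suc k = 3 ^ k * inverse x"
          using x by (simp add: power_mult_distrib divide_inverse)
        moreover have "l * inverse x ^ Suc k = l / x ^ Suc k"
          by (simp only: power_inverse divide_inverse)
        ultimately have 2: "3 ^ k * inverse x - l * inverse x ^ Suc k = ((3 * x) ^ k - l) / x ^ Suc k"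
          by (simp only: diff_divide_distrib)
        have "4 * (Y / X) / (D / X) = 4 * Y / D" if "X \<noteq> 0" for X Y D :: real
          using that by simp
        from this[of "x ^ Suc k"] show ?thesis unfolding 1 2 using x by simp
      qed
      have "\<forall>\<^sub>F n in sequentially. 4 * (3 ^ k * inverse (real n) - l * inverse (real n) ^ Suc k) / ((1 - norm c * inverse (real n)) / 4) ^ Suc k
         = (4 * ((3 * real n) ^ k - l)) / ((real n - norm c) / 4) ^ Suc k"
        by (intro eventually_mono[OF eventually_gt_at_top[of 0]] G) simp
      from Lim_transform_eventually[OF e this] show ?thesis using k by simp
    qed
    then have lim: "(\<lambda>n. K * ((4 * ((3 * real n) ^ k - l)) / ((real n - norm c) / 4) ^ Suc k)) \<longlonglongrightarrow> K * 0"
      by (rule tendsto_mult_left)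
    show ?thesis
    proof -
      have "K * (Y / D) = fact (Suc k) * Y / D * norm (s - c) ^ k / fact (k - 1)" for Y D :: real
        by (simp add: K_def divide_inverse mult_ac del: fact_Suc)
      from lim[unfolded this] show ?thesis unfolding bd_def by (simp only: mult_zero_right)
    qed
  qed
  moreover have "\<forall>\<^sub>F n in sequentially. norm ((deriv f s / f s - (\<Sum>a | norm a < real n \<and> f a = 0.
       of_int (zorder f a) * ((s - c) ^ k / ((a - c) ^ k * (s - a))))) -
     (\<Sum>i<k. (deriv ^^ i) (\<lambda>z. deriv f z / f z) c / fact i * (s - c) ^ i)) \<le> bd n"
  proof -
    have e1: "\<forall>\<^sub>F n in sequentially. real n > max 1 (max (\<bar>b\<bar>) (max (2 * norm c) (max (norm c + 4 * norm (s - c)) (\<bar>l\<bar>))))"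
      by (rule eventually_compose_filterlim[OF eventually_gt_at_top filterlim_real_sequentially])
    then show ?thesis
    proof eventually_elim
      case (elim n)
      define x where "x = real n"
      have x: "x > 1" "x > \<bar>b\<bar>" "x > 2 * norm c" "x > norm c + 4 * norm (s - c)" "x > \<bar>l\<bar>"
        using elim by (auto simp: x_def)
      have B: "norm (f z) \<le> exp ((3 * x) ^ k)" if "norm z = 3 * x" for z
      proof -
        have "norm (f z) \<le> exp ((3 * x) powr \<kappa>)" using b[of z] that x by simp
        also have "(3 * x) powr \<kappa> \<le> (3 * x) powr real k" using x k by (intro powr_mono) auto
        also have "\<dots> = (3 * x) ^ k" using x by (simp add: powr_realpow)
        finally show ?thesis by simp
      qed
      have "3 * x \<le> (3 * x) ^ k" using x k self_le_power[of "3 * x" k] by simp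
      then have B': "ln (norm (f c)) < (3 * x) ^ k" using x(1,5) by (simp add: l_def[symmetric])
      show ?case
        using entire_log_deriv_expansion_bound[OF f fc k(1) x(3) _ fs B B'] x(4)
        unfolding bd_def x_def[symmetric] l_def[symmetric] by simp
    qed
  qed
  ultimately have "(\<lambda>n. (deriv f s / f s - (\<Sum>a | norm a < real n \<and> f a = 0.
       of_int (zorder f a) * ((s - c) ^ k / ((a - c) ^ k * (s - a))))) -
     (\<Sum>i<k. (deriv ^^ i) (\<lambda>z. deriv f z / f z) c / fact i * (s - c) ^ i)) \<longlonglongrightarrow> 0"
    by (rule Lim_null_comparison[rotated])
  then show ?thesis by (simp add: LIM_zero_iff)
qed

section \<open>Logarithmic derivatives of meromorphic functions of finite order\<close>

lemma entire_nonconst_eventually_at: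
  assumes "f holomorphic_on UNIV" "f w0 \<noteq> 0"
  shows "f analytic_on {z}" "f meromorphic_on {z}" "frequently (\<lambda>w. f w \<noteq> 0) (at z)"
proof -
  show "f analytic_on {z}" using assms(1) by (auto simp: analytic_on_holomorphic)
  then show "f meromorphic_on {z}" by (rule analytic_on_imp_meromorphic_on)
  show "frequently (\<lambda>w. f w \<noteq> 0) (at z)"
    using entire_nonzero_eventually[OF assms] by (simp add: eventually_frequently)
qed

lemma singular_points_iff_zorder:
  assumes "f meromorphic_on UNIV" "\<And>z. eventually (\<lambda>w. f w \<noteq> 0) (at z)"
  shows "z \<in> singular_points f \<longleftrightarrow> zorder f z \<noteq> 0"
proof
  have mer: "f meromorphic_on {z}" using assms(1) by (rule meromorphic_on_subset) auto
  then have iso: "isolated_singularity_at f z" by (simp add: meromorphic_at_iff)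
  {
    assume "z \<in> singular_points f"
    then show "zorder f z \<noteq> 0"
      using zorder_isolated_zero_pos'[OF _ iso] isolated_pole_imp_neg_zorder[OF iso]
      by (fastforce simp: singular_points_def)
  next
    assume "zorder f z \<noteq> 0"
    then show "z \<in> singular_points f"
      using zorder_pos_imp_isolated_zero[OF mer assms(2)] zorder_neg_imp_is_pole[OF mer assms(2)]
      by (auto simp: singular_points_def neq_iff)
  }
qed

lemma uncountable_interval_avoid:
  fixes a b :: real
  assumes "a < b" "countable B"
  obtains x where "a \<le> x" "x \<le> b" "x \<notin> B"
proof -
  have "uncountable {a..b}" using assms(1) by (simp add: uncountable_closed_interval)
  then have "\<not> {a..b} \<subseteq> B" using assms(2) countable_subset by blast
  then obtain x where "x \<in> {a..b}" "x \<notin> B" by blast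
  then show ?thesis by (intro that) auto
qed

text \<open>Once \<open>c\<close> is fixed, each point of the bad set excludes one step \<theta> for
  each positive index; \<open>E\<close> collects these countably many steps.\<close>

lemma progression_avoiding_countable:
  fixes C :: "complex set"
  assumes "countable C"
  obtains c \<theta> :: real where "2 \<le> c" "0 < \<theta>" "of_real c \<notin> C" "\<And>n::nat. of_real (c + real n * \<theta>) \<notin> C"
proof -
  define D where "D = {x :: real. complex_of_real x \<in> C}"
  have D: "countable D"
  proof -
    have "countable (Re ` C)" using assms by simp
    moreover have "D \<subseteq> Re ` C"
    proof
      fix x assume "x \<in> D"
      then have "complex_of_real x \<in> C" by (simp add: D_def)
      then have "Re (complex_of_real x) \<in> Re ` C" by (rule imageI)
      then show "x \<in> Re ` C" by simp
    qed
    ultimately show ?thesis by (rule countable_subset[rotated])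
  qed
  obtain c where c: "2 \<le> c" "c \<notin> D" using uncountable_interval_avoid[of 2 3 D] D by auto
  define E where "E = (\<Union>n::nat. (\<lambda>x. (x - c) / real (Suc n)) ` D)"
  have "countable E" unfolding E_def using D by auto
  then obtain \<theta> where t: "1 \<le> \<theta>" "\<theta> \<notin> E" using uncountable_interval_avoid[of 1 2 E] by auto
  have "c + real n * \<theta> \<notin> D" for n
  proof (cases n)
    case (Suc m)
    show ?thesis
    proof
      assume "c + real n * \<theta> \<in> D"
      then have "(c + real n * \<theta> - c) / real (Suc m) \<in> E" unfolding E_def by blast
      moreover have "(c + real n * \<theta> - c) / real (Suc m) = \<theta>"
        by (simp add: Suc del: of_nat_Suc)
      ultimately show False using t by simp
    qed
  qed (use c in simp)
  then show ?thesis using that[of c \<theta>] c t by (auto simp: D_def)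
qed

lemma quotient_log_deriv:
  assumes g: "g holomorphic_on UNIV" and h: "h holomorphic_on UNIV"
    and Z: "\<And>z. h z \<noteq> 0 \<Longrightarrow> Z z = g z / h z" and s: "g s \<noteq> 0" "h s \<noteq> 0"
  shows "deriv Z s / Z s = deriv g s / g s - deriv h s / h s"
proof -
  have dg: "(g has_field_derivative deriv g s) (at s)" by (rule holomorphic_derivI[OF g]) auto
  have dh: "(h has_field_derivative deriv h s) (at s)" by (rule holomorphic_derivI[OF h]) auto
  have "\<forall>\<^sub>F w in nhds s. h w \<noteq> 0"
    using entire_nonzero_eventually[OF h s(2), of s] unfolding eventually_at_filter
    by eventually_elim (use s in auto)
  then have "\<forall>\<^sub>F w in nhds s. Z w = g w / h w" by eventually_elim (rule Z)
  then have "deriv Z s = deriv (\<lambda>w. g w / h w) s" by (rule deriv_cong_ev) simp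
  also have "\<dots> = (deriv g s * h s - g s * deriv h s) / (h s * h s)"
    by (rule DERIV_imp_deriv[OF DERIV_divide[OF dg dh s(2)]])
  finally have "deriv Z s = (deriv g s * h s - g s * deriv h s) / (h s * h s)" .
  then have "deriv Z s / Z s = (deriv g s * h s - g s * deriv h s) / (h s * h s) / (g s / h s)"
    by (simp only: Z[OF s(2)])
  also have "\<dots> = deriv g s / g s - deriv h s / h s" using s by (simp add: field_simps)
  finally show ?thesis .
qed

text \<open>
  Numerator and denominator of \<open>Z\<close> may have common zeros, even where \<open>Z\<close> is regular. The
  points \<open>c + n * \<theta>\<close> avoid all of them.
\<close>

lemma meromorphic_finite_order_log_deriv_expansion:
  assumes fin: "meromorphic_finite_order Z" and nz: "eventually (\<lambda>z. Z z \<noteq> 0) (at p)"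
  shows "Z meromorphic_on UNIV" "eventually (\<lambda>w. Z w \<noteq> 0) (at z)" "finite (singular_points Z \<inter> {\<sigma>. norm \<sigma> \<le> R})"
    "\<exists>K c \<theta>. 2 \<le> c \<and> 0 < \<theta> \<and> (\<forall>k\<ge>K. \<exists>q. \<forall>n::nat. \<forall>s. s = of_real (c + real n * \<theta>) \<longrightarrow>
      (\<lambda>R. deriv Z s / Z s - (\<Sum>\<sigma> \<in> singular_points Z \<inter> {\<sigma>. norm \<sigma> < real R}.
         of_int (zorder Z \<sigma>) * ((s - of_real c) ^ k / ((\<sigma> - of_real c) ^ k * (s - \<sigma>)))))
       \<longlonglongrightarrow> (\<Sum>i<k. q i * (s - of_real c) ^ i))"
proof -
  from fin obtain g h where gh: "entire_finite_order g" "entire_finite_order h" "\<exists>z. h z \<noteq> 0"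
    and Z: "\<And>z. h z \<noteq> 0 \<Longrightarrow> Z z = g z / h z" and nice: "Z nicely_meromorphic_on UNIV"
    by (auto simp: meromorphic_finite_order_def)
  from gh obtain kg kh where g: "g holomorphic_on UNIV" and h: "h holomorphic_on UNIV"
    and gg: "eventually (\<lambda>z. norm (g z) \<le> exp (norm z powr kg)) at_infinity"
    and hg: "eventually (\<lambda>z. norm (h z) \<le> exp (norm z powr kh)) at_infinity"
    by (auto simp: entire_finite_order_def)
  obtain h0 where h0: "h h0 \<noteq> 0" using gh by auto
  have "\<exists>g0. g g0 \<noteq> 0"
  proof -
    have "\<forall>\<^sub>F w in at p. Z w \<noteq> 0 \<and> h w \<noteq> 0"
      using nz entire_nonzero_eventually[OF h h0, of p] by eventually_elim simp
    from eventually_happens'[OF at_neq_bot this] obtain w where "Z w \<noteq> 0" "h w \<noteq> 0" by blast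
    then show ?thesis using Z[of w] by auto
  qed
  then obtain g0 where g0: "g g0 \<noteq> 0" by auto
  show mer: "Z meromorphic_on UNIV" using nice by (simp add: nicely_meromorphic_on_def)
  have evnz: "eventually (\<lambda>w. Z w \<noteq> 0) (at z)" for z
    using entire_nonzero_eventually[OF h h0, of z] entire_nonzero_eventually[OF g g0, of z]
    by eventually_elim (simp add: Z)
  then show "eventually (\<lambda>w. Z w \<noteq> 0) (at z)" .
  \<comment> \<open>Common zeros cancel here: where \<open>g\<close> and \<open>h\<close> vanish to
    the same order, \<open>Z\<close> has order 0 and no singular point.\<close>
  have zo: "zorder Z z = zorder g z - zorder h z" for z
  proof -
    have "\<forall>\<^sub>F w in at z. Z w = g w / h w"
      using entire_nonzero_eventually[OF h h0, of z] by eventually_elim (rule Z)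
    then have "zorder Z z = zorder (\<lambda>w. g w / h w) z" by (rule zorder_cong) simp
    also have "\<dots> = zorder g z - zorder h z"
      by (rule zorder_divide) (rule entire_nonconst_eventually_at[OF g g0] entire_nonconst_eventually_at[OF h h0])+
    finally show ?thesis .
  qed
  have zg: "zorder g z = 0" if "g z \<noteq> 0" for z
    using zorder_eq_0_iff[OF entire_nonconst_eventually_at(1,3)[OF g g0]] that by simp
  have zh: "zorder h z = 0" if "h z \<noteq> 0" for z
    using zorder_eq_0_iff[OF entire_nonconst_eventually_at(1,3)[OF h h0]] that by simp
  define A where "A R = {a. norm a \<le> R \<and> g a = 0} \<union> {a. norm a \<le> R \<and> h a = 0}" for R
  have finA: "finite (A R)" for R unfolding A_def
    by (intro finite_UnI entire_finite_zeros[OF g g0] entire_finite_zeros[OF h h0])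
  have S: "z \<in> singular_points Z \<longleftrightarrow> zorder Z z \<noteq> 0" for z
    by (rule singular_points_iff_zorder[OF mer evnz])
  have SA: "singular_points Z \<inter> {\<sigma>. norm \<sigma> \<le> R} \<subseteq> A R" for R
  proof
    fix a assume "a \<in> singular_points Z \<inter> {\<sigma>. norm \<sigma> \<le> R}"
    then have "zorder g a - zorder h a \<noteq> 0" "norm a \<le> R" using S zo by auto
    then show "a \<in> A R" using zg[of a] zh[of a] by (cases "g a = 0"; cases "h a = 0") (auto simp: A_def)
  qed
  show "finite (singular_points Z \<inter> {\<sigma>. norm \<sigma> \<le> R})" by (rule finite_subset[OF SA finA])
  have count: "countable {z. f z = 0}" if "f holomorphic_on UNIV" "f w0 \<noteq> 0" for f :: "complex \<Rightarrow> complex" and w0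
  proof -
    have "{z. f z = 0} = (\<Union>n::nat. {z. norm z \<le> real n \<and> f z = 0})"
      using real_arch_simple by auto
    then show ?thesis using entire_finite_zeros[OF that] by (simp add: countable_finite)
  qed
  obtain c \<theta> :: real where c: "2 \<le> c" "0 < \<theta>" "of_real c \<notin> {z. g z = 0} \<union> {z. h z = 0}"
    "\<And>n::nat. of_real (c + real n * \<theta>) \<notin> {z. g z = 0} \<union> {z. h z = 0}"
    using progression_avoiding_countable[OF countable_Un[OF count[OF g g0] count[OF h h0]]] by blast
  \<comment> \<open>\<open>K\<close> depends only on the growth of \<open>g\<close> and
    \<open>h\<close>, and \<open>c\<close> and \<theta> are already fixed. So one progression serves
    all \<open>k\<close>, and \<open>k\<close> can later be taken large in terms of \<epsilon>.
    \<open>Suc\<close> keeps \<open>k\<close> positive.\<close>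
  define K where "K = Suc (nat \<lceil>max kg kh\<rceil>)"
  have "\<exists>q. \<forall>n::nat. \<forall>s. s = of_real (c + real n * \<theta>) \<longrightarrow>
      (\<lambda>R. deriv Z s / Z s - (\<Sum>\<sigma> \<in> singular_points Z \<inter> {\<sigma>. norm \<sigma> < real R}.
         of_int (zorder Z \<sigma>) * ((s - of_real c) ^ k / ((\<sigma> - of_real c) ^ k * (s - \<sigma>)))))
       \<longlonglongrightarrow> (\<Sum>i<k. q i * (s - of_real c) ^ i)" if k: "k \<ge> K" for k
  proof (intro exI allI impI)
    fix n s assume s: "s = complex_of_real (c + real n * \<theta>)"
    have k': "0 < k" "kg \<le> real k" "kh \<le> real k"
    proof -
      have "real (nat \<lceil>max kg kh\<rceil>) \<le> real k"
        using k unfolding K_def of_nat_le_iff by (rule Suc_leD)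
      moreover have "max kg kh \<le> real (nat \<lceil>max kg kh\<rceil>)" by linarith
      ultimately have "max kg kh \<le> real k" by linarith
      then show "kg \<le> real k" "kh \<le> real k" by simp_all
      show "0 < k" using k by (simp add: K_def)
    qed
    have nzs: "g c \<noteq> 0" "h c \<noteq> 0" "g s \<noteq> 0" "h s \<noteq> 0" using c(3) c(4)[of n] s by auto
    let ?T = "\<lambda>\<sigma>. (s - of_real c) ^ k / ((\<sigma> - of_real c) ^ k * (s - \<sigma>))"
    let ?q = "\<lambda>i. (deriv ^^ i) (\<lambda>z. deriv g z / g z) (of_real c) / fact i - (deriv ^^ i) (\<lambda>z. deriv h z / h z) (of_real c) / fact i"
    \<comment> \<open>The sums for \<open>g\<close>, \<open>h\<close> and \<open>Z\<close> are
      extended to the common finite index set \<open>A R\<close>, where the added points have order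
      0, so that they can be subtracted termwise.\<close>
    have sums: "(\<Sum>a | norm a < real R \<and> f a = 0. of_int (zorder f a) * ?T a) =
      (\<Sum>a \<in> A (real R) \<inter> {a. norm a < real R}. of_int (zorder f a) * ?T a)"
      if "f = g \<or> f = h" for f R
      by (rule sum.mono_neutral_left) (use finA that zg zh in \<open>auto simp: A_def\<close>)
    have sumZ: "(\<Sum>\<sigma> \<in> singular_points Z \<inter> {\<sigma>. norm \<sigma> < real R}. of_int (zorder Z \<sigma>) * ?T \<sigma>) =
      (\<Sum>a | norm a < real R \<and> g a = 0. of_int (zorder g a) * ?T a) -
      (\<Sum>a | norm a < real R \<and> h a = 0. of_int (zorder h a) * ?T a)" for R
    proof -
      have "(\<Sum>\<sigma> \<in> singular_points Z \<inter> {\<sigma>. norm \<sigma> < real R}. of_int (zorder Z \<sigma>) * ?T \<sigma>) =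
        (\<Sum>a \<in> A (real R) \<inter> {a. norm a < real R}. of_int (zorder Z a) * ?T a)"
      proof (rule sum.mono_neutral_left)
        show "finite (A (real R) \<inter> {a. norm a < real R})" using finA by simp
        show "singular_points Z \<inter> {\<sigma>. norm \<sigma> < real R} \<subseteq> A (real R) \<inter> {a. norm a < real R}"
          using SA[of "real R"] by auto
        show "\<forall>i\<in>A (real R) \<inter> {a. norm a < real R} - singular_points Z \<inter> {\<sigma>. norm \<sigma> < real R}.
          of_int (zorder Z i) * ?T i = 0" using S by auto
      qed
      also have "\<dots> = (\<Sum>a \<in> A (real R) \<inter> {a. norm a < real R}. of_int (zorder g a) * ?T a - of_int (zorder h a) * ?T a)"
        by (rule sum.cong[OF refl]) (simp only: zo of_int_diff left_diff_distrib)
      finally show ?thesis using sums by (simp only: sum_subtractf simp_thms)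
    qed
    have "(\<lambda>R. (deriv g s / g s - (\<Sum>a | norm a < real R \<and> g a = 0. of_int (zorder g a) * ?T a)) -
        (deriv h s / h s - (\<Sum>a | norm a < real R \<and> h a = 0. of_int (zorder h a) * ?T a))) \<longlonglongrightarrow>
        (\<Sum>i<k. (deriv ^^ i) (\<lambda>z. deriv g z / g z) (of_real c) / fact i * (s - of_real c) ^ i) -
        (\<Sum>i<k. (deriv ^^ i) (\<lambda>z. deriv h z / h z) (of_real c) / fact i * (s - of_real c) ^ i)"
      by (rule tendsto_diff[OF entire_log_deriv_expansion[OF g nzs(1) k'(1,2) gg nzs(3)]
            entire_log_deriv_expansion[OF h nzs(2) k'(1,3) hg nzs(4)]])
    moreover have "(\<lambda>R. (deriv g s / g s - (\<Sum>a | norm a < real R \<and> g a = 0. of_int (zorder g a) * ?T a)) -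
        (deriv h s / h s - (\<Sum>a | norm a < real R \<and> h a = 0. of_int (zorder h a) * ?T a))) =
      (\<lambda>R. deriv Z s / Z s - (\<Sum>\<sigma> \<in> singular_points Z \<inter> {\<sigma>. norm \<sigma> < real R}. of_int (zorder Z \<sigma>) * ?T \<sigma>))"
      using quotient_log_deriv[where Z = Z, OF g h Z nzs(3,4)] unfolding sumZ by (intro ext) simp
    moreover have "(\<Sum>i<k. (deriv ^^ i) (\<lambda>z. deriv g z / g z) (of_real c) / fact i * (s - of_real c) ^ i) -
        (\<Sum>i<k. (deriv ^^ i) (\<lambda>z. deriv h z / h z) (of_real c) / fact i * (s - of_real c) ^ i) =
        (\<Sum>i<k. ?q i * (s - of_real c) ^ i)"
      by (simp only: sum_subtractf left_diff_distrib)
    ultimately show "(\<lambda>R. deriv Z s / Z s - (\<Sum>\<sigma> \<in> singular_points Z \<inter> {\<sigma>. norm \<sigma> < real R}. of_int (zorder Z \<sigma>) * ?T \<sigma>))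
      \<longlonglongrightarrow> (\<Sum>i<k. ?q i * (s - of_real c) ^ i)"
      by (simp only:)
  qed
  then show "\<exists>K c \<theta>. 2 \<le> c \<and> 0 < \<theta> \<and> (\<forall>k\<ge>K. \<exists>q. \<forall>n::nat. \<forall>s. s = of_real (c + real n * \<theta>) \<longrightarrow>
      (\<lambda>R. deriv Z s / Z s - (\<Sum>\<sigma> \<in> singular_points Z \<inter> {\<sigma>. norm \<sigma> < real R}.
         of_int (zorder Z \<sigma>) * ((s - of_real c) ^ k / ((\<sigma> - of_real c) ^ k * (s - \<sigma>)))))
       \<longlonglongrightarrow> (\<Sum>i<k. q i * (s - of_real c) ^ i))"
    using c(1,2) by blast
qed

section \<open>Euler products\<close>

lemma finite_summable_ge:
  fixes f :: "'a \<Rightarrow> real"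
  assumes s: "f summable_on P" and nn: "\<And>p. p \<in> P \<Longrightarrow> f p \<ge> 0" and e: "e > 0"
  shows "finite {p \<in> P. f p \<ge> e}"
proof -
  have "card G \<le> nat \<lfloor>infsum f P / e\<rfloor>" if G: "G \<subseteq> {p \<in> P. f p \<ge> e}" "finite G" for G
  proof -
    have "real (card G) * e = (\<Sum>p\<in>G. e)" by simp
    also have "\<dots> \<le> sum f G" using G by (intro sum_mono) auto
    also have "\<dots> \<le> infsum f P" using G nn by (intro finite_sum_le_infsum[OF s]) auto
    finally have "real (card G) \<le> infsum f P / e" using e by (simp add: field_simps)
    then show ?thesis by linarith
  qed
  then show ?thesis using finite_if_finite_subsets_card_bdd by blast
qed

text \<open>Summing over \<open>j\<close> leaves \<open>r p / (1 - r p)\<close>, which is at most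
  \<open>2 * r p\<close> outside the finite set where \<open>r p \<ge> 1 / 2\<close>.\<close>

lemma geometric_sum_summable_on:
  fixes r :: "'a \<Rightarrow> real"
  assumes s: "r summable_on P" and r: "\<And>p. p \<in> P \<Longrightarrow> 0 < r p \<and> r p < 1"
  shows "(\<lambda>(p, j). r p ^ Suc j) summable_on (P \<times> UNIV)"
proof -
  define B where "B = {p \<in> P. r p \<ge> 1 / 2}"
  have B: "finite B" unfolding B_def
    by (rule finite_summable_ge[OF s]) (use r in \<open>auto intro: less_imp_le\<close>)
  have "(\<lambda>p. r p / (1 - r p)) summable_on (P - B)"
  proof (rule summable_on_comparison_test)
    show "(\<lambda>p. 2 * r p) summable_on (P - B)"
      by (intro summable_on_cmult_right summable_on_subset_banach[OF s]) auto
    fix p assume p: "p \<in> P - B"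
    then have "0 < r p" "r p < 1 / 2" using r by (auto simp: B_def)
    then have "r p / (1 - r p) \<le> r p / (1 / 2)" by (intro divide_left_mono) auto
    then show "r p / (1 - r p) \<le> 2 * r p" by simp
    show "0 \<le> r p / (1 - r p)" using \<open>0 < r p\<close> \<open>r p < 1 / 2\<close> by simp
  qed
  moreover have "(\<lambda>p. r p / (1 - r p)) summable_on B" using B by simp
  ultimately have "(\<lambda>p. r p / (1 - r p)) summable_on ((P - B) \<union> B)"
    by (rule summable_on_Un_disjoint) auto
  moreover have "(P - B) \<union> B = P" by (auto simp: B_def)
  ultimately have sm: "(\<lambda>p. r p / (1 - r p)) summable_on P" by simp
  show ?thesis
  proof (rule summable_on_SigmaI[where g = "\<lambda>p. r p / (1 - r p)"])
    fix p assume "p \<in> P"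
    then have rp: "0 < r p" "r p < 1" using r by auto
    have "(\<lambda>j. r p * r p ^ j) sums (r p * (1 / (1 - r p)))"
      using rp by (intro sums_mult geometric_sums) auto
    then have "((\<lambda>j. r p * r p ^ j) has_sum (r p * (1 / (1 - r p)))) UNIV"
      by (rule sums_nonneg_imp_has_sum) (use rp in auto)
    then show "((\<lambda>j. case (p, j) of (p, j) \<Rightarrow> r p ^ Suc j) has_sum r p / (1 - r p)) UNIV" by simp
  qed (use sm r in \<open>auto intro: less_imp_le\<close>)
qed

lemma powr_eq_exp_mult_ln: "N > 0 \<Longrightarrow> complex_of_real N powr (- s) = exp (- s * of_real (ln N))"
  by (simp add: powr_def Ln_of_real)

text \<open>The pair \<open>(p, j)\<close> stands for the prime power \<open>p ^ Suc j\<close>.\<close>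

definition pp_log :: "('a \<Rightarrow> real) \<Rightarrow> 'a \<times> nat \<Rightarrow> real" where
  "pp_log N = (\<lambda>(p, j). real (Suc j) * ln (N p))"

lemma pp_log_summable_on:
  assumes N: "\<And>p. p \<in> P \<Longrightarrow> N p > 1" and s: "(\<lambda>p. N p powr (- a)) summable_on P" and a: "a > 0"
  shows "(\<lambda>i. exp (- a * pp_log N i)) summable_on (P \<times> UNIV)"
proof -
  have "(\<lambda>(p, j). (N p powr (- a)) ^ Suc j) summable_on (P \<times> UNIV)"
  proof (rule geometric_sum_summable_on[OF s])
    fix p assume "p \<in> P"
    then have "N p > 1" by (rule N)
    moreover from this have "- a * ln (N p) < 0" using a by (simp add: mult_neg_pos)
    ultimately show "0 < N p powr (- a) \<and> N p powr (- a) < 1" by (simp add: powr_def)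
  qed
  moreover have "(case i of (p, j) \<Rightarrow> (N p powr (- a)) ^ Suc j) = exp (- a * pp_log N i)" if iP: "i \<in> P \<times> UNIV" for i
  proof -
    obtain p j where i: "i = (p, j)" "p \<in> P" using iP by (cases i) auto
    have "N p > 0" using N[OF i(2)] by simp
    then have "(N p powr (- a)) ^ Suc j = exp (real (Suc j) * (- a * ln (N p)))"
      by (simp only: exp_of_nat_mult) (simp add: powr_def)
    then show ?thesis by (simp add: i pp_log_def algebra_simps)
  qed
  ultimately show ?thesis by (subst summable_on_cong[of _ _ "\<lambda>(p, j). (N p powr (- a)) ^ Suc j"]) auto
qed

text \<open>Expand \<open>- ln (1 - z)\<close> for each \<open>p\<close>. Absolute summability over
  pairs allows two readings of the double sum: with \<open>p\<close> outermost, which matches the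
  finite partial products, and along the enumeration \<open>e\<close>, which gives an ordinary
  series that can be differentiated.\<close>

lemma euler_product_eq_exp:
  assumes N: "\<And>p. p \<in> P \<Longrightarrow> N p > 1" and sm: "(\<lambda>p. N p powr (- Re s)) summable_on P" and s: "Re s > 0"
    and e: "bij_betw e (UNIV :: nat set) (P \<times> UNIV)"
  shows "euler_product P N s = exp (\<Sum>n. of_real (1 / real (Suc (snd (e n)))) * exp (- s * of_real (pp_log N (e n))))"
proof -
  define f where "f i = of_real (1 / real (Suc (snd i))) * exp (- s * of_real (pp_log N i))" for i :: "'a \<times> nat"
  have fabs: "(\<lambda>i. norm (f i)) summable_on (P \<times> UNIV)"
  proof (rule summable_on_comparison_test[OF pp_log_summable_on[OF N sm s]])
    fix i :: "'a \<times> nat"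
    have "norm (f i) = 1 / real (Suc (snd i)) * exp (- Re s * pp_log N i)"
      unfolding f_def norm_mult norm_of_real by simp
    also have "\<dots> \<le> 1 * exp (- Re s * pp_log N i)" by (intro mult_right_mono) auto
    finally show "norm (f i) \<le> exp (- Re s * pp_log N i)" by simp
  qed auto
  have fs: "(f has_sum infsum f (P \<times> UNIV)) (P \<times> UNIV)"
    by (rule has_sum_infsum[OF abs_summable_summable[OF fabs]])
  define b where "b p = - ln (1 - complex_of_real (N p) powr (- s))" for p
  have small: "norm (complex_of_real (N p) powr (- s)) < 1" if "p \<in> P" for p
  proof -
    have "N p > 1" by (rule N[OF that])
    moreover from this have "- Re s * ln (N p) < 0" using s by (simp add: mult_neg_pos)
    ultimately show ?thesis by (simp add: powr_eq_exp_mult_ln)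
  qed
  have "((\<lambda>j. f (p, j)) has_sum b p) UNIV" if p: "p \<in> P" for p
  proof -
    define z where "z = complex_of_real (N p) powr (- s)"
    have z: "norm z < 1" using small[OF p] by (simp add: z_def)
    have fz: "f (p, j) = z ^ Suc j / of_nat (Suc j)" for j
    proof -
      have "z ^ Suc j = exp (of_nat (Suc j) * (- s * of_real (ln (N p))))"
        using N[OF p] by (simp only: z_def powr_eq_exp_mult_ln exp_of_nat_mult)
      then show ?thesis by (simp add: f_def pp_log_def algebra_simps)
    qed
    have "(\<lambda>n. - ((- (- z)) ^ n) / of_nat n) sums ln (1 + (- z))" by (rule Ln_series') (use z in simp)
    then have "(\<lambda>n. - (- (z ^ n) / of_nat n)) sums (- ln (1 - z))" by (intro sums_minus) simp
    then have "(\<lambda>n. z ^ n / of_nat n) sums (- ln (1 - z))" by simp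
    then have "(\<lambda>n. z ^ Suc n / of_nat (Suc n)) sums (- ln (1 - z))"
      by (subst sums_Suc_iff) simp
    then have "(\<lambda>j. f (p, j)) sums b p" by (simp only: fz b_def z_def)
    moreover have "summable (\<lambda>j. norm (f (p, j)))"
    proof (rule summable_comparison_test')
      show "summable (\<lambda>j. norm z * norm z ^ j)" using z by (intro summable_mult summable_geometric) auto
      show "norm (norm (f (p, j))) \<le> norm z * norm z ^ j" for j
      proof -
        have "norm z * norm z ^ j / real (Suc j) \<le> norm z * norm z ^ j / 1"
          by (intro divide_left_mono) auto
        then show ?thesis unfolding fz by (simp add: norm_divide norm_mult norm_power del: of_nat_Suc)
      qed
    qed
    ultimately show ?thesis by (intro norm_summable_imp_has_sum)
  qed
  then have bs: "(b has_sum infsum f (P \<times> UNIV)) P"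
    by (rule has_sum_SigmaD[OF fs])
  have "((\<lambda>F. exp (sum b F)) \<longlongrightarrow> exp (infsum f (P \<times> UNIV))) (finite_subsets_at_top P)"
    using bs unfolding has_sum_def by (rule tendsto_exp)
  moreover have "\<forall>\<^sub>F F in finite_subsets_at_top P. exp (sum b F) = (\<Prod>p\<in>F. inverse (1 - complex_of_real (N p) powr (- s)))"
  proof (rule eventually_finite_subsets_at_top_weakI)
    fix F assume F: "finite F" "F \<subseteq> P"
    have "exp (b p) = inverse (1 - complex_of_real (N p) powr (- s))" if "p \<in> F" for p
    proof -
      have "1 - complex_of_real (N p) powr (- s) \<noteq> 0" using small[of p] that F by auto
      then show ?thesis by (simp add: b_def exp_minus)
    qed
    then show "exp (sum b F) = (\<Prod>p\<in>F. inverse (1 - complex_of_real (N p) powr (- s)))"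
      using F by (simp add: exp_sum)
  qed
  ultimately have "((\<lambda>F. \<Prod>p\<in>F. inverse (1 - complex_of_real (N p) powr (- s))) \<longlongrightarrow> exp (infsum f (P \<times> UNIV))) (finite_subsets_at_top P)"
    by (rule Lim_transform_eventually)
  then have "euler_product P N s = exp (infsum f (P \<times> UNIV))"
    unfolding euler_product_def by (intro tendsto_Lim) auto
  moreover have "((\<lambda>n. f (e n)) has_sum infsum f (P \<times> UNIV)) UNIV"
    using fs has_sum_reindex_bij_betw[OF e, of f] by simp
  then have "infsum f (P \<times> UNIV) = (\<Sum>n. f (e n))"
    using has_sum_imp_sums sums_unique by blast
  ultimately show ?thesis by (simp add: f_def)
qed

text \<open>Termwise differentiation on the half-plane \<open>Re z \<ge> a\<close>. The factor
  \<open>t n\<close> is paid for by moving the exponent from \<open>a\<close> down to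
  \<open>b\<close>, still above 1, since \<open>t \<le> exp ((a - b) * t) / (a - b)\<close>.\<close>

lemma dirichlet_series_deriv:
  fixes v t :: "nat \<Rightarrow> real"
  assumes v: "\<And>n. v n \<ge> 0" and t: "\<And>n. t n \<ge> 0"
    and sm: "\<And>a. a > 1 \<Longrightarrow> summable (\<lambda>n. v n * exp (- a * t n))" and s: "Re s > 1"
  shows "((\<lambda>s. \<Sum>n. of_real (v n) * exp (- s * of_real (t n))) has_field_derivative
      (\<Sum>n. - of_real (v n * t n) * exp (- s * of_real (t n)))) (at s)"
    and "summable (\<lambda>n. v n * t n * exp (- Re s * t n))"
proof -
  define a where "a = (1 + Re s) / 2"
  have a: "1 < a" "a < Re s" using s by (auto simp: a_def)
  define b where "b = (1 + a) / 2"
  have b: "1 < b" "b < a" using a by (auto simp: b_def)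
  define M where "M n = v n * exp (- b * t n) * (1 / (a - b))" for n
  have M: "summable M" unfolding M_def using sm[OF b(1)] by (rule summable_mult2)
  have bound: "v n * t n * exp (- x * t n) \<le> M n" if "x \<ge> a" for n x
  proof -
    have "(a - b) * t n \<le> exp ((a - b) * t n)" using exp_ge_add_one_self[of "(a - b) * t n"] by linarith
    then have "t n \<le> exp ((a - b) * t n) * (1 / (a - b))" using b by (simp add: field_simps)
    moreover have "exp (- x * t n) \<le> exp (- a * t n)" using that t[of n] by (simp add: mult_right_mono)
    ultimately have "t n * exp (- x * t n) \<le> exp ((a - b) * t n) * (1 / (a - b)) * exp (- a * t n)"
      using t[of n] by (intro mult_mono) (use b in auto)
    also have "\<dots> = exp (- b * t n) * (1 / (a - b))"
      by (simp add: exp_diff exp_minus left_diff_distrib field_simps)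
    finally show ?thesis unfolding M_def mult.assoc using v[of n] by (intro mult_left_mono)
  qed
  show "summable (\<lambda>n. v n * t n * exp (- Re s * t n))"
    by (rule summable_comparison_test'[OF M]) (use bound[of "Re s"] a v t in auto)
  define S where "S = {z. Re z \<ge> a}"
  have c1: "convex S" unfolding S_def by (rule convex_halfspace_Re_ge)
  have c2: "((\<lambda>s. of_real (v n) * exp (- s * of_real (t n))) has_field_derivative
      - of_real (v n * t n) * exp (- z * of_real (t n))) (at z within S)" if "z \<in> S" for n z
    by (auto intro!: derivative_eq_intros)
  have c3: "uniformly_convergent_on S (\<lambda>n z. \<Sum>i<n. - of_real (v i * t i) * exp (- z * of_real (t i)))"
  proof (rule Weierstrass_m_test'[OF _ M])
    fix n z assume "z \<in> S"
    then show "norm (- complex_of_real (v n * t n) * exp (- z * of_real (t n))) \<le> M n"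
      using bound[of "Re z" n] v[of n] t[of n] by (simp add: norm_mult S_def)
  qed
  have c4: "s \<in> S" using a by (simp add: S_def)
  have c5: "summable (\<lambda>n. of_real (v n) * exp (- s * of_real (t n)))"
  proof (rule summable_norm_cancel)
    show "summable (\<lambda>n. norm (complex_of_real (v n) * exp (- s * of_real (t n))))"
      using sm[OF s] v by (simp add: norm_mult)
  qed
  have c6: "s \<in> interior S"
  proof -
    have "open {z. Re z > a}" by (rule open_halfspace_Re_gt)
    then show ?thesis using a by (intro interiorI[of "{z. Re z > a}"]) (auto simp: S_def)
  qed
  show "((\<lambda>s. \<Sum>n. of_real (v n) * exp (- s * of_real (t n))) has_field_derivative
      (\<Sum>n. - of_real (v n * t n) * exp (- s * of_real (t n)))) (at s)"
    by (rule has_field_derivative_series'(2)[where f = "\<lambda>n s. of_real (v n) * exp (- s * of_real (t n))"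
        and f' = "\<lambda>n s. - of_real (v n * t n) * exp (- s * of_real (t n))", OF c1 c2 c3 c4 c5 c6])
qed

lemma pp_log_nonneg: "N (fst i) > 1 \<Longrightarrow> pp_log N i \<ge> 0"
  by (auto simp: pp_log_def split: prod.splits)

lemma euler_product_log_deriv:
  assumes N: "\<And>p. p \<in> P \<Longrightarrow> N p > 1"
    and sm: "\<And>a. a > 1 \<Longrightarrow> (\<lambda>p. N p powr (- a)) summable_on P"
    and Z: "\<And>s. Re s > 1 \<Longrightarrow> Z s = euler_product P N s"
    and e: "bij_betw e (UNIV :: nat set) (P \<times> UNIV)" and s: "Re s > 1"
  shows "deriv Z s / Z s = - (\<Sum>n. of_real (ln (N (fst (e n)))) * exp (- s * of_real (pp_log N (e n))))"
    and "summable (\<lambda>n. ln (N (fst (e n))) * exp (- Re s * pp_log N (e n)))"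
proof -
  define t where "t n = pp_log N (e n)" for n
  define v where "v n = 1 / real (Suc (snd (e n)))" for n
  have en: "fst (e n) \<in> P" for n using bij_betwE[OF e] by (auto simp: mem_Times_iff)
  \<comment> \<open>The weight \<open>1 / Suc j\<close> of the logarithm cancels the factor
    \<open>Suc j\<close> of \<open>pp_log\<close>: differentiation leaves the von Mangoldt
    weight.\<close>
  have vt: "v n * t n = ln (N (fst (e n)))" for n
    by (simp add: v_def t_def pp_log_def split_beta del: of_nat_Suc)
  have t0: "t n \<ge> 0" for n unfolding t_def by (rule pp_log_nonneg) (rule N[OF en])
  have v0: "v n \<ge> 0" for n by (simp add: v_def)
  have sv: "summable (\<lambda>n. v n * exp (- a * t n))" if "a > 1" for a
  proof -
    have "(\<lambda>n. exp (- a * pp_log N (e n))) summable_on UNIV"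
      using pp_log_summable_on[OF N sm[OF that]] that summable_on_reindex_bij_betw[OF e, of "\<lambda>i. exp (- a * pp_log N i)"] by simp
    then have "summable (\<lambda>n. exp (- a * t n))" unfolding t_def by (rule summable_on_imp_summable)
    then show ?thesis
    proof (rule summable_comparison_test')
      fix n :: nat
      have "v n * exp (- a * t n) \<le> 1 * exp (- a * t n)" by (intro mult_right_mono) (auto simp: v_def)
      then show "norm (v n * exp (- a * t n)) \<le> exp (- a * t n)" using v0[of n] by simp
    qed
  qed
  define D :: "complex \<Rightarrow> complex" where "D = (\<lambda>s. \<Sum>n. of_real (v n) * exp (- s * of_real (t n)))"
  have ZD: "Z w = exp (D w)" if "Re w > 1" for w
    using Z[OF that] euler_product_eq_exp[OF N sm[OF that] _ e] that by (simp add: D_def t_def v_def)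
  have "((\<lambda>w. exp (D w)) has_field_derivative exp (D s) * (\<Sum>n. - of_real (v n * t n) * exp (- s * of_real (t n)))) (at s)"
    unfolding D_def by (intro DERIV_chain2[OF DERIV_exp] dirichlet_series_deriv[OF v0 t0 sv s])
  then have "(Z has_field_derivative exp (D s) * (\<Sum>n. - of_real (v n * t n) * exp (- s * of_real (t n)))) (at s)"
    by (rule has_field_derivative_transform_within_open[OF _ open_halfspace_Re_gt[of 1]]) (use s ZD in auto)
  then have "deriv Z s / Z s = (\<Sum>n. - of_real (v n * t n) * exp (- s * of_real (t n)))"
    by (simp add: DERIV_imp_deriv ZD[OF s])
  also have "\<dots> = (\<Sum>n. - (of_real (ln (N (fst (e n)))) * exp (- s * of_real (pp_log N (e n)))))"
    by (simp only: vt) (simp add: t_def)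
  also have "\<dots> = - (\<Sum>n. of_real (ln (N (fst (e n)))) * exp (- s * of_real (pp_log N (e n))))"
  proof (rule suminf_minus)
    have "summable (\<lambda>n. ln (N (fst (e n))) * exp (- Re s * pp_log N (e n)))"
      using dirichlet_series_deriv(2)[OF v0 t0 sv s] unfolding vt by (simp add: t_def)
    then show "summable (\<lambda>n. complex_of_real (ln (N (fst (e n)))) * exp (- s * of_real (pp_log N (e n))))"
      using less_imp_le[OF ln_gt_zero[OF N[OF en]]]
      by (subst summable_norm_cancel) (simp_all add: norm_mult)
  qed
  finally show "deriv Z s / Z s = - (\<Sum>n. of_real (ln (N (fst (e n)))) * exp (- s * of_real (pp_log N (e n))))" .
  show "summable (\<lambda>n. ln (N (fst (e n))) * exp (- Re s * pp_log N (e n)))"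
    using dirichlet_series_deriv(2)[OF v0 t0 sv s] unfolding vt by (simp add: t_def)
qed

section \<open>Laplace transforms on the half-line\<close>

text \<open>Existence and value in one relation, so that integrability is carried along by linear
  operations and by series. The half-line is open, so integrands have to agree for
  \<open>u > 0\<close> only.\<close>

definition has_hl_integral :: "(real \<Rightarrow> 'a :: {banach, second_countable_topology}) \<Rightarrow> 'a \<Rightarrow> bool" where
  "has_hl_integral f v \<longleftrightarrow> has_bochner_integral lborel (\<lambda>u. indicator {0<..} u *\<^sub>R f u) v"

lemma has_hl_integral_cong:
  "(\<And>u. u > 0 \<Longrightarrow> f u = g u) \<Longrightarrow> has_hl_integral f v \<longleftrightarrow> has_hl_integral g v"
  unfolding has_hl_integral_def by (intro has_bochner_integral_cong) (auto simp: indicator_def)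

lemma has_hl_integral_add:
  "has_hl_integral f v \<Longrightarrow> has_hl_integral g w \<Longrightarrow> has_hl_integral (\<lambda>u. f u + g u) (v + w)"
  unfolding has_hl_integral_def scaleR_add_right by (rule has_bochner_integral_add)

lemma has_hl_integral_sum:
  "(\<And>i. i \<in> I \<Longrightarrow> has_hl_integral (f i) (v i)) \<Longrightarrow> has_hl_integral (\<lambda>u. \<Sum>i\<in>I. f i u) (\<Sum>i\<in>I. v i)"
  unfolding has_hl_integral_def scaleR_sum_right by (rule has_bochner_integral_sum)

lemma has_hl_integral_bounded_linear:
  assumes "bounded_linear T" "has_hl_integral f v"
  shows "has_hl_integral (\<lambda>u. T (f u)) (T v)"
proof -
  have "has_bochner_integral lborel (\<lambda>u. T (indicator {0<..} u *\<^sub>R f u)) (T v)"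
    using assms(2) unfolding has_hl_integral_def by (rule has_bochner_integral_bounded_linear[OF assms(1)])
  then show ?thesis
    by (simp add: has_hl_integral_def linear_simps(5)[OF assms(1)])
qed

lemma has_hl_integral_cmult:
  fixes c :: "'a :: {banach, second_countable_topology, real_normed_algebra}"
  shows "has_hl_integral f v \<Longrightarrow> has_hl_integral (\<lambda>u. c * f u) (c * v)"
  by (rule has_hl_integral_bounded_linear[OF bounded_linear_mult_right])

text \<open>Domination by multiples \<open>M r\<close> of one integrable function makes the
  integrals of the norms summable, which is what termwise integration asks for.\<close>

lemma has_hl_integral_suminf:
  fixes f :: "nat \<Rightarrow> real \<Rightarrow> 'a :: {banach, second_countable_topology}"
  assumes f: "\<And>r. has_hl_integral (f r) (v r)" and g: "has_hl_integral g G"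
    and bound: "\<And>r u. u > 0 \<Longrightarrow> norm (f r u) \<le> M r * g u" and M: "summable M"
  shows "summable v" "has_hl_integral (\<lambda>u. \<Sum>r. f r u) (\<Sum>r. v r)"
proof -
  define h where "h r u = indicator {0<..} u *\<^sub>R f r u" for r and u :: real
  define k where "k u = indicator {0<..} u *\<^sub>R g u" for u :: real
  have hI: "integrable lborel (h r)" "integral\<^sup>L lborel (h r) = v r" for r
    using f[of r] by (auto simp: has_hl_integral_def has_bochner_integral_iff h_def[abs_def])
  have kI: "integrable lborel k" "integral\<^sup>L lborel k = G"
    using g by (auto simp: has_hl_integral_def has_bochner_integral_iff k_def[abs_def])
  have b: "norm (h r u) \<le> M r * k u" for r u
    using bound[of u r] by (auto simp: h_def k_def indicator_def)
  have sm: "summable (\<lambda>r. norm (h r u))" for u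
    by (rule summable_comparison_test'[OF summable_mult2[OF M, of "k u"]]) (use b in auto)
  have sI: "summable (\<lambda>r. \<integral>u. norm (h r u) \<partial>lborel)"
  proof (rule summable_comparison_test'[OF summable_mult2[OF M, of G]])
    fix r
    have "(\<integral>u. norm (h r u) \<partial>lborel) \<le> (\<integral>u. M r * k u \<partial>lborel)"
      using hI kI b by (intro integral_mono) auto
    also have "\<dots> = M r * G" using kI by simp
    finally show "norm (\<integral>u. norm (h r u) \<partial>lborel) \<le> M r * G" by simp
  qed
  have "(\<lambda>r. integral\<^sup>L lborel (h r)) sums (\<integral>u. (\<Sum>r. h r u) \<partial>lborel)"
    by (rule sums_integral[OF hI(1) _ sI]) (use sm in auto)
  then have s: "v sums (\<integral>u. (\<Sum>r. h r u) \<partial>lborel)" by (simp add: hI(2))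
  then show "summable v" by (rule sums_summable)
  have "integrable lborel (\<lambda>u. \<Sum>r. h r u)"
    by (rule integrable_suminf[OF hI(1) _ sI]) (use sm in auto)
  then have "has_bochner_integral lborel (\<lambda>u. \<Sum>r. h r u) (\<Sum>r. v r)"
    using s by (simp add: has_bochner_integral_iff sums_unique)
  moreover have "(\<Sum>r. h r u) = indicator {0<..} u *\<^sub>R (\<Sum>r. f r u)" for u
    by (auto simp: h_def indicator_def)
  ultimately show "has_hl_integral (\<lambda>u. \<Sum>r. f r u) (\<Sum>r. v r)"
    by (simp add: has_hl_integral_def)
qed

text \<open>Scaling and translating the Gamma integral. The exponent \<open>Suc k\<close> in the
  first formula is positive, so the power of \<open>max 0 (u - t)\<close> really vanishes before
  \<open>t\<close>; \<open>0 ^ 0\<close> would be 1.\<close>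

lemma has_hl_integral_power_exp:
  assumes w: "w > 0" and t: "t \<ge> 0"
  shows "has_hl_integral (\<lambda>u. max 0 (u - t) ^ Suc k * exp (- w * u)) (fact (Suc k) * exp (- w * t) / w ^ Suc (Suc k))"
    and "has_hl_integral (\<lambda>u. u ^ k * exp (- w * u)) (fact k / w ^ Suc k)"
proof -
  have base: "has_bochner_integral lborel (\<lambda>u. indicator {0<..} u *\<^sub>R (u ^ n * exp (- w * u))) (fact n / w ^ Suc n)" for n
  proof -
    have "has_bochner_integral lborel (\<lambda>x. (0 + w * x) ^ n * exp (- (0 + w * x)) * indicator {0<..} (0 + w * x)) (fact n /\<^sub>R \<bar>w\<bar>)"
      using has_bochner_integral_I0i_power_exp_m[of n] w
      by (subst (asm) lborel_has_bochner_integral_real_affine_iff[of w _ _ 0]) auto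
    from has_bochner_integral_mult_right[OF this, of "1 / w ^ n"]
    have "has_bochner_integral lborel (\<lambda>x. 1 / w ^ n * ((0 + w * x) ^ n * exp (- (0 + w * x)) * indicator {0<..} (0 + w * x))) (1 / w ^ n * (fact n /\<^sub>R \<bar>w\<bar>))" .
    moreover have "1 / w ^ n * ((0 + w * x) ^ n * exp (- (0 + w * x)) * indicator {0<..} (0 + w * x)) =
      indicator {0<..} x *\<^sub>R (x ^ n * exp (- w * x))" for x
      using w by (auto simp: indicator_def power_mult_distrib zero_less_mult_iff)
    moreover have "1 / w ^ n * (fact n /\<^sub>R \<bar>w\<bar>) = fact n / w ^ Suc n"
      using w by (simp add: divide_inverse)
    ultimately show ?thesis by simp
  qed
  show "has_hl_integral (\<lambda>u. u ^ k * exp (- w * u)) (fact k / w ^ Suc k)"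
    unfolding has_hl_integral_def by (rule base)
  have "has_bochner_integral lborel (\<lambda>u. indicator {0<..} (- t + 1 * u) *\<^sub>R ((- t + 1 * u) ^ Suc k * exp (- w * (- t + 1 * u))))
     ((fact (Suc k) / w ^ Suc (Suc k)) /\<^sub>R \<bar>1\<bar>)"
    using base[of "Suc k"] by (subst (asm) lborel_has_bochner_integral_real_affine_iff[of 1 _ _ "- t"]) auto
  from has_bochner_integral_mult_right[OF this, of "exp (- w * t)"]
  have "has_bochner_integral lborel (\<lambda>u. exp (- w * t) * (indicator {0<..} (- t + 1 * u) *\<^sub>R ((- t + 1 * u) ^ Suc k * exp (- w * (- t + 1 * u)))))
     (exp (- w * t) * ((fact (Suc k) / w ^ Suc (Suc k)) /\<^sub>R \<bar>1\<bar>))" .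
  moreover have "exp (- w * t) * (indicator {0<..} (- t + 1 * u) *\<^sub>R ((- t + 1 * u) ^ Suc k * exp (- w * (- t + 1 * u)))) =
    indicator {0<..} u *\<^sub>R (max 0 (u - t) ^ Suc k * exp (- w * u))" for u
  proof (cases "u > t")
    case True
    have "exp (- w * t) * exp (- w * (- t + 1 * u)) = exp (- w * u)"
      by (simp add: exp_add[symmetric] algebra_simps)
    then show ?thesis using True t by (simp add: algebra_simps)
  qed auto
  ultimately show "has_hl_integral (\<lambda>u. max 0 (u - t) ^ Suc k * exp (- w * u)) (fact (Suc k) * exp (- w * t) / w ^ Suc (Suc k))"
    by (simp add: has_hl_integral_def mult.commute del: power_Suc fact_Suc)
qed

lemma has_hl_integral_cexp:
  assumes "Re z > 0"
  shows "has_hl_integral (\<lambda>u. exp (- z * of_real u)) (1 / z)"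
proof -
  have z0: "z \<noteq> 0" using assms by auto
  have "set_integrable lborel {0<..} (\<lambda>u. u ^ 0 * exp (- Re z * u))"
    using has_hl_integral_power_exp(2)[OF assms order_refl, of 0]
    by (auto simp: has_hl_integral_def has_bochner_integral_iff set_integrable_def)
  then have int: "set_integrable lborel {0<..} (\<lambda>u. exp (- z * of_real u))"
  proof (rule set_integrable_bound)
    show "set_borel_measurable lborel {0<..} (\<lambda>u. exp (- z * complex_of_real u))"
      unfolding set_borel_measurable_def
      using borel_measurable_continuous_on_indicator[of "{0<..}" "\<lambda>u. exp (- z * complex_of_real u)"]
      by (simp add: continuous_intros)
    show "AE x in lborel. x \<in> {0<..} \<longrightarrow> norm (exp (- z * complex_of_real x)) \<le> norm (x ^ 0 * exp (- Re z * x))"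
      by simp
  qed
  have "(LBINT u=ereal 0..\<infinity>. exp (- z * of_real u)) = 0 - (- 1 / z)"
  proof (rule interval_integral_FTC_integrable[where F = "\<lambda>u. - exp (- z * of_real u) / z"])
    show "((\<lambda>u. - exp (- z * of_real u) / z) has_vector_derivative exp (- z * of_real x)) (at x)" for x
    proof -
      have "((\<lambda>w. - exp (- z * w) / z) has_field_derivative exp (- z * of_real x)) (at (of_real x))"
        using z0 by (auto intro!: derivative_eq_intros)
      from field_vector_diff_chain_at[OF has_vector_derivative_of_real[OF DERIV_ident] this]
      show ?thesis by (simp add: o_def)
    qed
    show "set_integrable lborel (einterval (ereal 0) \<infinity>) (\<lambda>x. exp (- z * complex_of_real x))"
      using int by (simp add: zero_ereal_def)
    have "((\<lambda>u. - exp (- z * complex_of_real u) / z) \<longlongrightarrow> - exp (- z * complex_of_real 0) / z) (at_right 0)"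
      by (intro tendsto_intros) (use z0 in auto)
    then show "(((\<lambda>u. - exp (- z * complex_of_real u) / z) \<circ> real_of_ereal) \<longlongrightarrow> - 1 / z) (at_right (ereal 0))"
      by (simp only: ereal_tendsto_simps1) simp
    have "((\<lambda>u. - exp (- z * complex_of_real u) / z) \<longlongrightarrow> 0) at_top"
    proof (rule Lim_null_comparison)
      have "filterlim (\<lambda>u. - Re z * u) at_bot at_top"
        by (rule filterlim_tendsto_neg_mult_at_bot[OF tendsto_const _ filterlim_ident]) (use assms in simp)
      then have "((\<lambda>u. exp (- Re z * u)) \<longlongrightarrow> 0) at_top" by (rule filterlim_compose[OF exp_at_bot])
      from tendsto_mult_right[OF this, of "1 / norm z"]
      show "((\<lambda>u. exp (- Re z * u) * (1 / norm z)) \<longlongrightarrow> 0) at_top" by simp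
      show "\<forall>\<^sub>F u in at_top. norm (- exp (- z * complex_of_real u) / z) \<le> exp (- Re z * u) * (1 / norm z)"
        by (simp add: norm_divide)
    qed
    then show "(((\<lambda>u. - exp (- z * complex_of_real u) / z) \<circ> real_of_ereal) \<longlongrightarrow> 0) (at_left \<infinity>)"
      by (simp only: ereal_tendsto_simps1)
  qed auto
  then have "(LBINT u:{0<..}. exp (- z * of_real u)) = 1 / z"
    by (simp only: interval_integral_to_infinity_eq) simp
  then show ?thesis using int
    by (simp add: has_hl_integral_def has_bochner_integral_iff set_integrable_def set_lebesgue_integral_def)
qed

text \<open>With \<open>x = exp (- \<theta> * u)\<close>, the hypothesis says that
  \<open>F u = f u * exp (- \<theta> * u)\<close> is orthogonal to every polynomial in
  \<open>x\<close>. The function \<psi>, which is \<open>f u * sqrt x\<close>, extends continuously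
  to \<open>x = 0\<close> and so is a uniform limit of polynomials. Hence the integral of
  \<open>F u * \<psi> x\<close>, which is that of \<open>(f u)\<^sup>2\<close> against a positive
  weight, vanishes, and continuity of \<open>f\<close> finishes the proof.\<close>

lemma lerch_real:
  fixes f :: "real \<Rightarrow> real"
  assumes cont: "continuous_on {0..} f" and th: "\<theta> > 0"
    and bound: "\<And>u. u \<ge> 0 \<Longrightarrow> \<bar>f u\<bar> \<le> C * exp (\<theta> / 4 * u)"
    and zero: "\<And>n::nat. n \<ge> 1 \<Longrightarrow> has_hl_integral (\<lambda>u. f u * exp (- (real n * \<theta>) * u)) 0"
    and u0: "u0 > 0"
  shows "f u0 = 0"
proof (rule ccontr)
  assume nz: "f u0 \<noteq> 0"
  have C0: "C \<ge> 0" using bound[of 0] by simp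
  \<comment> \<open>The growth rate \<open>\<theta> / 4\<close> makes \<open>f\<close> of order
    \<open>x powr (- 1 / 4)\<close> at most, so the factor \<open>sqrt x\<close> forces \<psi> to
    tend to 0 at \<open>x = 0\<close>.\<close>
  define \<psi> where "\<psi> x = (if x = 0 then 0 else f (- ln x / \<theta>) * sqrt x)" for x
  have \<psi>u: "\<psi> (exp (- \<theta> * u)) = f u * exp (- (\<theta> / 2) * u)" for u
  proof -
    have "sqrt (exp (- \<theta> * u)) = exp (- (\<theta> / 2) * u)"
      by (rule real_sqrt_unique) (auto simp: power2_eq_square exp_add[symmetric])
    then show ?thesis using th by (simp add: \<psi>_def)
  qed
  have \<psi>b: "\<bar>\<psi> x\<bar> \<le> C * sqrt (sqrt x)" if x: "0 < x" "x \<le> 1" for x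
  proof -
    define u where "u = - ln x / \<theta>"
    have u: "u \<ge> 0" "x = exp (- \<theta> * u)" using x th by (auto simp: u_def divide_nonpos_pos)
    have "\<bar>\<psi> x\<bar> = \<bar>f u\<bar> * exp (- (\<theta> / 2) * u)" unfolding u(2) \<psi>u by (simp add: abs_mult)
    also have "\<dots> \<le> C * exp (\<theta> / 4 * u) * exp (- (\<theta> / 2) * u)" by (intro mult_right_mono bound u) auto
    also have "\<dots> = C * exp (- (\<theta> / 4) * u)" by (simp add: exp_add[symmetric] mult.assoc)
    also have "exp (- (\<theta> / 4) * u) = sqrt (sqrt x)"
    proof -
      have "sqrt x = exp (- (\<theta> / 2) * u)" unfolding u(2)
        by (rule real_sqrt_unique) (auto simp: power2_eq_square exp_add[symmetric])
      moreover have "sqrt (exp (- (\<theta> / 2) * u)) = exp (- (\<theta> / 4) * u)"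
        by (rule real_sqrt_unique) (auto simp: power2_eq_square exp_add[symmetric])
      ultimately show ?thesis by simp
    qed
    finally show ?thesis .
  qed
  have "continuous_on {0..1} \<psi>"
  proof (rule continuous_on_eq_continuous_within[THEN iffD2], rule ballI)
    fix x :: real assume x: "x \<in> {0..1}"
    show "continuous (at x within {0..1}) \<psi>"
    proof (cases "x = 0")
      case True
      have "(\<psi> \<longlongrightarrow> 0) (at 0 within {0..1})"
      proof (rule Lim_null_comparison)
        have "((\<lambda>x. C * sqrt (sqrt x)) \<longlongrightarrow> C * sqrt (sqrt 0)) (at 0 within {0..1})"
          by (intro tendsto_intros)
        then show "((\<lambda>x. C * sqrt (sqrt x)) \<longlongrightarrow> 0) (at 0 within {0..1})" by simp
        show "\<forall>\<^sub>F x in at 0 within {0..1}. norm (\<psi> x) \<le> C * sqrt (sqrt x)"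
          unfolding eventually_at by (rule exI[of _ 1]) (use \<psi>b in auto)
      qed
      then show ?thesis using True by (simp add: continuous_within \<psi>_def)
    next
      case False
      have "continuous_on {0<..1} (\<lambda>x. f (- ln x / \<theta>) * sqrt x)"
      proof (intro continuous_on_mult continuous_on_compose2[OF cont] continuous_on_real_sqrt continuous_on_id)
        show "continuous_on {0<..1} (\<lambda>x. - ln x / \<theta>)"
          using th by (intro continuous_intros) auto
        show "(\<lambda>x. - ln x / \<theta>) ` {0<..1} \<subseteq> {0..}"
          using th by (auto simp: divide_nonpos_pos)
      qed
      then have "continuous_on {0<..1} \<psi>"
        by (rule continuous_on_eq) (auto simp: \<psi>_def)
      then have c: "continuous (at x within {0<..1}) \<psi>" using x False
        by (auto simp: continuous_on_eq_continuous_within)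
      have "at x within {0..1} = at x within {0<..1}"
        by (rule at_within_nhd[of _ "{0<..}"]) (use x False in auto)
      then show ?thesis using c by simp
    qed
  qed
  note \<psi>c = this
  define F where "F u = f u * exp (- \<theta> * u)" for u
  have meas: "(\<lambda>u. indicator {0<..} u *\<^sub>R (f u * exp (- b * u))) \<in> borel_measurable lborel" for b
  proof -
    have "continuous_on {0<..} (\<lambda>u. f u * exp (- b * u))"
      by (intro continuous_intros continuous_on_subset[OF cont]) auto
    from borel_measurable_continuous_on_indicator[OF _ this] show ?thesis by simp
  qed
  have gI: "integrable lborel (\<lambda>u. indicator {0<..} u *\<^sub>R \<bar>F u\<bar>)"
  proof (rule Bochner_Integration.integrable_bound)
    show "integrable lborel (\<lambda>u. C * (indicator {0<..} u *\<^sub>R (u ^ 0 * exp (- (3 / 4 * \<theta>) * u))))"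
      using has_hl_integral_power_exp(2)[of "3 / 4 * \<theta>" 0 0] th
      unfolding has_hl_integral_def has_bochner_integral_iff by (intro integrable_mult_right) auto
    have "(\<lambda>u. \<bar>indicator {0<..} u *\<^sub>R F u\<bar>) \<in> borel_measurable lborel"
      using meas[of \<theta>] unfolding F_def by measurable
    then show "(\<lambda>u. indicator {0<..} u *\<^sub>R \<bar>F u\<bar>) \<in> borel_measurable lborel"
      by (simp add: abs_mult)
    show "AE u in lborel. norm (indicator {0<..} u *\<^sub>R \<bar>F u\<bar>) \<le> norm (C * (indicator {0<..} u *\<^sub>R (u ^ 0 * exp (- (3 / 4 * \<theta>) * u))))"
    proof (rule AE_I2)
      fix u :: real
      have "\<bar>F u\<bar> \<le> C * exp (- (3 / 4 * \<theta>) * u)" if "u > 0"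
      proof -
        have "\<bar>F u\<bar> \<le> C * exp (\<theta> / 4 * u) * exp (- \<theta> * u)"
          using bound[of u] that by (simp add: F_def abs_mult mult_right_mono)
        also have "\<dots> = C * exp (- (3 / 4 * \<theta>) * u)" by (simp add: mult.assoc exp_add[symmetric])
        finally show ?thesis .
      qed
      then show "norm (indicator {0<..} u *\<^sub>R \<bar>F u\<bar>) \<le> norm (C * (indicator {0<..} u *\<^sub>R (u ^ 0 * exp (- (3 / 4 * \<theta>) * u))))"
        using C0 by (auto simp: indicator_def abs_mult)
    qed
  qed
  define G where "G = (\<integral>u. indicator {0<..} u *\<^sub>R \<bar>F u\<bar> \<partial>lborel)"
  have G0: "G \<ge> 0" unfolding G_def by (intro integral_nonneg_AE) auto
  define Q where "Q u = F u * \<psi> (exp (- \<theta> * u))" for u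
  have Qsq: "Q u = (f u)\<^sup>2 * exp (- (3 / 2 * \<theta>) * u)" for u
    unfolding Q_def F_def \<psi>u by (simp add: power2_eq_square exp_add[symmetric] mult_ac)
  have Q0: "Q u \<ge> 0" for u by (simp add: Qsq)
  have Qsmall: "integrable lborel (\<lambda>u. indicator {0<..} u *\<^sub>R Q u)"
    "(\<integral>u. indicator {0<..} u *\<^sub>R Q u \<partial>lborel) \<le> e * G" if e: "e > 0" for e
  proof -
    obtain p where p: "real_polynomial_function p" "\<And>x. x \<in> {0..1} \<Longrightarrow> \<bar>\<psi> x - p x\<bar> < e"
      using Stone_Weierstrass_real_polynomial_function[OF compact_Icc \<psi>c e] by blast
    then obtain a n where pa: "p = (\<lambda>x. \<Sum>i\<le>n. a i * x ^ i)"
      using real_polynomial_function_iff_sum by auto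
    \<comment> \<open>The monomial \<open>x ^ i\<close> against \<open>F\<close> is the hypothesis
      at index \<open>Suc i\<close>, so the indices from 1 on cover all polynomials, constants
      included.\<close>
    have "has_hl_integral (\<lambda>u. \<Sum>i\<le>n. a i * (f u * exp (- (real (Suc i) * \<theta>) * u))) (\<Sum>i\<le>n. a i * 0)"
      by (intro has_hl_integral_sum has_hl_integral_cmult zero) auto
    moreover have "(\<Sum>i\<le>n. a i * (f u * exp (- (real (Suc i) * \<theta>) * u))) = F u * p (exp (- \<theta> * u))" for u
      unfolding pa F_def sum_distrib_left
    proof (rule sum.cong[OF refl])
      fix i
      have "exp (- (real (Suc i) * \<theta>) * u) = exp (- \<theta> * u) * exp (- \<theta> * u) ^ i"
        by (simp add: exp_of_nat_mult[symmetric] exp_add[symmetric] algebra_simps)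
      then show "a i * (f u * exp (- (real (Suc i) * \<theta>) * u)) = f u * exp (- \<theta> * u) * (a i * exp (- \<theta> * u) ^ i)"
        by simp
    qed
    ultimately have pz: "has_hl_integral (\<lambda>u. F u * p (exp (- \<theta> * u))) 0" by simp
    then have pI: "integrable lborel (\<lambda>u. indicator {0<..} u *\<^sub>R (F u * p (exp (- \<theta> * u))))"
      "(\<integral>u. indicator {0<..} u *\<^sub>R (F u * p (exp (- \<theta> * u))) \<partial>lborel) = 0"
      by (auto simp: has_hl_integral_def has_bochner_integral_iff)
    have diff: "\<bar>indicator {0<..} u *\<^sub>R Q u - indicator {0<..} u *\<^sub>R (F u * p (exp (- \<theta> * u)))\<bar> \<le> e * (indicator {0<..} u *\<^sub>R \<bar>F u\<bar>)" for u
    proof (cases "u > 0")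
      case True
      then have "\<bar>\<psi> (exp (- \<theta> * u)) - p (exp (- \<theta> * u))\<bar> \<le> e" using p(2)[of "exp (- \<theta> * u)"] th by simp
      then have "\<bar>F u\<bar> * \<bar>\<psi> (exp (- \<theta> * u)) - p (exp (- \<theta> * u))\<bar> \<le> \<bar>F u\<bar> * e" by (rule mult_left_mono) simp
      then show ?thesis using True by (simp add: Q_def right_diff_distrib[symmetric] abs_mult mult.commute)
    qed auto
    have qm: "(\<lambda>u. indicator {0<..} u *\<^sub>R Q u) \<in> borel_measurable lborel"
    proof -
      have "continuous_on {0<..} (\<lambda>u. (f u)\<^sup>2 * exp (- (3 / 2 * \<theta>) * u))"
        by (intro continuous_intros continuous_on_subset[OF cont]) auto
      from borel_measurable_continuous_on_indicator[OF _ this] show ?thesis by (simp add: Qsq)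
    qed
    have dI: "integrable lborel (\<lambda>u. indicator {0<..} u *\<^sub>R Q u - indicator {0<..} u *\<^sub>R (F u * p (exp (- \<theta> * u))))"
    proof (rule Bochner_Integration.integrable_bound[OF integrable_mult_right[OF gI, of e]])
      show "(\<lambda>u. indicator {0<..} u *\<^sub>R Q u - indicator {0<..} u *\<^sub>R (F u * p (exp (- \<theta> * u)))) \<in> borel_measurable lborel"
        by (intro borel_measurable_diff qm borel_measurable_integrable pI)
      show "AE u in lborel. norm (indicator {0<..} u *\<^sub>R Q u - indicator {0<..} u *\<^sub>R (F u * p (exp (- \<theta> * u))))
         \<le> norm (e * (indicator {0<..} u *\<^sub>R \<bar>F u\<bar>))"
        using diff e by (intro AE_I2) (simp add: abs_mult)
    qed
    from Bochner_Integration.integrable_add[OF dI pI(1)]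
    show QI: "integrable lborel (\<lambda>u. indicator {0<..} u *\<^sub>R Q u)" by simp
    have "(\<integral>u. indicator {0<..} u *\<^sub>R Q u \<partial>lborel) =
      (\<integral>u. indicator {0<..} u *\<^sub>R Q u - indicator {0<..} u *\<^sub>R (F u * p (exp (- \<theta> * u))) \<partial>lborel)"
      using Bochner_Integration.integral_diff[OF QI pI(1)] pI(2) by simp
    also have "\<dots> \<le> (\<integral>u. e * (indicator {0<..} u *\<^sub>R \<bar>F u\<bar>) \<partial>lborel)"
      by (rule integral_mono[OF dI integrable_mult_right[OF gI] abs_le_D1[OF diff]])
    also have "\<dots> = e * G" unfolding G_def by (rule integral_mult_right_zero)
    finally show "(\<integral>u. indicator {0<..} u *\<^sub>R Q u \<partial>lborel) \<le> e * G" .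
  qed
  have "isCont Q u0"
  proof -
    have "continuous_on {0<..} (\<lambda>u. (f u)\<^sup>2 * exp (- (3 / 2 * \<theta>) * u))"
      by (intro continuous_intros continuous_on_subset[OF cont]) auto
    then show ?thesis using u0 by (simp add: continuous_on_eq_continuous_at Qsq[abs_def])
  qed
  moreover have "Q u0 / 2 < Q u0" using nz by (simp add: Qsq)
  ultimately have "\<forall>\<^sub>F u in at u0. Q u0 / 2 < Q u" unfolding isCont_def by (rule order_tendstoD(1))
  then obtain d where d: "d > 0" "\<And>u. u \<noteq> u0 \<Longrightarrow> dist u u0 < d \<Longrightarrow> Q u0 / 2 < Q u"
    unfolding eventually_at by auto
  have Qd: "Q u0 / 2 \<le> Q u" if "u \<in> {u0..u0 + d / 2}" for u
  proof (cases "u = u0")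
    case False
    then show ?thesis using d(2)[of u] that d(1) by (auto simp: dist_real_def)
  qed (use Q0[of u0] in simp)
  have "integral\<^sup>L lborel (\<lambda>u. Q u0 / 2 * indicator {u0..u0 + d / 2} u) \<le> (\<integral>u. indicator {0<..} u *\<^sub>R Q u \<partial>lborel)"
  proof (rule integral_mono[OF _ Qsmall(1)[OF zero_less_one]])
    show "integrable lborel (\<lambda>u. Q u0 / 2 * indicator {u0..u0 + d / 2} u)"
      using d by (intro integrable_mult_right) simp
    show "Q u0 / 2 * indicator {u0..u0 + d / 2} u \<le> indicator {0<..} u *\<^sub>R Q u" for u
      using Qd[of u] Q0[of u] u0 by (auto simp: indicator_def)
  qed
  then have low: "Q u0 / 2 * (d / 2) \<le> (\<integral>u. indicator {0<..} u *\<^sub>R Q u \<partial>lborel)"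
    using d by simp
  have pos: "Q u0 / 2 * (d / 2) > 0" using nz d by (simp add: Qsq)
  \<comment> \<open>Chosen to make \<open>e * G\<close> at most half of the lower bound in
    \<open>low\<close>; the summand 1 covers \<open>G = 0\<close>.\<close>
  define e where "e = Q u0 / 2 * (d / 2) / (2 * (G + 1))"
  have "e > 0" unfolding e_def using pos G0 by (intro divide_pos_pos) auto
  have "e * G \<le> e * (G + 1)" using \<open>e > 0\<close> by simp
  also have "\<dots> = Q u0 / 2 * (d / 2) / 2" using G0 by (simp add: e_def field_simps)
  also have "\<dots> < Q u0 / 2 * (d / 2)" using pos by linarith
  finally show False using low Qsmall(2)[OF \<open>e > 0\<close>] by linarith
qed

section \<open>From cancelling Laplace transforms to an identity in \<open>u\<close>\<close>

lemma power_div_fact_le_exp: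
  fixes x :: real
  assumes "x \<ge> 0"
  shows "x ^ n / fact n \<le> exp x"
proof -
  have "(\<Sum>i\<in>{n}. x ^ i /\<^sub>R fact i) \<le> (\<Sum>i. x ^ i /\<^sub>R fact i)"
    using assms by (intro sum_le_suminf summable_exp_generic) auto
  then show ?thesis by (simp add: exp_def divide_inverse mult.commute)
qed

lemma power_div_fact_le_exp_scaled:
  fixes u a :: real
  assumes "u \<ge> 0" "a > 0"
  shows "u ^ n / fact n \<le> (1 / a ^ n) * exp (a * u)"
proof -
  have "(a * u) ^ n / fact n \<le> exp (a * u)" using assms by (intro power_div_fact_le_exp) auto
  then have "(1 / a ^ n) * ((a * u) ^ n / fact n) \<le> (1 / a ^ n) * exp (a * u)"
    using assms by (intro mult_left_mono) auto
  moreover have "(1 / a ^ n) * ((a * u) ^ n / fact n) = u ^ n / fact n"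
    using assms by (simp add: power_mult_distrib)
  ultimately show ?thesis by simp
qed

lemma continuous_on_suminf_dominated:
  fixes f :: "nat \<Rightarrow> real \<Rightarrow> 'a :: banach"
  assumes "\<And>r. continuous_on S (f r)" "\<And>r u. u \<in> S \<Longrightarrow> norm (f r u) \<le> M r" "summable M"
  shows "continuous_on S (\<lambda>u. \<Sum>r. f r u)"
proof (rule uniform_limit_theorem)
  show "uniform_limit S (\<lambda>n u. \<Sum>i<n. f i u) (\<lambda>u. \<Sum>r. f r u) sequentially"
    by (rule Weierstrass_m_test) (use assms in auto)
  show "\<forall>\<^sub>F n in sequentially. continuous_on S (\<lambda>u. \<Sum>i<n. f i u)"
    by (intro always_eventually allI continuous_on_sum assms)
qed simp

text \<open>At \<open>s = n * \<theta>\<close> the three parts have as Laplace transforms the sums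
  of \<open>w j * exp (- s * t j) / s ^ k\<close>, of \<open>q i / s ^ (k - i)\<close> and of
  \<open>b \<sigma> / (s - \<tau> \<sigma>)\<close>. After multiplication by \<open>s ^ k\<close>
  the hypothesis \<open>lim\<close> says exactly that they cancel, and Lerch's theorem applies to
  real and imaginary parts. With \<open>k \<ge> 2\<close> the truncated powers are continuous in
  \<open>u\<close>.\<close>

lemma laplace_explicit_formula:
  fixes t w :: "nat \<Rightarrow> real" and A :: "nat \<Rightarrow> complex set" and b \<tau> :: "complex \<Rightarrow> complex"
    and q :: "nat \<Rightarrow> complex"
  assumes t: "\<And>n. t n \<ge> 0" and w: "\<And>n. w n \<ge> 0" and sw: "summable w" and k: "k \<ge> 2"
    and \<tau>: "\<And>r \<sigma>. \<sigma> \<in> A r \<Longrightarrow> Re (\<tau> \<sigma>) \<le> 0"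
    and M: "summable (\<lambda>r. \<Sum>\<sigma>\<in>A r. norm (b \<sigma>))" and th: "\<theta> > 0"
    and lim: "\<And>n s. n \<ge> 1 \<Longrightarrow> s = real n * \<theta> \<Longrightarrow>
      (\<lambda>R. \<Sum>r<R. \<Sum>\<sigma>\<in>A r. b \<sigma> * (of_real s ^ k / (of_real s - \<tau> \<sigma>))) \<longlonglongrightarrow>
        - of_real (\<Sum>j. w j * exp (- s * t j)) - (\<Sum>i<k. q i * of_real s ^ i)"
    and u: "u > 0"
  shows "of_real (\<Sum>j. w j * (max 0 (u - t j) ^ (k - 1) / fact (k - 1))) +
    (\<Sum>i<k. q i * of_real (u ^ (k - 1 - i) / fact (k - 1 - i))) +
    (\<Sum>r. \<Sum>\<sigma>\<in>A r. b \<sigma> * exp (\<tau> \<sigma> * of_real u)) = 0"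
proof -
  define M' where "M' r = (\<Sum>\<sigma>\<in>A r. norm (b \<sigma>))" for r
  define F where "F u = (\<Sum>j. w j * (max 0 (u - t j) ^ (k - 1) / fact (k - 1)))" for u
  define P where "P u = (\<Sum>i<k. q i * of_real (u ^ (k - 1 - i) / fact (k - 1 - i)))" for u :: real
  define g where "g r u = (\<Sum>\<sigma>\<in>A r. b \<sigma> * exp (\<tau> \<sigma> * of_real u))" for r and u :: real
  define G where "G u = (\<Sum>r. g r u)" for u
  define H where "H u = complex_of_real (F u) + P u + G u" for u
  obtain k0 where k0: "k = Suc (Suc k0)" using k by (metis add_2_eq_Suc le_Suc_ex)
  have maxle: "max 0 (u - t j) \<le> u" if "u \<ge> 0" for u j using that t[of j] by simp
  have Fterm: "w j * (max 0 (u - t j) ^ (k - 1) / fact (k - 1)) \<le> w j * (u ^ (k - 1) / fact (k - 1))"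
    if "u \<ge> 0" for u j
    using maxle[OF that] w by (intro mult_left_mono divide_right_mono power_mono) auto
  have Fsm: "summable (\<lambda>j. w j * (max 0 (u - t j) ^ (k - 1) / fact (k - 1)))" if "u \<ge> 0" for u
    by (rule summable_comparison_test'[OF summable_mult2[OF sw, of "u ^ (k - 1) / fact (k - 1)"]])
       (use Fterm[OF that] w in auto)
  have gb: "norm (g r u) \<le> M' r" if "u \<ge> 0" for r u
    unfolding g_def M'_def
  proof (rule sum_norm_le)
    fix \<sigma> assume "\<sigma> \<in> A r"
    then have "exp (Re (\<tau> \<sigma>) * u) \<le> 1" using \<tau> that by (simp add: mult_nonpos_nonneg)
    then have "norm (b \<sigma>) * exp (Re (\<tau> \<sigma>) * u) \<le> norm (b \<sigma>) * 1" by (rule mult_left_mono) simp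
    then show "norm (b \<sigma> * exp (\<tau> \<sigma> * complex_of_real u)) \<le> norm (b \<sigma>)" by (simp add: norm_mult)
  qed
  have M'sm: "summable M'" using M unfolding M'_def .
  have cG: "continuous_on {0..} G" unfolding G_def
    by (rule continuous_on_suminf_dominated[OF _ _ M'sm])
       (use gb in \<open>auto simp: g_def intro!: continuous_intros\<close>)
  have cP: "continuous_on {0..} P" unfolding P_def by (intro continuous_intros) auto
  have cF: "continuous_on {0..} F"
  proof -
    \<comment> \<open>The series itself need not converge uniformly on the half-line; multiplied by
      \<open>exp (- u)\<close> it is dominated by \<open>w\<close>, because
      \<open>u ^ n / fact n \<le> exp u\<close>.\<close>
    have "continuous_on {0..} (\<lambda>u. \<Sum>j. w j * (max 0 (u - t j) ^ (k - 1) / fact (k - 1)) * exp (- u))"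
    proof (rule continuous_on_suminf_dominated[OF _ _ sw])
      show "continuous_on {0..} (\<lambda>u. w r * (max 0 (u - t r) ^ (k - 1) / fact (k - 1)) * exp (- u))" for r
        by (intro continuous_intros) auto
      fix j and u :: real assume u: "u \<in> {0..}"
      have "w j * (max 0 (u - t j) ^ (k - 1) / fact (k - 1)) * exp (- u) \<le> w j * (u ^ (k - 1) / fact (k - 1)) * exp (- u)"
        using Fterm[of u j] u by (intro mult_right_mono) auto
      also have "\<dots> \<le> w j * exp u * exp (- u)"
        using u w by (intro mult_right_mono mult_left_mono power_div_fact_le_exp) auto
      also have "\<dots> = w j" by (simp add: mult.assoc exp_add[symmetric])
      finally show "norm (w j * (max 0 (u - t j) ^ (k - 1) / fact (k - 1)) * exp (- u)) \<le> w j"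
        using w[of j] by (simp add: abs_mult)
    qed
    then have c: "continuous_on {0..} (\<lambda>u. (\<Sum>j. w j * (max 0 (u - t j) ^ (k - 1) / fact (k - 1)) * exp (- u)) * exp u)"
      by (intro continuous_intros)
    have "(\<Sum>j. w j * (max 0 (u - t j) ^ (k - 1) / fact (k - 1)) * exp (- u)) * exp u = F u" if "u \<ge> 0" for u
      unfolding F_def suminf_mult2[OF Fsm[OF that], symmetric] by (simp add: mult.assoc exp_add[symmetric])
    then show ?thesis by (intro continuous_on_eq[OF c]) (simp only: atLeast_iff)
  qed
  have cH: "continuous_on {0..} H" unfolding H_def by (intro continuous_intros cF cP cG)
  define a where "a = \<theta> / 4"
  have a: "a > 0" using th by (simp add: a_def)
  define C where "C = suminf w * (1 / a ^ (k - 1)) + (\<Sum>i<k. norm (q i) * (1 / a ^ (k - 1 - i))) + suminf M'"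
  have Hb: "norm (H u) \<le> C * exp (a * u)" if u: "u \<ge> 0" for u
  proof -
    have "F u \<le> (\<Sum>j. w j * (u ^ (k - 1) / fact (k - 1)))" unfolding F_def
      by (rule suminf_le[OF Fterm[OF u] Fsm[OF u] summable_mult2[OF sw]])
    also have "\<dots> = suminf w * (u ^ (k - 1) / fact (k - 1))" by (rule suminf_mult2[OF sw, symmetric])
    also have "\<dots> \<le> suminf w * (1 / a ^ (k - 1) * exp (a * u))"
      using suminf_nonneg[OF sw w] by (intro mult_left_mono power_div_fact_le_exp_scaled u a)
    finally have 1: "F u \<le> suminf w * (1 / a ^ (k - 1)) * exp (a * u)" by (simp add: mult.assoc)
    have F0: "F u \<ge> 0" unfolding F_def using w by (intro suminf_nonneg[OF Fsm[OF u]]) auto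
    have "norm (P u) \<le> (\<Sum>i<k. norm (q i) * (1 / a ^ (k - 1 - i)) * exp (a * u))" unfolding P_def
    proof (rule sum_norm_le)
      fix i
      have "norm (q i) * (u ^ (k - 1 - i) / fact (k - 1 - i)) \<le> norm (q i) * (1 / a ^ (k - 1 - i) * exp (a * u))"
        by (intro mult_left_mono power_div_fact_le_exp_scaled u a) auto
      moreover have "norm (q i * complex_of_real (u ^ (k - 1 - i) / fact (k - 1 - i))) = norm (q i) * (u ^ (k - 1 - i) / fact (k - 1 - i))"
        unfolding norm_mult norm_of_real using u by simp
      ultimately show "norm (q i * complex_of_real (u ^ (k - 1 - i) / fact (k - 1 - i))) \<le> norm (q i) * (1 / a ^ (k - 1 - i)) * exp (a * u)"
        by (simp only: mult.assoc)
    qed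
    also have "\<dots> = (\<Sum>i<k. norm (q i) * (1 / a ^ (k - 1 - i))) * exp (a * u)" by (simp only: sum_distrib_right)
    finally have 2: "norm (P u) \<le> (\<Sum>i<k. norm (q i) * (1 / a ^ (k - 1 - i))) * exp (a * u)" .
    have "summable (\<lambda>r. norm (g r u))"
      by (rule summable_comparison_test'[OF M'sm]) (use gb[OF u] in auto)
    then have "norm (G u) \<le> (\<Sum>r. norm (g r u))" unfolding G_def by (rule summable_norm)
    also have "\<dots> \<le> suminf M'" by (rule suminf_le[OF gb[OF u] \<open>summable (\<lambda>r. norm (g r u))\<close> M'sm])
    also have "\<dots> \<le> suminf M' * exp (a * u)"
    proof -
      have "suminf M' \<ge> 0" by (rule suminf_nonneg[OF M'sm]) (auto simp: M'_def sum_nonneg)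
      moreover have "exp (a * u) \<ge> 1" using a u by simp
      ultimately show ?thesis using mult_left_mono[of 1 "exp (a * u)" "suminf M'"] by simp
    qed
    finally have 3: "norm (G u) \<le> suminf M' * exp (a * u)" .
    have "norm (H u) \<le> norm (complex_of_real (F u)) + norm (P u) + norm (G u)"
      unfolding H_def by (intro norm_triangle_le add_right_mono norm_triangle_ineq)
    then show ?thesis using 1 2 3 F0 by (simp add: C_def distrib_right)
  qed
  have zero: "has_hl_integral (\<lambda>u. H u * of_real (exp (- (real n * \<theta>) * u))) 0" if n: "n \<ge> 1" for n :: nat
  proof -
    define s where "s = real n * \<theta>"
    have s: "s > 0" using n th by (simp add: s_def)
    have iF: "has_hl_integral (\<lambda>u. F u * exp (- s * u)) (\<Sum>j. w j * exp (- s * t j) / s ^ k)"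
    proof -
      let ?f = "\<lambda>j u. w j / fact (k - 1) * (max 0 (u - t j) ^ (k - 1) * exp (- s * u))"
      have f: "has_hl_integral (?f j) (w j * exp (- s * t j) / s ^ k)" for j
      proof -
        have "has_hl_integral (?f j) (w j / fact (k - 1) * (fact (k - 1) * exp (- s * t j) / s ^ k))"
          using has_hl_integral_power_exp(1)[OF s t[of j], of k0] unfolding k0
          by (intro has_hl_integral_cmult) simp
        then show ?thesis by simp
      qed
      have bd: "norm (?f j u) \<le> (w j / fact (k - 1)) * (u ^ (k - 1) * exp (- s * u))" if "u > 0" for j u
      proof -
        have "max 0 (u - t j) ^ (k - 1) * exp (- s * u) \<le> u ^ (k - 1) * exp (- s * u)"
          using maxle[of u j] that by (intro mult_right_mono power_mono) auto
        then show ?thesis using w[of j] by (simp add: abs_mult mult_left_mono divide_right_mono)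
      qed
      have "has_hl_integral (\<lambda>u. \<Sum>j. ?f j u) (\<Sum>j. w j * exp (- s * t j) / s ^ k)"
        by (rule has_hl_integral_suminf(2)[OF f has_hl_integral_power_exp(2)[OF s order_refl, of "k - 1"] bd summable_divide[OF sw]])
      moreover have "(\<Sum>j. ?f j u) = F u * exp (- s * u)" if "u > 0" for u
        unfolding F_def suminf_mult2[OF Fsm[OF less_imp_le[OF that]]] by (simp add: mult_ac)
      ultimately show ?thesis by (subst has_hl_integral_cong[where g = "\<lambda>u. \<Sum>j. ?f j u"]) auto
    qed
    have iP: "has_hl_integral (\<lambda>u. P u * of_real (exp (- s * u))) (\<Sum>i<k. q i * of_real (1 / s ^ (k - i)))"
    proof -
      have "has_hl_integral (\<lambda>u. \<Sum>i<k. q i * of_real ((1 / fact (k - 1 - i)) * (u ^ (k - 1 - i) * exp (- s * u))))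
        (\<Sum>i<k. q i * of_real ((1 / fact (k - 1 - i)) * (fact (k - 1 - i) / s ^ Suc (k - 1 - i))))"
        by (intro has_hl_integral_sum has_hl_integral_cmult has_hl_integral_bounded_linear[OF bounded_linear_of_real]
              has_hl_integral_power_exp(2)[OF s order_refl])
      moreover have "(\<Sum>i<k. q i * of_real ((1 / fact (k - 1 - i)) * (fact (k - 1 - i) / s ^ Suc (k - 1 - i)))) =
        (\<Sum>i<k. q i * complex_of_real (1 / s ^ (k - i)))"
      proof (rule sum.cong[OF refl])
        fix i assume "i \<in> {..<k}"
        then have "Suc (k - 1 - i) = k - i" by auto
        then have "(1 / fact (k - 1 - i)) * (fact (k - 1 - i) / s ^ Suc (k - 1 - i)) = 1 / s ^ (k - i)" by simp
        then show "q i * of_real ((1 / fact (k - 1 - i)) * (fact (k - 1 - i) / s ^ Suc (k - 1 - i))) = q i * complex_of_real (1 / s ^ (k - i))"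
          by (simp only:)
      qed
      moreover have "(\<Sum>i<k. q i * of_real ((1 / fact (k - 1 - i)) * (u ^ (k - 1 - i) * exp (- s * u)))) = P u * of_real (exp (- s * u))" for u
        unfolding P_def sum_distrib_right by (rule sum.cong[OF refl]) simp
      ultimately show ?thesis by simp
    qed
    let ?v = "\<lambda>r. \<Sum>\<sigma>\<in>A r. b \<sigma> * (1 / (of_real s - \<tau> \<sigma>))"
    let ?f = "\<lambda>r u. \<Sum>\<sigma>\<in>A r. b \<sigma> * exp (- (of_real s - \<tau> \<sigma>) * of_real u)"
    have fg: "?f r u = g r u * of_real (exp (- s * u))" for r u
      unfolding g_def sum_distrib_right
    proof (rule sum.cong[OF refl])
      fix \<sigma>
      have "exp (- (of_real s - \<tau> \<sigma>) * of_real u) = exp (\<tau> \<sigma> * of_real u) * complex_of_real (exp (- s * u))"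
        by (simp add: exp_of_real[symmetric] exp_add[symmetric] algebra_simps)
      then show "b \<sigma> * exp (- (of_real s - \<tau> \<sigma>) * of_real u) = b \<sigma> * exp (\<tau> \<sigma> * of_real u) * of_real (exp (- s * u))"
        by simp
    qed
    have f: "has_hl_integral (?f r) (?v r)" for r
      using \<tau> s by (intro has_hl_integral_sum has_hl_integral_cmult has_hl_integral_cexp) fastforce
    have bd: "norm (?f r u) \<le> M' r * (u ^ 0 * exp (- s * u))" if "u > 0" for r u
      unfolding fg norm_mult using gb[of u r] that by (simp add: mult_right_mono)
    note iG' = has_hl_integral_suminf[OF f has_hl_integral_power_exp(2)[OF s order_refl, of 0] bd M'sm]
    have gsm: "summable (\<lambda>r. g r u)" if "u > 0" for u
      by (rule summable_comparison_test'[OF M'sm]) (use gb[of u] that in auto)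
    have iG: "has_hl_integral (\<lambda>u. G u * of_real (exp (- s * u))) (suminf ?v)"
    proof -
      have "(\<Sum>r. ?f r u) = G u * of_real (exp (- s * u))" if "u > 0" for u
        unfolding fg G_def by (rule suminf_mult2[OF gsm[OF that], symmetric])
      then show ?thesis using iG'(2) by (subst has_hl_integral_cong[where g = "\<lambda>u. \<Sum>r. ?f r u"]) auto
    qed
    have sne: "s \<noteq> 0" "complex_of_real s \<noteq> 0" using s by auto
    have "?v sums suminf ?v" using iG'(1) by (rule summable_sums)
    then have "(\<lambda>r. of_real s ^ k * ?v r) sums (of_real s ^ k * suminf ?v)" by (rule sums_mult)
    then have "(\<lambda>R. \<Sum>r<R. of_real s ^ k * ?v r) \<longlonglongrightarrow> of_real s ^ k * suminf ?v" by (simp only: sums_def)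
    moreover have "(\<Sum>r<R. of_real s ^ k * ?v r) = (\<Sum>r<R. \<Sum>\<sigma>\<in>A r. b \<sigma> * (of_real s ^ k / (of_real s - \<tau> \<sigma>)))" for R
      by (simp add: sum_distrib_left mult_ac)
    ultimately have eq: "of_real s ^ k * suminf ?v = - of_real (\<Sum>j. w j * exp (- s * t j)) - (\<Sum>i<k. q i * of_real s ^ i)"
      using lim[OF n s_def] by (simp only:) (rule LIMSEQ_unique)
    have ws: "summable (\<lambda>j. w j * exp (- s * t j))"
    proof (rule summable_comparison_test'[OF sw])
      fix j
      have "w j * exp (- s * t j) \<le> w j * 1" using w[of j] t[of j] s by (intro mult_left_mono) auto
      then show "norm (w j * exp (- s * t j)) \<le> w j" using w[of j] by simp
    qed
    have e1: "of_real s ^ k * complex_of_real (\<Sum>j. w j * exp (- s * t j) / s ^ k) = of_real (\<Sum>j. w j * exp (- s * t j))"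
      unfolding suminf_divide[OF ws] using sne by simp
    have e2: "of_real s ^ k * (\<Sum>i<k. q i * complex_of_real (1 / s ^ (k - i))) = (\<Sum>i<k. q i * of_real s ^ i)"
      unfolding sum_distrib_left
    proof (rule sum.cong[OF refl])
      fix i assume "i \<in> {..<k}"
      then have "of_real s ^ k = complex_of_real s ^ (k - i) * of_real s ^ i" by (simp add: power_add[symmetric])
      then show "of_real s ^ k * (q i * complex_of_real (1 / s ^ (k - i))) = q i * of_real s ^ i"
        using sne by simp
    qed
    define v where "v = complex_of_real (\<Sum>j. w j * exp (- s * t j) / s ^ k) + (\<Sum>i<k. q i * of_real (1 / s ^ (k - i))) + suminf ?v"
    have "of_real s ^ k * v = 0"
      unfolding v_def distrib_left e1 e2 eq by simp
    then have "v = 0" using sne by simp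
    moreover have "has_hl_integral (\<lambda>u. of_real (F u * exp (- s * u)) + P u * of_real (exp (- s * u)) + G u * of_real (exp (- s * u))) v"
      unfolding v_def by (intro has_hl_integral_add iP iG has_hl_integral_bounded_linear[OF bounded_linear_of_real] iF)
    ultimately show ?thesis unfolding s_def[symmetric] H_def by (simp add: distrib_right)
  qed
  have "Re (H u) = 0"
  proof (rule lerch_real[OF _ th _ _ u])
    show "continuous_on {0..} (\<lambda>u. Re (H u))" by (intro continuous_intros cH)
    show "\<bar>Re (H u)\<bar> \<le> C * exp (\<theta> / 4 * u)" if "u \<ge> 0" for u
      using Hb[OF that] abs_Re_le_cmod[of "H u"] by (simp add: a_def)
    show "has_hl_integral (\<lambda>u. Re (H u) * exp (- (real n * \<theta>) * u)) 0" if "n \<ge> 1" for n :: nat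
      using has_hl_integral_bounded_linear[OF bounded_linear_Re zero[OF that]] by simp
  qed
  moreover have "Im (H u) = 0"
  proof (rule lerch_real[OF _ th _ _ u])
    show "continuous_on {0..} (\<lambda>u. Im (H u))" by (intro continuous_intros cH)
    show "\<bar>Im (H u)\<bar> \<le> C * exp (\<theta> / 4 * u)" if "u \<ge> 0" for u
      using Hb[OF that] abs_Im_le_cmod[of "H u"] by (simp add: a_def)
    show "has_hl_integral (\<lambda>u. Im (H u) * exp (- (real n * \<theta>) * u)) 0" if "n \<ge> 1" for n :: nat
      using has_hl_integral_bounded_linear[OF bounded_linear_Im zero[OF that]] by simp
  qed
  ultimately have "H u = 0" by (simp add: complex_eq_iff)
  then show ?thesis by (simp add: H_def F_def P_def G_def g_def)
qed

section \<open>Iterated differences and mean squares of exponential sums\<close>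

definition fdiff :: "real \<Rightarrow> (real \<Rightarrow> 'a :: real_normed_vector) \<Rightarrow> real \<Rightarrow> 'a" where
  "fdiff h f u = f (u + h) - f u"

abbreviation fdiffs :: "real \<Rightarrow> nat \<Rightarrow> (real \<Rightarrow> 'a :: real_normed_vector) \<Rightarrow> real \<Rightarrow> 'a" where
  "fdiffs h k \<equiv> fdiff h ^^ k"

lemma fdiffs_Suc: "fdiffs h (Suc k) f u = fdiffs h k f (u + h) - fdiffs h k f u"
  by (simp add: fdiff_def)

lemma fdiffs_cong:
  assumes "\<And>u. u > 0 \<Longrightarrow> f u = g u" "h \<ge> 0" "u > 0"
  shows "fdiffs h k f u = fdiffs h k g u"
  using assms(3)
proof (induction k arbitrary: u)
  case (Suc k)
  then have "u + h > 0" using assms(2) by simp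
  then show ?case unfolding fdiffs_Suc using Suc by simp
qed (use assms in simp)

lemma fdiffs_add: "fdiffs h k (\<lambda>u. f u + g u) u = fdiffs h k f u + fdiffs h k g u"
  by (induction k arbitrary: u) (simp_all only: fdiffs_Suc, simp_all)

lemma fdiffs_sum: "fdiffs h k (\<lambda>u. \<Sum>i\<in>I. f i u) u = (\<Sum>i\<in>I. fdiffs h k (f i) u)"
  by (induction k arbitrary: u) (simp_all only: fdiffs_Suc sum_subtractf, simp_all)

lemma fdiffs_bounded_linear:
  assumes "bounded_linear T"
  shows "fdiffs h k (\<lambda>u. T (f u)) u = T (fdiffs h k f u)"
  by (induction k arbitrary: u) (simp_all only: fdiffs_Suc linear_simps(2)[OF assms], simp_all)

lemma fdiffs_cmult:
  fixes c :: "'a :: real_normed_algebra"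
  shows "fdiffs h k (\<lambda>u. c * f u) u = c * fdiffs h k f u"
  by (rule fdiffs_bounded_linear[OF bounded_linear_mult_right])

lemma fdiffs_shift: "fdiffs h k (\<lambda>u. f (u - t)) u = fdiffs h k f (u - t)"
  by (induction k arbitrary: u) (simp_all only: fdiffs_Suc, simp_all add: algebra_simps)

lemma fdiffs_suminf:
  fixes f :: "nat \<Rightarrow> real \<Rightarrow> 'a :: banach"
  assumes sm: "\<And>u. u > 0 \<Longrightarrow> summable (\<lambda>r. f r u)" and h: "h \<ge> 0" and u: "u > 0"
  shows "summable (\<lambda>r. fdiffs h k (f r) u)"
    "fdiffs h k (\<lambda>u. \<Sum>r. f r u) u = (\<Sum>r. fdiffs h k (f r) u)"
proof -
  have "summable (\<lambda>r. fdiffs h k (f r) u) \<and> fdiffs h k (\<lambda>u. \<Sum>r. f r u) u = (\<Sum>r. fdiffs h k (f r) u)"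
    using u
  proof (induction k arbitrary: u)
    case (Suc k)
    have "u + h > 0" using Suc.prems h by simp
    note 1 = Suc.IH[OF this] and 2 = Suc.IH[OF Suc.prems]
    have "summable (\<lambda>r. fdiffs h k (f r) (u + h) - fdiffs h k (f r) u)"
      using 1 2 by (intro summable_diff) auto
    moreover have "(\<Sum>r. fdiffs h k (f r) (u + h) - fdiffs h k (f r) u) =
      (\<Sum>r. fdiffs h k (f r) (u + h)) - (\<Sum>r. fdiffs h k (f r) u)"
      using 1 2 by (intro suminf_diff[symmetric]) auto
    ultimately show ?case unfolding fdiffs_Suc using 1 2 by simp
  qed (use sm in simp)
  then show "summable (\<lambda>r. fdiffs h k (f r) u)"
    "fdiffs h k (\<lambda>u. \<Sum>r. f r u) u = (\<Sum>r. fdiffs h k (f r) u)" by auto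
qed

text \<open>Each difference lowers the degree by one. This disposes of the polynomial in the
  explicit formula, about whose coefficients nothing is known.\<close>

lemma fdiffs_power_eq_0: "m < k \<Longrightarrow> fdiffs h k (\<lambda>u. u ^ m) u = 0"
proof (induction k arbitrary: m u)
  case (Suc k)
  have *: "fdiff h (\<lambda>u. u ^ m) = (\<lambda>u. \<Sum>i<m. (of_nat (m choose i) * h ^ (m - i)) * u ^ i)"
  proof
    fix u
    have "(u + h) ^ m = (\<Sum>i\<le>m. of_nat (m choose i) * u ^ i * h ^ (m - i))" by (rule binomial_ring)
    also have "\<dots> = (\<Sum>i<m. of_nat (m choose i) * u ^ i * h ^ (m - i)) + u ^ m"
      by (simp add: lessThan_Suc_atMost[symmetric])
    finally show "fdiff h (\<lambda>u. u ^ m) u = (\<Sum>i<m. (of_nat (m choose i) * h ^ (m - i)) * u ^ i)"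
      by (simp add: fdiff_def mult_ac)
  qed
  have "fdiffs h (Suc k) (\<lambda>u. u ^ m) u = fdiffs h k (fdiff h (\<lambda>u. u ^ m)) u"
    by (simp add: funpow_swap1)
  also have "\<dots> = (\<Sum>i<m. (of_nat (m choose i) * h ^ (m - i)) * fdiffs h k (\<lambda>u. u ^ i) u)"
    unfolding * fdiffs_sum fdiffs_cmult ..
  also have "\<dots> = 0" using Suc by (intro sum.neutral) auto
  finally show ?case .
qed simp

lemma fdiffs_cexp: "fdiffs h k (\<lambda>u. exp (z * complex_of_real u)) u = (exp (z * of_real h) - 1) ^ k * exp (z * of_real u)"
proof (induction k arbitrary: u)
  case (Suc k)
  show ?case unfolding fdiffs_Suc Suc by (simp add: algebra_simps exp_add)
qed simp

lemma has_derivative_max_power: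
  "((\<lambda>v::real. max 0 v ^ Suc (Suc n)) has_field_derivative of_nat (Suc (Suc n)) * max 0 v ^ Suc n) (at v)"
proof (cases v "0 :: real" rule: linorder_cases)
  case less
  have "((\<lambda>v::real. 0) has_field_derivative 0) (at v)" by simp
  then have "((\<lambda>v::real. max 0 v ^ Suc (Suc n)) has_field_derivative 0) (at v)"
    by (rule has_field_derivative_transform_within_open[of _ _ _ "{..<0}"]) (use less in auto)
  then show ?thesis using less by simp
next
  case greater
  have "((\<lambda>v::real. v ^ Suc (Suc n)) has_field_derivative of_nat (Suc (Suc n)) * v ^ Suc n) (at v)"
    by (auto intro!: derivative_eq_intros simp del: power_Suc)
  then have "((\<lambda>v::real. max 0 v ^ Suc (Suc n)) has_field_derivative of_nat (Suc (Suc n)) * v ^ Suc n) (at v)"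
    by (rule has_field_derivative_transform_within_open[of _ _ _ "{0<..}"]) (use greater in auto)
  then show ?thesis using greater by simp
next
  case equal
  have "((\<lambda>y::real. max 0 y ^ Suc (Suc n) / y) \<longlongrightarrow> 0) (at 0)"
  proof (rule Lim_null_comparison)
    have "((\<lambda>y::real. \<bar>y\<bar> ^ Suc n) \<longlongrightarrow> \<bar>0\<bar> ^ Suc n) (at 0)" by (intro tendsto_intros)
    then show "((\<lambda>y::real. \<bar>y\<bar> ^ Suc n) \<longlongrightarrow> 0) (at 0)" by simp
    show "\<forall>\<^sub>F y in at 0. norm (max 0 y ^ Suc (Suc n) / y) \<le> \<bar>y :: real\<bar> ^ Suc n"
    proof (intro always_eventually allI)
      fix y :: real
      show "norm (max 0 y ^ Suc (Suc n) / y) \<le> \<bar>y\<bar> ^ Suc n"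
      proof (cases "y > 0")
        case True
        then show ?thesis by simp
      next
        case False
        then have "max 0 y = 0" by simp
        then have "norm (max 0 y ^ Suc (Suc n) / y) = 0" by simp
        then show ?thesis using zero_le_power[OF abs_ge_zero, of y "Suc n"] by linarith
      qed
    qed
  qed
  then show ?thesis using equal by (simp add: has_field_derivative_iff)
qed

lemma fdiffs_has_derivative:
  fixes f :: "real \<Rightarrow> real"
  assumes "\<And>v. (f has_field_derivative f' v) (at v)"
  shows "(fdiffs h k f has_field_derivative fdiffs h k f' v) (at v)"
proof (induction k arbitrary: v)
  case (Suc k)
  have "((\<lambda>v. fdiffs h k f (v + h) - fdiffs h k f v) has_field_derivative fdiffs h k f' (v + h) - fdiffs h k f' v) (at v)"
    using Suc.IH[of "v + h"] Suc.IH[of v] unfolding DERIV_shift by (rule DERIV_diff)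
  then show ?case by (simp add: fdiff_def[abs_def])
qed (use assms in simp)

text \<open>Up to a factor this is a B-spline. The derivative of \<open>F\<close> is a positive
  multiple of the spline of one degree less, so by induction \<open>F\<close> is monotone and its
  next difference is non-negative. The induction starts with the hat function.\<close>

lemma fdiffs_max_power_nonneg:
  assumes h: "h \<ge> 0"
  shows "fdiffs h (Suc (Suc n)) (\<lambda>v::real. max 0 v ^ Suc n) v \<ge> 0"
proof (induction n arbitrary: v)
  case 0
  show ?case using h by (simp add: fdiff_def max_def)
next
  case (Suc n)
  define F where "F = fdiffs h (Suc (Suc n)) (\<lambda>v::real. max 0 v ^ Suc (Suc n))"
  define F' where "F' = fdiffs h (Suc (Suc n)) (\<lambda>v::real. of_nat (Suc (Suc n)) * max 0 v ^ Suc n)"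
  have "(F has_field_derivative F' x) (at x)" for x
    unfolding F_def F'_def by (rule fdiffs_has_derivative[OF has_derivative_max_power])
  moreover have "F' x \<ge> 0" for x
    unfolding F'_def fdiffs_cmult using Suc.IH[of x] by (intro mult_nonneg_nonneg) auto
  ultimately have "F v \<le> F (v + h)"
    using h by (intro DERIV_nonneg_imp_nondecreasing[of v "v + h" F]) auto
  then show ?case unfolding F_def by (subst fdiffs_Suc) simp
qed

text \<open>Of the points \<open>v, v + h, ..., v + k * h\<close> all but the last lie in the region
  where \<open>f\<close> vanishes.\<close>

lemma fdiffs_left_end:
  assumes "\<And>v. v \<le> 0 \<Longrightarrow> f v = 0" "h \<ge> 0"
  shows "v \<le> - (real k - 1) * h \<Longrightarrow> fdiffs h k f v = f (v + real k * h)"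
proof (induction k arbitrary: v)
  case (Suc k)
  have v: "v + real k * h \<le> 0" using Suc.prems by (simp add: algebra_simps)
  have 1: "fdiffs h k f (v + h) = f (v + h + real k * h)"
    using v by (intro Suc.IH) (simp add: algebra_simps)
  have 2: "fdiffs h k f v = f (v + real k * h)"
    using v assms(2) by (intro Suc.IH) (simp add: algebra_simps)
  show ?case unfolding fdiffs_Suc 1 2 using assms(1)[OF v] by (simp add: algebra_simps)
qed simp

section \<open>Mean squares of finite exponential sums\<close>

lemma integral_cexp_bound:
  fixes z :: complex
  assumes ab: "0 \<le> a" "a \<le> b" and E: "\<And>u. u \<in> {a..b} \<Longrightarrow> exp (Re z * u) \<le> E"
  shows "norm (integral {a..b} (\<lambda>u. exp (z * of_real u))) \<le> E * (2 * (b - a) + 4) / (1 + norm z)"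
proof -
  have cont: "continuous_on {a..b} (\<lambda>u. exp (z * of_real u))" by (intro continuous_intros)
  have E0: "E \<ge> 0" using E[of a] ab by (meson atLeastAtMost_iff exp_ge_zero order_refl order_trans)
  have nE: "norm (exp (z * of_real u)) \<le> E" if "u \<in> {a..b}" for u using E[OF that] by simp
  show ?thesis
  \<comment> \<open>For small \<open>z\<close> the trivial bound \<open>E * (b - a)\<close> is used
    with \<open>1 + norm z \<le> 2\<close>; otherwise integration gives
    \<open>2 * E / norm z\<close>, and \<open>2 / norm z \<le> 4 / (1 + norm z)\<close>. The
    constant \<open>2 * (b - a) + 4\<close> covers both cases.\<close>
  proof (cases "norm z \<le> 1")
    case True
    have "norm (integral {a..b} (\<lambda>u. exp (z * of_real u))) \<le> E * (b - a)"
      by (rule integral_bound[OF ab(2) cont nE])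
    also have "\<dots> \<le> E * ((2 * (b - a) + 4) / (1 + norm z))"
    proof (rule mult_left_mono[OF _ E0])
      have "(b - a) * (1 + norm z) \<le> (b - a) * 2" using True ab by (intro mult_left_mono) auto
      then show "b - a \<le> (2 * (b - a) + 4) / (1 + norm z)"
        by (subst pos_le_divide_eq) (auto intro: add_pos_nonneg)
    qed
    finally show ?thesis by simp
  next
    case False
    then have z: "z \<noteq> 0" by auto
    have "((\<lambda>u. exp (z * of_real u)) has_integral exp (z * of_real b) / z - exp (z * of_real a) / z) {a..b}"
    proof (rule fundamental_theorem_of_calculus[OF ab(2)])
      fix x :: real
      have "((\<lambda>w. exp (z * w) / z) has_field_derivative exp (z * of_real x)) (at (of_real x))"
        using z by (auto intro!: derivative_eq_intros)
      from field_vector_diff_chain_at[OF has_vector_derivative_of_real[OF DERIV_ident] this]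
      show "((\<lambda>u. exp (z * of_real u) / z) has_vector_derivative exp (z * of_real x)) (at x within {a..b})"
        by (simp add: o_def has_vector_derivative_at_within)
    qed
    then have "norm (integral {a..b} (\<lambda>u. exp (z * of_real u))) = norm (exp (z * of_real b) / z - exp (z * of_real a) / z)"
      by (simp add: integral_unique)
    also have "\<dots> \<le> norm (exp (z * of_real b)) / norm z + norm (exp (z * of_real a)) / norm z"
      by (rule order_trans[OF norm_triangle_ineq4]) (simp only: norm_divide)
    also have "\<dots> \<le> E / norm z + E / norm z"
      using nE[of a] nE[of b] ab by (intro add_mono divide_right_mono) auto
    also have "\<dots> = E * (2 / norm z)" by simp
    also have "\<dots> \<le> E * ((2 * (b - a) + 4) / (1 + norm z))"
    proof (rule mult_left_mono[OF _ E0])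
      have "2 / norm z \<le> 4 / (1 + norm z)" using False by (simp add: divide_simps)
      also have "\<dots> \<le> (2 * (b - a) + 4) / (1 + norm z)" using ab by (intro divide_right_mono) auto
      finally show "2 / norm z \<le> (2 * (b - a) + 4) / (1 + norm z)" .
    qed
    finally show ?thesis by simp
  qed
qed

text \<open>In the expanded square the pair \<sigma>, \<sigma>' has exponent
  \<open>\<sigma> + cnj \<sigma>'\<close>, whose norm is at least
  \<open>\<bar>norm \<sigma> - norm \<sigma>'\<bar>\<close> by the reverse triangle inequality. A
  bound in terms of norms alone fits the counting hypotheses.\<close>

lemma exp_sum_mean_square:
  fixes x :: "complex \<Rightarrow> complex"
  assumes ab: "0 \<le> a" "a \<le> b" and \<rho>: "\<And>\<sigma>. \<sigma> \<in> S \<Longrightarrow> Re \<sigma> \<le> \<rho>"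
    and E: "\<And>u. u \<in> {a..b} \<Longrightarrow> exp (2 * \<rho> * u) \<le> E"
  shows "integral {a..b} (\<lambda>u. (norm (\<Sum>\<sigma>\<in>S. x \<sigma> * exp (\<sigma> * of_real u)))\<^sup>2) \<le>
    E * (2 * (b - a) + 4) * (\<Sum>\<sigma>\<in>S. \<Sum>\<sigma>'\<in>S. norm (x \<sigma>) * norm (x \<sigma>') / (1 + \<bar>norm \<sigma> - norm \<sigma>'\<bar>))"
proof -
  define W where "W u = (\<Sum>\<sigma>\<in>S. x \<sigma> * exp (\<sigma> * of_real u))" for u :: real
  define J where "J z = integral {a..b} (\<lambda>u. exp (z * complex_of_real u))" for z
  have hJ: "((\<lambda>u. exp (z * complex_of_real u)) has_integral J z) {a..b}" for z
    unfolding J_def by (intro integrable_integral integrable_continuous_real continuous_intros)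
  have W2: "complex_of_real ((norm (W u))\<^sup>2) = (\<Sum>\<sigma>\<in>S. \<Sum>\<sigma>'\<in>S. x \<sigma> * cnj (x \<sigma>') * exp ((\<sigma> + cnj \<sigma>') * of_real u))" for u
  proof -
    have "complex_of_real ((norm (W u))\<^sup>2) = W u * cnj (W u)" by (rule complex_norm_square)
    also have "\<dots> = (\<Sum>\<sigma>\<in>S. \<Sum>\<sigma>'\<in>S. (x \<sigma> * exp (\<sigma> * of_real u)) * cnj (x \<sigma>' * exp (\<sigma>' * of_real u)))"
      unfolding W_def cnj_sum sum_product ..
    also have "\<dots> = (\<Sum>\<sigma>\<in>S. \<Sum>\<sigma>'\<in>S. x \<sigma> * cnj (x \<sigma>') * exp ((\<sigma> + cnj \<sigma>') * of_real u))"
      by (intro sum.cong refl) (simp add: exp_cnj distrib_right exp_add)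
    finally show ?thesis .
  qed
  have "((\<lambda>u. complex_of_real ((norm (W u))\<^sup>2)) has_integral (\<Sum>\<sigma>\<in>S. \<Sum>\<sigma>'\<in>S. x \<sigma> * cnj (x \<sigma>') * J (\<sigma> + cnj \<sigma>'))) {a..b}"
    unfolding W2 by (cases "finite S") (auto intro!: has_integral_sum has_integral_mult_right hJ)
  moreover have "((\<lambda>u. complex_of_real ((norm (W u))\<^sup>2)) has_integral of_real (integral {a..b} (\<lambda>u. (norm (W u))\<^sup>2))) {a..b}"
  proof -
    have "(\<lambda>u. (norm (W u))\<^sup>2) integrable_on {a..b}"
      by (rule integrable_continuous_real) (auto simp: W_def intro!: continuous_intros)
    from has_integral_linear[OF integrable_integral[OF this] bounded_linear_of_real]
    show ?thesis by (simp add: o_def)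
  qed
  ultimately have eq: "complex_of_real (integral {a..b} (\<lambda>u. (norm (W u))\<^sup>2)) = (\<Sum>\<sigma>\<in>S. \<Sum>\<sigma>'\<in>S. x \<sigma> * cnj (x \<sigma>') * J (\<sigma> + cnj \<sigma>'))"
    by (rule has_integral_unique[rotated])
  have "integral {a..b} (\<lambda>u. (norm (W u))\<^sup>2) \<le> norm (complex_of_real (integral {a..b} (\<lambda>u. (norm (W u))\<^sup>2)))" by simp
  also have "\<dots> \<le> (\<Sum>\<sigma>\<in>S. \<Sum>\<sigma>'\<in>S. E * (2 * (b - a) + 4) * (norm (x \<sigma>) * norm (x \<sigma>') / (1 + \<bar>norm \<sigma> - norm \<sigma>'\<bar>)))"
    unfolding eq
  proof (intro sum_norm_le)
    fix \<sigma> \<sigma>' assume s: "\<sigma> \<in> S" "\<sigma>' \<in> S"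
    have "exp (Re (\<sigma> + cnj \<sigma>') * u) \<le> E" if "u \<in> {a..b}" for u
    proof -
      have "Re (\<sigma> + cnj \<sigma>') * u \<le> 2 * \<rho> * u"
        using \<rho>[OF s(1)] \<rho>[OF s(2)] that ab by (intro mult_right_mono) auto
      then show ?thesis using E[OF that] by (meson exp_le_cancel_iff order_trans)
    qed
    from integral_cexp_bound[OF ab this]
    have "norm (J (\<sigma> + cnj \<sigma>')) \<le> E * (2 * (b - a) + 4) / (1 + norm (\<sigma> + cnj \<sigma>'))" by (simp add: J_def)
    also have "\<dots> \<le> E * (2 * (b - a) + 4) / (1 + \<bar>norm \<sigma> - norm \<sigma>'\<bar>)"
    proof (rule divide_left_mono)
      show "1 + \<bar>norm \<sigma> - norm \<sigma>'\<bar> \<le> 1 + norm (\<sigma> + cnj \<sigma>')"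
        using norm_triangle_ineq3[of \<sigma> "- cnj \<sigma>'"] by simp
      have "E \<ge> 0" using E[of a] ab by (meson atLeastAtMost_iff exp_ge_zero order_refl order_trans)
      then show "0 \<le> E * (2 * (b - a) + 4)" using ab by simp
      show "0 < (1 + norm (\<sigma> + cnj \<sigma>')) * (1 + \<bar>norm \<sigma> - norm \<sigma>'\<bar>)"
        by (intro mult_pos_pos add_pos_nonneg) auto
    qed
    finally have "norm (x \<sigma>) * norm (x \<sigma>') * norm (J (\<sigma> + cnj \<sigma>')) \<le>
      norm (x \<sigma>) * norm (x \<sigma>') * (E * (2 * (b - a) + 4) / (1 + \<bar>norm \<sigma> - norm \<sigma>'\<bar>))"
      by (intro mult_left_mono) auto
    then show "norm (x \<sigma> * cnj (x \<sigma>') * J (\<sigma> + cnj \<sigma>')) \<le> E * (2 * (b - a) + 4) * (norm (x \<sigma>) * norm (x \<sigma>') / (1 + \<bar>norm \<sigma> - norm \<sigma>'\<bar>))"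
      by (simp add: norm_mult mult_ac)
  qed
  also have "\<dots> = E * (2 * (b - a) + 4) * (\<Sum>\<sigma>\<in>S. \<Sum>\<sigma>'\<in>S. norm (x \<sigma>) * norm (x \<sigma>') / (1 + \<bar>norm \<sigma> - norm \<sigma>'\<bar>))"
    by (simp only: sum_distrib_left)
  finally show ?thesis by (simp add: W_def)
qed

section \<open>Weighted sums of counts in annuli\<close>

lemma summable_powr_neg:
  assumes "e > 0"
  shows "summable (\<lambda>r::nat. (1 + real r) powr (- 1 - e))"
proof -
  have "summable (\<lambda>r. real r powr (- 1 - e))" using assms by (simp add: summable_real_powr_iff)
  then have "summable (\<lambda>r. real (Suc r) powr (- 1 - e))" by (subst summable_Suc_iff)
  then show ?thesis by simp
qed

text \<open>Summation by parts: the partial sums \<open>S\<close> grow at most like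
  \<open>r powr D\<close>, the differences of the weight decay like
  \<open>r powr (- (D + e) - 1)\<close>, and the surplus \<open>e\<close> makes the product
  summable.\<close>

lemma sum_by_parts_bound:
  fixes c :: "nat \<Rightarrow> real"
  assumes c: "\<And>r. c r \<ge> 0" and C: "\<And>R. (\<Sum>r<R. c r) \<le> C * (1 + real R) powr D" and D: "D \<ge> 0" and e: "e > 0"
  obtains K where "\<And>R. (\<Sum>r<R. c r * (1 + real r) powr (- (D + e))) \<le> K"
proof -
  define f where "f r = (1 + real r) powr (- (D + e))" for r
  define S where "S R = (\<Sum>r<R. c r)" for R
  have S0: "S R \<ge> 0" for R unfolding S_def by (intro sum_nonneg c)
  have C0: "C \<ge> 0" using C[of 0] by simp
  have parts: "(\<Sum>r<R. c r * f r) = S R * f R + (\<Sum>r<R. S (Suc r) * (f r - f (Suc r)))" for R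
    by (induction R) (simp_all add: S_def algebra_simps)
  have fdec: "f r - f (Suc r) \<le> (D + e) * (1 + real r) powr (- (D + e) - 1)" for r
  proof -
    have "\<exists>z. 1 + real r < z \<and> z < 2 + real r \<and>
      (2 + real r) powr (- (D + e)) - (1 + real r) powr (- (D + e)) =
      (2 + real r - (1 + real r)) * (- (D + e) * z powr (- (D + e) - 1))"
      by (rule MVT2) (auto intro!: DERIV_powr derivative_eq_intros)
    then obtain z where z: "1 + real r < z"
      "(2 + real r) powr (- (D + e)) - (1 + real r) powr (- (D + e)) = - (D + e) * z powr (- (D + e) - 1)"
      by auto
    have "z powr (- (D + e) - 1) \<le> (1 + real r) powr (- (D + e) - 1)"
      using z(1) D e by (intro powr_mono2') auto
    then have "(D + e) * z powr (- (D + e) - 1) \<le> (D + e) * (1 + real r) powr (- (D + e) - 1)"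
      using D e by (intro mult_left_mono) auto
    then show ?thesis using z(2) by (simp add: f_def algebra_simps)
  qed
  have tm: "S (Suc r) * (f r - f (Suc r)) \<le> C * 2 powr D * (D + e) * (1 + real r) powr (- 1 - e)" for r
  proof -
    have "S (Suc r) * (f r - f (Suc r)) \<le> S (Suc r) * ((D + e) * (1 + real r) powr (- (D + e) - 1))"
      by (rule mult_left_mono[OF fdec S0])
    also have "\<dots> \<le> (C * (2 powr D * (1 + real r) powr D)) * ((D + e) * (1 + real r) powr (- (D + e) - 1))"
    proof (rule mult_right_mono)
      have "S (Suc r) \<le> C * (1 + real (Suc r)) powr D" unfolding S_def by (rule C)
      also have "\<dots> \<le> C * (2 * (1 + real r)) powr D"
        using C0 D by (intro mult_left_mono powr_mono2) auto
      also have "(2 * (1 + real r)) powr D = 2 powr D * (1 + real r) powr D" by (rule powr_mult)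
      finally show "S (Suc r) \<le> C * (2 powr D * (1 + real r) powr D)" .
    qed (use D e in auto)
    also have "\<dots> = C * 2 powr D * (D + e) * ((1 + real r) powr D * (1 + real r) powr (- (D + e) - 1))" by simp
    also have "(1 + real r) powr D * (1 + real r) powr (- (D + e) - 1) = (1 + real r) powr (- 1 - e)"
    proof -
      have "D + (- (D + e) - 1) = - 1 - e" by simp
      then show ?thesis by (simp only: powr_add[symmetric])
    qed
    finally show ?thesis .
  qed
  have "(\<Sum>r<R. c r * (1 + real r) powr (- (D + e))) \<le> C + C * 2 powr D * (D + e) * (\<Sum>r. (1 + real r) powr (- 1 - e))" for R
  proof -
    have "S R * f R \<le> C * (1 + real R) powr D * (1 + real R) powr (- (D + e))"
      unfolding f_def S_def by (intro mult_right_mono C) auto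
    also have "\<dots> = C * (1 + real R) powr (- e)" by (simp add: mult.assoc powr_add[symmetric])
    also have "\<dots> \<le> C * 1"
      using powr_mono[of "- e" 0 "1 + real R"] e by (intro mult_left_mono C0) simp
    finally have 1: "S R * f R \<le> C" by simp
    have "(\<Sum>r<R. S (Suc r) * (f r - f (Suc r))) \<le> (\<Sum>r<R. C * 2 powr D * (D + e) * (1 + real r) powr (- 1 - e))"
      by (intro sum_mono tm)
    also have "\<dots> = C * 2 powr D * (D + e) * (\<Sum>r<R. (1 + real r) powr (- 1 - e))" by (simp only: sum_distrib_left)
    also have "\<dots> \<le> C * 2 powr D * (D + e) * (\<Sum>r. (1 + real r) powr (- 1 - e))"
      using C0 D e by (intro mult_left_mono sum_le_suminf summable_powr_neg) auto
    finally show ?thesis using 1 parts[of R] by (simp add: f_def)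
  qed
  then show ?thesis by (rule that)
qed

lemma sum_abs_diff_powr_bound:
  assumes e: "e > 0"
  shows "(\<Sum>r'<R. (1 + \<bar>real r - real r'\<bar>) powr (- 1 - e)) \<le> 2 * (\<Sum>j. (1 + real j) powr (- 1 - e))"
proof -
  let ?g = "\<lambda>j::nat. (1 + real j) powr (- 1 - e)"
  note sm = summable_powr_neg[OF e]
  have "(\<Sum>r'<R. (1 + \<bar>real r - real r'\<bar>) powr (- 1 - e)) =
    (\<Sum>r' \<in> {..<R} \<inter> {..r}. ?g (r - r')) + (\<Sum>r' \<in> {..<R} - {..r}. ?g (r' - r))"
    (is "_ = ?A + ?B")
    by (subst sum.Int_Diff[of "{..<R}" _ "{..r}"]) (auto intro!: arg_cong2[where f = "(+)"] sum.cong)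
  also have "?A = sum ?g ((\<lambda>r'. r - r') ` ({..<R} \<inter> {..r}))"
    by (subst sum.reindex) (auto simp: inj_on_def)
  also have "\<dots> \<le> (\<Sum>j. ?g j)" by (intro sum_le_suminf sm) auto
  also have "?B = sum ?g ((\<lambda>r'. r' - r) ` ({..<R} - {..r}))"
    by (subst sum.reindex) (auto simp: inj_on_def)
  also have "\<dots> \<le> (\<Sum>j. ?g j)" by (intro sum_le_suminf sm) auto
  finally show ?thesis by simp
qed

text \<open>
  The sum over \<open>r'\<close> is bounded by \<open>x powr (- e) / y \<le> x powr (- 1 - e) + y powr (- 1 - e)\<close>.
\<close>

lemma double_sum_bound:
  fixes c :: "nat \<Rightarrow> real"
  assumes c: "\<And>r. c r \<ge> 0" and C: "\<And>R. (\<Sum>r<R. c r) \<le> C * (1 + real R) powr D" and D: "D \<ge> 0"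
    and C1: "\<And>r. c r \<le> C1 * (1 + real r) powr D1" and e: "e > 0"
  obtains K where "K \<ge> 0" "\<And>R. (\<Sum>r<R. \<Sum>r'<R. c r * (1 + real r) powr (- (D + e)) * (c r' * (1 + real r') powr (- (D1 + e)))
    / (1 + \<bar>real r - real r'\<bar>)) \<le> K"
proof -
  define z where "z = (\<Sum>j. (1 + real j) powr (- 1 - e))"
  obtain K where K: "\<And>R. (\<Sum>r<R. c r * (1 + real r) powr (- (D + e))) \<le> K"
    using sum_by_parts_bound[OF c C D e] by blast
  have C10: "C1 \<ge> 0"
  proof -
    have "0 \<le> C1 * (1 + real 0) powr D1" using c[of 0] C1[of 0] by (rule order_trans)
    then show ?thesis by simp
  qed
  have z0: "z \<ge> 0" unfolding z_def by (intro suminf_nonneg summable_powr_neg e) auto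
  have ee: "- 1 - e = - e - 1" by simp
  have young: "x powr (- e) / y \<le> x powr (- 1 - e) + y powr (- 1 - e)" if "x \<ge> 1" "y \<ge> 1" for x y :: real
  proof (cases "x \<le> y")
    case True
    have "x powr (- e) / y \<le> x powr (- e) / x" using True that by (intro divide_left_mono) auto
    also have "\<dots> = x powr (- 1 - e)" using that powr_diff[of x "- e" 1] by (simp add: ee)
    finally show ?thesis using powr_ge_zero[of y "- 1 - e"] by linarith
  next
    case False
    have "x powr (- e) / y \<le> y powr (- e) / y" using False that e by (intro divide_right_mono powr_mono2') auto
    also have "\<dots> = y powr (- 1 - e)" using that powr_diff[of y "- e" 1] by (simp add: ee)
    finally show ?thesis using powr_ge_zero[of x "- 1 - e"] by linarith
  qed
  \<comment> \<open>The pointwise bound \<open>C1\<close> makes the inner sum bounded uniformly in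
    \<open>r\<close>; the outer sum is then controlled by the total count. Hence the two different
    exponents \<open>D\<close> and \<open>D1\<close>.\<close>
  have inner: "(\<Sum>r'<R. c r' * (1 + real r') powr (- (D1 + e)) / (1 + \<bar>real r - real r'\<bar>)) \<le> C1 * (3 * z)" for r R
  proof -
    have "(\<Sum>r'<R. c r' * (1 + real r') powr (- (D1 + e)) / (1 + \<bar>real r - real r'\<bar>)) \<le>
      (\<Sum>r'<R. C1 * ((1 + real r') powr (- 1 - e) + (1 + \<bar>real r - real r'\<bar>) powr (- 1 - e)))"
    proof (rule sum_mono)
      fix r'
      have "c r' * (1 + real r') powr (- (D1 + e)) \<le> C1 * (1 + real r') powr D1 * (1 + real r') powr (- (D1 + e))"
        by (intro mult_right_mono C1) auto
      also have "\<dots> = C1 * (1 + real r') powr (- e)" by (simp add: mult.assoc powr_add[symmetric])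
      finally have "c r' * (1 + real r') powr (- (D1 + e)) / (1 + \<bar>real r - real r'\<bar>) \<le> C1 * (1 + real r') powr (- e) / (1 + \<bar>real r - real r'\<bar>)"
        by (intro divide_right_mono) auto
      also have "\<dots> = C1 * ((1 + real r') powr (- e) / (1 + \<bar>real r - real r'\<bar>))" by simp
      also have "\<dots> \<le> C1 * ((1 + real r') powr (- 1 - e) + (1 + \<bar>real r - real r'\<bar>) powr (- 1 - e))"
        by (intro mult_left_mono C10 young) auto
      finally show "c r' * (1 + real r') powr (- (D1 + e)) / (1 + \<bar>real r - real r'\<bar>) \<le>
        C1 * ((1 + real r') powr (- 1 - e) + (1 + \<bar>real r - real r'\<bar>) powr (- 1 - e))" .
    qed
    also have "\<dots> = C1 * ((\<Sum>r'<R. (1 + real r') powr (- 1 - e)) + (\<Sum>r'<R. (1 + \<bar>real r - real r'\<bar>) powr (- 1 - e)))"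
      by (simp add: sum_distrib_left sum.distrib distrib_left)
    also have "\<dots> \<le> C1 * (z + 2 * z)"
      unfolding z_def
      by (intro mult_left_mono C10 add_mono sum_abs_diff_powr_bound e sum_le_suminf summable_powr_neg) auto
    finally show ?thesis by simp
  qed
  have "(\<Sum>r<R. \<Sum>r'<R. c r * (1 + real r) powr (- (D + e)) * (c r' * (1 + real r') powr (- (D1 + e))) / (1 + \<bar>real r - real r'\<bar>))
    \<le> \<bar>K\<bar> * (C1 * (3 * z))" for R
  proof -
    have "(\<Sum>r<R. \<Sum>r'<R. c r * (1 + real r) powr (- (D + e)) * (c r' * (1 + real r') powr (- (D1 + e))) / (1 + \<bar>real r - real r'\<bar>)) =
      (\<Sum>r<R. c r * (1 + real r) powr (- (D + e)) * (\<Sum>r'<R. c r' * (1 + real r') powr (- (D1 + e)) / (1 + \<bar>real r - real r'\<bar>)))"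
      by (simp add: sum_distrib_left)
    also have "\<dots> \<le> (\<Sum>r<R. c r * (1 + real r) powr (- (D + e)) * (C1 * (3 * z)))"
      by (intro sum_mono mult_left_mono inner mult_nonneg_nonneg c) auto
    also have "\<dots> = (\<Sum>r<R. c r * (1 + real r) powr (- (D + e))) * (C1 * (3 * z))" by (simp only: sum_distrib_right)
    also have "\<dots> \<le> \<bar>K\<bar> * (C1 * (3 * z))"
      using K[of R] C10 z0 by (intro mult_right_mono) auto
    finally show ?thesis .
  qed
  then show ?thesis using C10 z0 by (intro that[of "\<bar>K\<bar> * (C1 * (3 * z))"]) auto
qed

text \<open>The \<open>k\<close>-fold difference kills the polynomial with the coefficients
  \<open>q i\<close>, replaces the truncated powers by the spline \<phi>, and multiplies each
  exponential by \<open>(exp (\<tau> \<sigma> * h) - 1) ^ k\<close>. As \<open>h \<ge> 0\<close>, it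
  stays within \<open>u > 0\<close>, where the identity is known.\<close>

lemma fdiffs_laplace_explicit:
  fixes t w :: "nat \<Rightarrow> real" and A :: "nat \<Rightarrow> complex set" and b \<tau> :: "complex \<Rightarrow> complex"
    and q :: "nat \<Rightarrow> complex"
  assumes t: "\<And>n. t n \<ge> 0" and w: "\<And>n. w n \<ge> 0" and sw: "summable w"
    and \<tau>: "\<And>r \<sigma>. \<sigma> \<in> A r \<Longrightarrow> Re (\<tau> \<sigma>) \<le> 0"
    and M: "summable (\<lambda>r. \<Sum>\<sigma>\<in>A r. norm (b \<sigma>))" and h: "h \<ge> 0" and k: "k \<ge> 1"
    and ident: "\<And>u. u > 0 \<Longrightarrow> of_real (\<Sum>j. w j * (max 0 (u - t j) ^ (k - 1) / fact (k - 1))) +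
    (\<Sum>i<k. q i * of_real (u ^ (k - 1 - i) / fact (k - 1 - i))) +
    (\<Sum>r. \<Sum>\<sigma>\<in>A r. b \<sigma> * exp (\<tau> \<sigma> * of_real u)) = 0"
    and u: "u > 0"
  defines "\<phi> \<equiv> fdiffs h k (\<lambda>v. max 0 v ^ (k - 1) / fact (k - 1))"
  shows "summable (\<lambda>j. w j * \<phi> (u - t j))"
    "summable (\<lambda>r. \<Sum>\<sigma>\<in>A r. b \<sigma> * ((exp (\<tau> \<sigma> * of_real h) - 1) ^ k * exp (\<tau> \<sigma> * of_real u)))"
    "complex_of_real (\<Sum>j. w j * \<phi> (u - t j)) =
      - (\<Sum>r. \<Sum>\<sigma>\<in>A r. b \<sigma> * ((exp (\<tau> \<sigma> * of_real h) - 1) ^ k * exp (\<tau> \<sigma> * of_real u)))"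
proof -
  define f where "f j u = w j * (max 0 (u - t j) ^ (k - 1) / fact (k - 1))" for j u
  define P where "P u = (\<Sum>i<k. q i * of_real (u ^ (k - 1 - i) / fact (k - 1 - i)))" for u :: real
  define g where "g r u = (\<Sum>\<sigma>\<in>A r. b \<sigma> * exp (\<tau> \<sigma> * of_real u))" for r and u :: real
  have fsm: "summable (\<lambda>j. f j u)" if "u > 0" for u
  proof (rule summable_comparison_test'[OF summable_mult2[OF sw, of "u ^ (k - 1) / fact (k - 1)"]])
    fix j
    have "f j u \<le> w j * (u ^ (k - 1) / fact (k - 1))"
      unfolding f_def using that t[of j] w by (intro mult_left_mono divide_right_mono power_mono) auto
    then show "norm (f j u) \<le> w j * (u ^ (k - 1) / fact (k - 1))" using w[of j] by (simp add: f_def)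
  qed
  have gsm: "summable (\<lambda>r. g r u)" if "u > 0" for u
  proof (rule summable_comparison_test'[OF M])
    fix r
    show "norm (g r u) \<le> (\<Sum>\<sigma>\<in>A r. norm (b \<sigma>))" unfolding g_def
    proof (rule sum_norm_le)
      fix \<sigma> assume "\<sigma> \<in> A r"
      then have "exp (Re (\<tau> \<sigma>) * u) \<le> 1" using \<tau> that by (simp add: mult_nonpos_nonneg)
      then have "norm (b \<sigma>) * exp (Re (\<tau> \<sigma>) * u) \<le> norm (b \<sigma>) * 1" by (rule mult_left_mono) simp
      then show "norm (b \<sigma> * exp (\<tau> \<sigma> * complex_of_real u)) \<le> norm (b \<sigma>)" by (simp add: norm_mult)
    qed
  qed
  have Df: "fdiffs h k (f j) u = w j * \<phi> (u - t j)" for j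
    unfolding f_def fdiffs_cmult \<phi>_def by (simp only: fdiffs_shift[where f = "\<lambda>v. max 0 v ^ (k - 1) / fact (k - 1)"])
  have Dg: "fdiffs h k (g r) u = (\<Sum>\<sigma>\<in>A r. b \<sigma> * ((exp (\<tau> \<sigma> * of_real h) - 1) ^ k * exp (\<tau> \<sigma> * of_real u)))" for r
    unfolding g_def fdiffs_sum fdiffs_cmult fdiffs_cexp ..
  have DP: "fdiffs h k P u = 0"
  proof -
    have "fdiffs h k (\<lambda>u. q i * complex_of_real (u ^ (k - 1 - i) / fact (k - 1 - i))) u = 0" if "i < k" for i
    proof -
      have "fdiffs h k (\<lambda>u. q i * complex_of_real ((1 / fact (k - 1 - i)) * u ^ (k - 1 - i))) u = 0"
        unfolding fdiffs_cmult fdiffs_bounded_linear[OF bounded_linear_of_real] using that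
        by (subst fdiffs_power_eq_0) auto
      then show ?thesis by simp
    qed
    then show ?thesis unfolding P_def fdiffs_sum by simp
  qed
  show s1: "summable (\<lambda>j. w j * \<phi> (u - t j))"
    using fdiffs_suminf(1)[where f = f and k = k, OF fsm h u] unfolding Df .
  show s2: "summable (\<lambda>r. \<Sum>\<sigma>\<in>A r. b \<sigma> * ((exp (\<tau> \<sigma> * of_real h) - 1) ^ k * exp (\<tau> \<sigma> * of_real u)))"
    using fdiffs_suminf(1)[where f = g and k = k, OF gsm h u] unfolding Dg .
  have "fdiffs h k (\<lambda>u. of_real (\<Sum>j. f j u) + P u + (\<Sum>r. g r u)) u = fdiffs h k (\<lambda>u. 0) u"
    by (rule fdiffs_cong[OF _ h u]) (use ident in \<open>simp add: f_def P_def g_def\<close>)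
  also have "fdiffs h k (\<lambda>u. 0 :: complex) u = 0"
    using fdiffs_sum[where I = "{}" and k = k and h = h and u = u] by simp
  finally have "complex_of_real (fdiffs h k (\<lambda>u. \<Sum>j. f j u) u) + fdiffs h k P u + fdiffs h k (\<lambda>u. \<Sum>r. g r u) u = 0"
    unfolding fdiffs_add fdiffs_bounded_linear[OF bounded_linear_of_real] .
  moreover have "fdiffs h k (\<lambda>u. \<Sum>j. f j u) u = (\<Sum>j. fdiffs h k (f j) u)"
    by (rule fdiffs_suminf(2)[where f = f, OF fsm h u])
  moreover have "fdiffs h k (\<lambda>u. \<Sum>r. g r u) u = (\<Sum>r. fdiffs h k (g r) u)"
    by (rule fdiffs_suminf(2)[where f = g, OF gsm h u])
  ultimately have "complex_of_real (\<Sum>j. w j * \<phi> (u - t j)) +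
      (\<Sum>r. \<Sum>\<sigma>\<in>A r. b \<sigma> * ((exp (\<tau> \<sigma> * of_real h) - 1) ^ k * exp (\<tau> \<sigma> * of_real u))) = 0"
    by (simp only: DP Df Dg add_0_right)
  then show "complex_of_real (\<Sum>j. w j * \<phi> (u - t j)) =
      - (\<Sum>r. \<Sum>\<sigma>\<in>A r. b \<sigma> * ((exp (\<tau> \<sigma> * of_real h) - 1) ^ k * exp (\<tau> \<sigma> * of_real u)))"
    by (simp add: eq_neg_iff_add_eq_0)
qed

lemma norm_cexp_minus_one_le:
  assumes "Re z \<le> 0"
  shows "norm (exp z - 1) \<le> norm z" "norm (exp z - 1) \<le> 2"
proof -
  have "norm (exp z - exp 0) \<le> 1 * norm (z - 0)"
  proof (rule field_differentiable_bound[where S = "{z. Re z \<le> 0}" and f' = exp])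
    show "convex {z. Re z \<le> 0}" by (rule convex_halfspace_Re_le)
    show "(exp has_field_derivative exp w) (at w within {z. Re z \<le> 0})" for w :: complex
      by (intro DERIV_exp has_field_derivative_at_within)
  qed (use assms in auto)
  then show "norm (exp z - 1) \<le> norm z" by simp
  have "norm (exp z - 1) \<le> norm (exp z) + norm (1 :: complex)" by (rule norm_triangle_ineq4)
  also have "\<dots> \<le> 2" using assms by simp
  finally show "norm (exp z - 1) \<le> 2" .
qed

text \<open>The quotient divided by \<open>h\<close> is at most 1, by the mean value inequality, and
  at most \<open>2 / (norm z * h) \<le> v\<close>. So its \<open>k\<close>-th power is at most
  \<open>v powr x\<close> for every \<open>x\<close> from 0 to \<open>k\<close>. The free
  \<open>x\<close> allows different decay rates for the two factors of a product.\<close>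

lemma cexp_quotient_power_bound:
  fixes z :: complex
  assumes z: "Re z \<le> 0" "z \<noteq> 0" and h: "h > 0" and r: "0 < 1 + r" "1 + r \<le> B * norm z"
    and x: "0 \<le> x" "x \<le> real k"
  shows "norm (((exp (z * of_real h) - 1) / z) ^ k) \<le> h ^ k * (2 * B / h) powr x * (1 + r) powr (- x)"
proof -
  have B: "B > 0" using r z by (metis less_le_trans norm_ge_zero not_less zero_less_mult_iff zero_less_norm_iff)
  define s where "s = norm ((exp (z * of_real h) - 1) / z) / h"
  define v where "v = 2 * B / h / (1 + r)"
  have zh: "Re (z * of_real h) \<le> 0" using z h by (simp add: mult_nonpos_nonneg)
  have nz: "norm z > 0" using z by simp
  have v0: "v > 0" using B h r by (simp add: v_def)
  have s0: "s \<ge> 0" using h by (simp add: s_def)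
  have s1: "s \<le> 1"
  proof -
    have "norm (exp (z * of_real h) - 1) \<le> norm z * h"
      using norm_cexp_minus_one_le(1)[OF zh] h by (simp add: norm_mult)
    then show ?thesis using nz h by (simp add: s_def norm_divide divide_simps mult.commute)
  qed
  have sv: "s \<le> v"
  proof -
    have "s \<le> 2 / norm z / h"
      unfolding s_def norm_divide using norm_cexp_minus_one_le(2)[OF zh] h by (intro divide_right_mono) auto
    also have "2 / norm z \<le> 2 * B / (1 + r)"
    proof -
      have "2 * (1 + r) \<le> 2 * (B * norm z)" using r by simp
      then show ?thesis using r(1) nz by (simp add: divide_simps algebra_simps)
    qed
    then have "2 / norm z / h \<le> 2 * B / (1 + r) / h" using h by (intro divide_right_mono) auto
    finally show ?thesis by (simp add: v_def mult.commute)
  qed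
  have "s ^ k \<le> v powr x"
  proof (cases "v \<ge> 1")
    case True
    have "s ^ k \<le> 1" using s0 s1 by (rule power_le_one)
    also have "\<dots> \<le> v powr x" using True x(1) by (rule ge_one_powr_ge_zero)
    finally show ?thesis .
  next
    case False
    have "s ^ k \<le> v ^ k" by (intro power_mono sv s0)
    also have "\<dots> = v powr real k" using v0 by (simp add: powr_realpow)
    also have "\<dots> \<le> v powr x" using False v0 x by (intro powr_mono') auto
    finally show ?thesis .
  qed
  also have "v powr x = (2 * B / h) powr x * (1 + r) powr (- x)"
    using B h r by (simp add: v_def powr_divide powr_minus_divide powr_mult)
  finally have "h ^ k * s ^ k \<le> h ^ k * ((2 * B / h) powr x * (1 + r) powr (- x))"
    using h by (intro mult_left_mono) auto
  moreover have "h ^ k * s ^ k = norm (((exp (z * of_real h) - 1) / z) ^ k)"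
    using h by (simp add: s_def norm_power power_mult_distrib[symmetric])
  ultimately show ?thesis by (simp add: mult.assoc)
qed

text \<open>The partial sums are exponential sums over finite sets, and dominated convergence with
  the constant \<open>Q\<close> passes to the limit. The two bounds for \<open>y\<close> serve the
  two factors of each pair, so that the double sum takes the asymmetric form bounded by
  \<open>K\<close>.\<close>

lemma series_mean_square:
  fixes B :: "nat \<Rightarrow> complex set" and y :: "complex \<Rightarrow> complex" and m :: "complex \<Rightarrow> real"
  assumes fin: "\<And>r. finite (B r)" and nB: "\<And>r \<sigma>. \<sigma> \<in> B r \<Longrightarrow> real r \<le> norm \<sigma> \<and> norm \<sigma> < real r + 1"
    and \<rho>: "\<And>r \<sigma>. \<sigma> \<in> B r \<Longrightarrow> Re \<sigma> \<le> \<rho>"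
    and y1: "\<And>r \<sigma>. \<sigma> \<in> B r \<Longrightarrow> norm (y \<sigma>) \<le> G1 * (m \<sigma> * p r)"
    and y2: "\<And>r \<sigma>. \<sigma> \<in> B r \<Longrightarrow> norm (y \<sigma>) \<le> G2 * (m \<sigma> * p' r)"
    and K: "\<And>R. (\<Sum>r<R. \<Sum>r'<R. (\<Sum>\<sigma>\<in>B r. m \<sigma>) * p r * ((\<Sum>\<sigma>\<in>B r'. m \<sigma>) * p' r') / (1 + \<bar>real r - real r'\<bar>)) \<le> K"
    and G: "G1 \<ge> 0" "G2 \<ge> 0"
    and ab: "0 \<le> a" "a \<le> b" and E: "\<And>u. u \<in> {a..b} \<Longrightarrow> exp (2 * \<rho> * u) \<le> E"
    and L: "\<And>u. u \<in> {a..b} \<Longrightarrow> (\<lambda>R. \<Sum>r<R. \<Sum>\<sigma>\<in>B r. y \<sigma> * exp (\<sigma> * of_real u)) \<longlonglongrightarrow> L u"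
    and Q: "\<And>u R. u \<in> {a..b} \<Longrightarrow> norm (\<Sum>r<R. \<Sum>\<sigma>\<in>B r. y \<sigma> * exp (\<sigma> * of_real u)) \<le> Q"
  shows "(\<lambda>u. (norm (L u))\<^sup>2) integrable_on {a..b}"
    "integral {a..b} (\<lambda>u. (norm (L u))\<^sup>2) \<le> E * (2 * (b - a) + 4) * (2 * G1 * G2 * K)"
proof -
  define W where "W R u = (\<Sum>r<R. \<Sum>\<sigma>\<in>B r. y \<sigma> * exp (\<sigma> * of_real u))" for R and u :: real
  define S where "S R = (\<Union>r<R. B r)" for R
  have disj: "\<forall>i\<in>{..<R}. \<forall>j\<in>{..<R}. i \<noteq> j \<longrightarrow> B i \<inter> B j = {}" for R :: nat
  proof (intro ballI impI)
    fix i j :: nat assume "i \<noteq> j"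
    show "B i \<inter> B j = {}"
    proof (rule equals0I)
      fix \<sigma> assume "\<sigma> \<in> B i \<inter> B j"
      then show False using nB[of \<sigma> i] nB[of \<sigma> j] \<open>i \<noteq> j\<close> by auto
    qed
  qed
  have SU: "(\<Sum>\<sigma>\<in>S R. f \<sigma>) = (\<Sum>r<R. \<Sum>\<sigma>\<in>B r. f \<sigma>)" for R and f :: "complex \<Rightarrow> 'c :: comm_monoid_add"
    unfolding S_def by (rule sum.UNION_disjoint) (use fin disj[of R] in auto)
  have WS: "W R u = (\<Sum>\<sigma>\<in>S R. y \<sigma> * exp (\<sigma> * of_real u))" for R u by (simp add: W_def SU)
  have E0: "E \<ge> 0" using E[of a] ab by (meson atLeastAtMost_iff exp_ge_zero order_refl order_trans)
  have bound: "integral {a..b} (\<lambda>u. (norm (W R u))\<^sup>2) \<le> E * (2 * (b - a) + 4) * (2 * G1 * G2 * K)" for R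
  proof -
    have "integral {a..b} (\<lambda>u. (norm (W R u))\<^sup>2) \<le>
      E * (2 * (b - a) + 4) * (\<Sum>\<sigma>\<in>S R. \<Sum>\<sigma>'\<in>S R. norm (y \<sigma>) * norm (y \<sigma>') / (1 + \<bar>norm \<sigma> - norm \<sigma>'\<bar>))"
      unfolding WS by (rule exp_sum_mean_square[OF ab _ E]) (auto simp: S_def intro: \<rho>)
    also have "\<dots> \<le> E * (2 * (b - a) + 4) * (2 * G1 * G2 * K)"
    proof (rule mult_left_mono)
      have "(\<Sum>\<sigma>\<in>S R. \<Sum>\<sigma>'\<in>S R. norm (y \<sigma>) * norm (y \<sigma>') / (1 + \<bar>norm \<sigma> - norm \<sigma>'\<bar>)) =
        (\<Sum>r<R. \<Sum>\<sigma>\<in>B r. \<Sum>r'<R. \<Sum>\<sigma>'\<in>B r'. norm (y \<sigma>) * norm (y \<sigma>') / (1 + \<bar>norm \<sigma> - norm \<sigma>'\<bar>))"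
        by (simp only: SU)
      also have "\<dots> = (\<Sum>r<R. \<Sum>r'<R. \<Sum>\<sigma>\<in>B r. \<Sum>\<sigma>'\<in>B r'. norm (y \<sigma>) * norm (y \<sigma>') / (1 + \<bar>norm \<sigma> - norm \<sigma>'\<bar>))"
        by (intro sum.cong refl sum.swap)
      also have "\<dots> \<le> (\<Sum>r<R. \<Sum>r'<R. \<Sum>\<sigma>\<in>B r. \<Sum>\<sigma>'\<in>B r'. (m \<sigma> * m \<sigma>') * (2 * G1 * G2 * p r * p' r' / (1 + \<bar>real r - real r'\<bar>)))"
      proof (intro sum_mono)
        fix r r' \<sigma> \<sigma>' assume s: "\<sigma> \<in> B r" "\<sigma>' \<in> B r'"
        have d: "1 / (1 + \<bar>norm \<sigma> - norm \<sigma>'\<bar>) \<le> 2 / (1 + \<bar>real r - real r'\<bar>)"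
        proof -
          \<comment> \<open>Each norm exceeds its block index by less than 1, so the difference of
            the norms is within 1 of the difference of the indices; this costs the factor 2.\<close>
          have "1 + \<bar>real r - real r'\<bar> \<le> 2 * (1 + \<bar>norm \<sigma> - norm \<sigma>'\<bar>)"
            using nB[OF s(1), THEN conjunct1] nB[OF s(1), THEN conjunct2]
              nB[OF s(2), THEN conjunct1] nB[OF s(2), THEN conjunct2] by (smt (verit))
          then have "2 / (2 * (1 + \<bar>norm \<sigma> - norm \<sigma>'\<bar>)) \<le> 2 / (1 + \<bar>real r - real r'\<bar>)"
            by (rule divide_left_mono) (auto intro!: mult_pos_pos add_pos_nonneg)
          moreover have "2 / (2 * x) = 1 / x" for x :: real by simp
          ultimately show ?thesis by (simp only:)
        qed
        have n1: "G1 * (m \<sigma> * p r) \<ge> 0" using y1[OF s(1)] norm_ge_zero[of "y \<sigma>"] by linarith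
        have yy: "norm (y \<sigma>) * norm (y \<sigma>') \<le> (G1 * (m \<sigma> * p r)) * (G2 * (m \<sigma>' * p' r'))"
          by (intro mult_mono y1 y2 s n1) auto
        have "norm (y \<sigma>) * norm (y \<sigma>') * (1 / (1 + \<bar>norm \<sigma> - norm \<sigma>'\<bar>)) \<le>
          (G1 * (m \<sigma> * p r)) * (G2 * (m \<sigma>' * p' r')) * (2 / (1 + \<bar>real r - real r'\<bar>))"
          by (rule mult_mono[OF yy d order_trans[OF mult_nonneg_nonneg[OF norm_ge_zero norm_ge_zero] yy]]) simp
        then show "norm (y \<sigma>) * norm (y \<sigma>') / (1 + \<bar>norm \<sigma> - norm \<sigma>'\<bar>) \<le>
          (m \<sigma> * m \<sigma>') * (2 * G1 * G2 * p r * p' r' / (1 + \<bar>real r - real r'\<bar>))"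
          by (simp add: mult_ac)
      qed
      also have "\<dots> = (\<Sum>r<R. \<Sum>r'<R. (2 * G1 * G2) * ((\<Sum>\<sigma>\<in>B r. m \<sigma>) * p r * ((\<Sum>\<sigma>\<in>B r'. m \<sigma>) * p' r') / (1 + \<bar>real r - real r'\<bar>)))"
      proof (intro sum.cong refl)
        fix r r'
        have "(\<Sum>\<sigma>\<in>B r. \<Sum>\<sigma>'\<in>B r'. (m \<sigma> * m \<sigma>') * (2 * G1 * G2 * p r * p' r' / (1 + \<bar>real r - real r'\<bar>))) =
          (\<Sum>\<sigma>\<in>B r. m \<sigma>) * (\<Sum>\<sigma>\<in>B r'. m \<sigma>) * (2 * G1 * G2 * p r * p' r' / (1 + \<bar>real r - real r'\<bar>))"
          by (subst sum_product) (simp only: sum_distrib_right)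
        then show "(\<Sum>\<sigma>\<in>B r. \<Sum>\<sigma>'\<in>B r'. (m \<sigma> * m \<sigma>') * (2 * G1 * G2 * p r * p' r' / (1 + \<bar>real r - real r'\<bar>))) =
          (2 * G1 * G2) * ((\<Sum>\<sigma>\<in>B r. m \<sigma>) * p r * ((\<Sum>\<sigma>\<in>B r'. m \<sigma>) * p' r') / (1 + \<bar>real r - real r'\<bar>))"
          by (simp add: mult_ac)
      qed
      also have "\<dots> = (2 * G1 * G2) * (\<Sum>r<R. \<Sum>r'<R. (\<Sum>\<sigma>\<in>B r. m \<sigma>) * p r * ((\<Sum>\<sigma>\<in>B r'. m \<sigma>) * p' r') / (1 + \<bar>real r - real r'\<bar>))"
        by (simp only: sum_distrib_left)
      also have "\<dots> \<le> (2 * G1 * G2) * K" using G by (intro mult_left_mono K) auto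
      finally show "(\<Sum>\<sigma>\<in>S R. \<Sum>\<sigma>'\<in>S R. norm (y \<sigma>) * norm (y \<sigma>') / (1 + \<bar>norm \<sigma> - norm \<sigma>'\<bar>)) \<le> 2 * G1 * G2 * K" .
      show "0 \<le> E * (2 * (b - a) + 4)" using E0 ab by simp
    qed
    finally show ?thesis .
  qed
  have int: "(\<lambda>u. (norm (W R u))\<^sup>2) integrable_on {a..b}" for R
    unfolding W_def by (intro integrable_continuous_real continuous_intros)
  have dom: "norm ((norm (W R u))\<^sup>2) \<le> Q\<^sup>2" if "u \<in> {a..b}" for R u
    using Q[OF that, of R] by (simp add: W_def power_mono)
  have lim: "(\<lambda>R. (norm (W R u))\<^sup>2) \<longlonglongrightarrow> (norm (L u))\<^sup>2" if "u \<in> {a..b}" for u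
    unfolding W_def by (intro tendsto_power tendsto_norm L that)
  note dc = dominated_convergence[OF int integrable_const_ivl dom lim]
  show "(\<lambda>u. (norm (L u))\<^sup>2) integrable_on {a..b}" by (rule dc(1))
  show "integral {a..b} (\<lambda>u. (norm (L u))\<^sup>2) \<le> E * (2 * (b - a) + 4) * (2 * G1 * G2 * K)"
  proof -
    have "\<exists>n0. \<forall>n\<ge>n0. integral {a..b} (\<lambda>u. (norm (W n u))\<^sup>2) \<le> E * (2 * (b - a) + 4) * (2 * G1 * G2 * K)"
      by (intro exI allI impI bound)
    then show ?thesis using LIMSEQ_le_const2[OF dc(2)] by blast
  qed
qed

section \<open>Singular points in unit annuli\<close>

definition sing_block :: "(complex \<Rightarrow> complex) \<Rightarrow> nat \<Rightarrow> complex set" where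
  "sing_block Z r = {\<sigma> \<in> singular_points Z. real r \<le> norm \<sigma> \<and> norm \<sigma> < real r + 1}"

abbreviation sing_mult :: "(complex \<Rightarrow> complex) \<Rightarrow> complex \<Rightarrow> real" where
  "sing_mult Z \<sigma> \<equiv> \<bar>real_of_int (zorder Z \<sigma>)\<bar>"

lemma finite_sing_block:
  assumes "\<And>R. finite (singular_points Z \<inter> {\<sigma>. norm \<sigma> \<le> R})"
  shows "finite (sing_block Z r)"
  by (rule finite_subset[OF _ assms[of "real r + 1"]]) (auto simp: sing_block_def)

lemma sum_sing_blocks:
  assumes fin: "\<And>R. finite (singular_points Z \<inter> {\<sigma>. norm \<sigma> \<le> R})"
  shows "(\<Sum>\<sigma> \<in> singular_points Z \<inter> {\<sigma>. norm \<sigma> < real R}. f \<sigma>) = (\<Sum>r<R. \<Sum>\<sigma>\<in>sing_block Z r. f \<sigma>)"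
proof (induction R)
  case (Suc R)
  have "singular_points Z \<inter> {\<sigma>. norm \<sigma> < real (Suc R)} = (singular_points Z \<inter> {\<sigma>. norm \<sigma> < real R}) \<union> sing_block Z R"
    by (auto simp: sing_block_def)
  moreover have "finite (singular_points Z \<inter> {\<sigma>. norm \<sigma> < real R})"
    by (rule finite_subset[OF _ fin[of "real R"]]) auto
  moreover have "(singular_points Z \<inter> {\<sigma>. norm \<sigma> < real R}) \<inter> sing_block Z R = {}"
    by (auto simp: sing_block_def)
  ultimately show ?case using Suc finite_sing_block[OF fin, of R] by (simp add: sum.union_disjoint)
next
  case 0
  have "singular_points Z \<inter> {\<sigma>. norm \<sigma> < real 0} = {}" by (auto simp: not_less)
  then show ?case by simp
qed

lemma real_sing_count: "real (sing_count Z A) = (\<Sum>\<sigma> \<in> singular_points Z \<inter> A. sing_mult Z \<sigma>)"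
  unfolding sing_count_def of_nat_sum by (rule sum.cong) auto

lemma bigo_powr_bound:
  fixes f :: "real \<Rightarrow> real"
  assumes "f \<in> O[at_top](\<lambda>x. x powr a)"
  obtains K x0 where "K > 0" "x0 \<ge> 1" "\<And>x. x \<ge> x0 \<Longrightarrow> \<bar>f x\<bar> \<le> K * x powr a"
proof -
  obtain K where K: "K > 0" "eventually (\<lambda>x. norm (f x) \<le> K * norm (x powr a)) at_top"
    using landau_o.bigE[OF assms] by blast
  then obtain x0 where "\<And>x. x \<ge> x0 \<Longrightarrow> norm (f x) \<le> K * norm (x powr a)"
    by (auto simp: eventually_at_top_linorder)
  then show ?thesis using K(1) by (intro that[of K "max 1 x0"]) auto
qed

text \<open>The finitely many terms before \<open>x0\<close> are absorbed by adding their sum to the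
  constant; the powers are at least 1 because \<open>a \<ge> 0\<close>.\<close>

lemma nat_sequence_powr_bound:
  fixes f :: "nat \<Rightarrow> real"
  assumes "\<And>r. real r \<ge> x0 \<Longrightarrow> f r \<le> K * (1 + real r) powr a" "\<And>r. f r \<ge> 0" "K > 0" "a \<ge> 0"
  obtains C where "C > 0" "\<And>r. f r \<le> C * (1 + real r) powr a"
proof -
  define n0 where "n0 = nat \<lceil>x0\<rceil>"
  define K' where "K' = (\<Sum>r<n0. f r)"
  have K': "K' \<ge> 0" unfolding K'_def by (intro sum_nonneg assms)
  have "f r \<le> (K + K') * (1 + real r) powr a" for r
  proof (cases "r < n0")
    case True
    have "f r \<le> K'" unfolding K'_def using True assms by (intro member_le_sum) auto
    also have "\<dots> \<le> (K + K') * 1" using assms by simp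
    also have "\<dots> \<le> (K + K') * (1 + real r) powr a"
      using K' assms ge_one_powr_ge_zero[of "1 + real r" a] by (intro mult_left_mono) auto
    finally show ?thesis .
  next
    case False
    then have "real r \<ge> x0" unfolding n0_def by linarith
    then have "f r \<le> K * (1 + real r) powr a" by (rule assms)
    also have "\<dots> \<le> (K + K') * (1 + real r) powr a" using K' by (intro mult_right_mono) auto
    finally show ?thesis .
  qed
  then show ?thesis using K' assms by (intro that[of "K + K'"]) auto
qed

lemma sing_block_count_bound:
  assumes fin: "\<And>R. finite (singular_points Z \<inter> {\<sigma>. norm \<sigma> \<le> R})"
    and O: "(\<lambda>T::real. real (sing_count Z {\<sigma>. T - 1 < norm \<sigma> \<and> norm \<sigma> < T + 1})) \<in> O[at_top](\<lambda>T. T powr a)"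
    and a: "a \<ge> 0"
  obtains C where "C > 0" "\<And>r. (\<Sum>\<sigma>\<in>sing_block Z r. sing_mult Z \<sigma>) \<le> C * (1 + real r) powr a"
proof -
  obtain K x0 where K: "K > 0" "x0 \<ge> 1" "\<And>x. x \<ge> x0 \<Longrightarrow>
      \<bar>real (sing_count Z {\<sigma>. x - 1 < norm \<sigma> \<and> norm \<sigma> < x + 1})\<bar> \<le> K * x powr a"
    using bigo_powr_bound[OF O] by blast
  have "(\<Sum>\<sigma>\<in>sing_block Z r. sing_mult Z \<sigma>) \<le> K * (1 + real r) powr a" if "real r \<ge> x0" for r
  proof -
    \<comment> \<open>Centred so that the annulus from \<open>r\<close> to \<open>r + 1\<close> lies
      inside the open one from \<open>T - 1\<close> to \<open>T + 1\<close>.\<close>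
    define T where "T = real r + 1 / 2"
    have "(\<Sum>\<sigma>\<in>sing_block Z r. sing_mult Z \<sigma>) \<le> (\<Sum>\<sigma> \<in> singular_points Z \<inter> {\<sigma>. T - 1 < norm \<sigma> \<and> norm \<sigma> < T + 1}. sing_mult Z \<sigma>)"
      by (rule sum_mono2[OF finite_subset[OF _ fin[of "T + 1"]]]) (auto simp: sing_block_def T_def)
    also have "\<dots> = \<bar>real (sing_count Z {\<sigma>. T - 1 < norm \<sigma> \<and> norm \<sigma> < T + 1})\<bar>"
      by (simp add: real_sing_count)
    also have "\<dots> \<le> K * T powr a" using that by (intro K) (auto simp: T_def)
    also have "\<dots> \<le> K * (1 + real r) powr a"
      using K a by (intro mult_left_mono powr_mono2) (auto simp: T_def)
    finally show ?thesis .
  qed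
  then show ?thesis using nat_sequence_powr_bound[OF _ _ K(1) a, of x0 "\<lambda>r. \<Sum>\<sigma>\<in>sing_block Z r. sing_mult Z \<sigma>"] that
    by (simp add: sum_nonneg) blast
qed

lemma sing_total_count_bound:
  assumes fin: "\<And>R. finite (singular_points Z \<inter> {\<sigma>. norm \<sigma> \<le> R})"
    and O: "(\<lambda>T::real. real (sing_count Z {\<sigma>. norm \<sigma> < T})) \<in> O[at_top](\<lambda>T. T powr a)"
    and a: "a \<ge> 0"
  obtains C where "C > 0" "\<And>R. (\<Sum>r<R. \<Sum>\<sigma>\<in>sing_block Z r. sing_mult Z \<sigma>) \<le> C * (1 + real R) powr a"
proof -
  obtain K x0 where K: "K > 0" "x0 \<ge> 1" "\<And>x. x \<ge> x0 \<Longrightarrow> \<bar>real (sing_count Z {\<sigma>. norm \<sigma> < x})\<bar> \<le> K * x powr a"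
    using bigo_powr_bound[OF O] by blast
  have "(\<Sum>r<R. \<Sum>\<sigma>\<in>sing_block Z r. sing_mult Z \<sigma>) \<le> K * (1 + real R) powr a" if "real R \<ge> x0" for R
  proof -
    have "(\<Sum>r<R. \<Sum>\<sigma>\<in>sing_block Z r. sing_mult Z \<sigma>) = \<bar>real (sing_count Z {\<sigma>. norm \<sigma> < real R})\<bar>"
      unfolding real_sing_count sum_sing_blocks[OF fin, symmetric] by (simp add: sum_nonneg)
    also have "\<dots> \<le> K * real R powr a" by (rule K(3)[OF that])
    also have "\<dots> \<le> K * (1 + real R) powr a" using K a by (intro mult_left_mono powr_mono2) auto
    finally show ?thesis .
  qed
  then show ?thesis using nat_sequence_powr_bound[OF _ _ K(1) a, of x0 "\<lambda>R. \<Sum>r<R. \<Sum>\<sigma>\<in>sing_block Z r. sing_mult Z \<sigma>"] that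
    by (simp add: sum_nonneg) blast
qed

section \<open>The explicit formula\<close>

locale zeta_setup =
  fixes P :: "'a set" and N :: "'a \<Rightarrow> real" and Z :: "complex \<Rightarrow> complex" and d d1 \<rho> :: real
  assumes infP: "infinite P" and countP: "countable P" and N_gt_1: "\<And>p. p \<in> P \<Longrightarrow> N p > 1"
    and abscissa: "abscissa_set P N \<noteq> {}" "Inf (abscissa_set P N) = 1"
    and Z_eq: "\<And>s. Re s > 1 \<Longrightarrow> Z s = euler_product P N s"
    and Z_analytic: "Z analytic_on ({s. Re s \<ge> 1} - {1})"
    and Z_nz: "\<And>s. Re s \<ge> 1 \<Longrightarrow> s \<noteq> 1 \<Longrightarrow> Z s \<noteq> 0"
    and Z_pole: "is_pole Z 1"
    and d_nonneg: "d \<ge> 0" and order: "meromorphic_of_order Z d" and d1_nonneg: "0 \<le> d1"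
    and short: "\<And>\<epsilon>. \<epsilon> > 0 \<Longrightarrow>
           (\<lambda>T::real. real (sing_count Z {\<sigma>. T - 1 < norm \<sigma> \<and> norm \<sigma> < T + 1}))
             \<in> O[at_top](\<lambda>T. T powr (d1 + \<epsilon>))"
    and fin_right: "finite (singular_points Z \<inter> {s. Re s \<ge> \<rho>})"
begin

lemma summable_powr:
  assumes "a > 1"
  shows "(\<lambda>p. N p powr (- a)) summable_on P"
proof -
  obtain b where b: "b \<in> abscissa_set P N" "b < a"
    using cInf_lessD[of "abscissa_set P N" a] abscissa assms by auto
  show ?thesis
  proof (rule summable_on_comparison_test)
    show "(\<lambda>p. N p powr (- b)) summable_on P" using b by (simp add: abscissa_set_def)
    show "N p powr (- a) \<le> N p powr (- b)" if "p \<in> P" for p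
      using N_gt_1[OF that] b by (intro powr_mono) auto
  qed auto
qed

lemma finite_norm_less: "finite {p \<in> P. N p < x}"
proof (cases "x > 0")
  case True
  have "finite {p \<in> P. N p powr (- 2) \<ge> x powr (- 2)}"
    by (rule finite_summable_ge[OF summable_powr]) (use True in auto)
  moreover have "{p \<in> P. N p < x} \<subseteq> {p \<in> P. N p powr (- 2) \<ge> x powr (- 2)}"
  proof safe
    fix p assume "p \<in> P" "N p < x"
    then show "x powr (- 2) \<le> N p powr (- 2)" using N_gt_1[of p] by (intro powr_mono2') auto
  qed
  ultimately show ?thesis by (rule finite_subset[rotated])
next
  case False
  then have "{p \<in> P. N p < x} = {}" using N_gt_1 by force
  then show ?thesis by (simp only: finite.emptyI)
qed

lemma eventually_Z_nz: "eventually (\<lambda>z. Z z \<noteq> 0) (at 1)"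
  using Z_pole by (rule non_zero_neighbour_pole)

lemma finite_order: "meromorphic_finite_order Z"
  using order by (simp add: meromorphic_of_order_def)

lemmas fin_sing = meromorphic_finite_order_log_deriv_expansion(3)[OF finite_order eventually_Z_nz]

lemma Re_sing_le_1: "Re \<sigma> \<le> 1" if "\<sigma> \<in> singular_points Z"
proof (rule ccontr)
  assume "\<not> Re \<sigma> \<le> 1"
  then have r: "Re \<sigma> \<ge> 1" "\<sigma> \<noteq> 1" by auto
  have an: "Z analytic_on {\<sigma>}" by (rule analytic_on_subset[OF Z_analytic]) (use r in auto)
  have "\<not> is_pole Z \<sigma>" using an by (rule analytic_at_imp_no_pole)
  moreover have "\<not> isolated_zero Z \<sigma>"
  proof
    assume "isolated_zero Z \<sigma>"
    then have "Z \<midarrow>\<sigma>\<rightarrow> 0" by (simp add: isolated_zero_def)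
    moreover have "Z \<midarrow>\<sigma>\<rightarrow> Z \<sigma>" using analytic_at_imp_isCont[OF an] by (simp add: isCont_def)
    ultimately have "Z \<sigma> = 0" using LIM_unique by blast
    then show False using Z_nz[OF r] by simp
  qed
  ultimately show False using that by (simp add: singular_points_def)
qed

lemma block_count_bound:
  assumes "\<epsilon> > 0"
  obtains C where "C > 0" "\<And>r. (\<Sum>\<sigma>\<in>sing_block Z r. sing_mult Z \<sigma>) \<le> C * (1 + real r) powr (d1 + \<epsilon>)"
  using sing_block_count_bound[OF fin_sing short[OF assms]] d1_nonneg assms by auto

lemma total_count_bound:
  assumes "\<epsilon> > 0"
  obtains C where "C > 0" "\<And>R. (\<Sum>r<R. \<Sum>\<sigma>\<in>sing_block Z r. sing_mult Z \<sigma>) \<le> C * (1 + real R) powr (d + \<epsilon>)"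
proof -
  have "(\<lambda>T::real. real (sing_count Z {\<sigma>. norm \<sigma> < T})) \<in> O[at_top](\<lambda>T. T powr (d + \<epsilon>))"
    using order assms by (simp add: meromorphic_of_order_def)
  from sing_total_count_bound[OF fin_sing this] show ?thesis using that d_nonneg assms by auto
qed

text \<open>All singular points have real part at most 1, so they are at distance at least 1 from
  \<open>c\<close>. The constant \<open>c + 2\<close> comes from
  \<open>1 + r \<le> norm (\<sigma> - c) + (c + 1)\<close>, with the last summand multiplied by
  \<open>norm (\<sigma> - c) \<ge> 1\<close>.\<close>

lemma shifted_norm_bounds:
  assumes "\<sigma> \<in> sing_block Z r" "c \<ge> 2"
  shows "1 \<le> norm (\<sigma> - of_real c)" "1 + real r \<le> (c + 2) * norm (\<sigma> - of_real c)" "Re (\<sigma> - of_real c) \<le> 0"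
proof -
  have s: "\<sigma> \<in> singular_points Z" "real r \<le> norm \<sigma>" using assms by (auto simp: sing_block_def)
  have "1 \<le> \<bar>Re (\<sigma> - of_real c)\<bar>" using Re_sing_le_1[OF s(1)] assms by simp
  also have "\<dots> \<le> norm (\<sigma> - of_real c)" by (rule abs_Re_le_cmod)
  finally show 1: "1 \<le> norm (\<sigma> - of_real c)" .
  show "Re (\<sigma> - of_real c) \<le> 0" using Re_sing_le_1[OF s(1)] assms by simp
  have "norm \<sigma> \<le> norm (\<sigma> - of_real c) + norm (complex_of_real c)"
    using norm_triangle_ineq[of "\<sigma> - of_real c" "of_real c"] by simp
  then have "1 + real r \<le> norm (\<sigma> - of_real c) + (c + 1) * 1" using s assms by simp
  also have "\<dots> \<le> norm (\<sigma> - of_real c) + (c + 1) * norm (\<sigma> - of_real c)"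
    using 1 assms by (intro add_left_mono mult_left_mono) auto
  finally show "1 + real r \<le> (c + 2) * norm (\<sigma> - of_real c)" by (simp add: algebra_simps)
qed

text \<open>\<open>c\<close> and the enumeration are obtained before \<open>k\<close>, so that
  \<open>k\<close> stays free above \<open>k0\<close>. Prime powers carry the damping
  \<open>exp (- c * pp_log N i)\<close> and exponentials the shift \<open>\<sigma> - c\<close>;
  multiplication by \<open>exp (c * u)\<close> will undo both, up to a factor bounded on the
  window.\<close>

lemma explicit_formula:
  obtains c :: real and k0 :: nat and e :: "nat \<Rightarrow> 'a \<times> nat" where "c \<ge> 2" "bij_betw e UNIV (P \<times> UNIV)"
    "\<And>k. k \<ge> k0 \<Longrightarrow> summable (\<lambda>r. \<Sum>\<sigma>\<in>sing_block Z r. sing_mult Z \<sigma> / norm (\<sigma> - of_real c) ^ k)"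
    "\<And>k h u. k \<ge> k0 \<Longrightarrow> h > 0 \<Longrightarrow> u > 0 \<Longrightarrow>
      summable (\<lambda>n. ln (N (fst (e n))) * exp (- c * pp_log N (e n)) *
        fdiffs h k (\<lambda>v. max 0 v ^ (k - 1) / fact (k - 1)) (u - pp_log N (e n)))"
    "\<And>k h u. k \<ge> k0 \<Longrightarrow> h > 0 \<Longrightarrow> u > 0 \<Longrightarrow>
      (\<lambda>R. \<Sum>r<R. \<Sum>\<sigma>\<in>sing_block Z r. of_int (zorder Z \<sigma>) *
         ((exp ((\<sigma> - of_real c) * of_real h) - 1) / (\<sigma> - of_real c)) ^ k * exp ((\<sigma> - of_real c) * of_real u))
      \<longlonglongrightarrow> - of_real (\<Sum>n. ln (N (fst (e n))) * exp (- c * pp_log N (e n)) *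
        fdiffs h k (\<lambda>v. max 0 v ^ (k - 1) / fact (k - 1)) (u - pp_log N (e n)))"
proof -
  obtain K c \<theta> where kc: "2 \<le> c \<and> 0 < \<theta> \<and> (\<forall>k\<ge>K. \<exists>q. \<forall>n::nat. \<forall>s. s = of_real (c + real n * \<theta>) \<longrightarrow>
      (\<lambda>R. deriv Z s / Z s - (\<Sum>\<sigma> \<in> singular_points Z \<inter> {\<sigma>. norm \<sigma> < real R}.
         of_int (zorder Z \<sigma>) * ((s - of_real c) ^ k / ((\<sigma> - of_real c) ^ k * (s - \<sigma>)))))
       \<longlonglongrightarrow> (\<Sum>i<k. q i * (s - of_real c) ^ i))"
    using meromorphic_finite_order_log_deriv_expansion(4)[OF finite_order eventually_Z_nz]
    by (elim exE) (erule that)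
  note c = kc[THEN conjunct1] and th = kc[THEN conjunct2, THEN conjunct1]
    and exp_lim = kc[THEN conjunct2, THEN conjunct2, rule_format]
  define e where "e = from_nat_into (P \<times> (UNIV :: nat set))"
  have e: "bij_betw e UNIV (P \<times> UNIV)" unfolding e_def
    using infP countP by (intro bij_betw_from_nat_into) (auto simp: finite_cartesian_product_iff)
  have en: "fst (e n) \<in> P" for n using bij_betwE[OF e] by (auto simp: mem_Times_iff)
  define t where "t n = pp_log N (e n)" for n
  define w where "w n = ln (N (fst (e n))) * exp (- c * t n)" for n
  have t0: "t n \<ge> 0" for n unfolding t_def by (rule pp_log_nonneg) (rule N_gt_1[OF en])
  have w0: "w n \<ge> 0" for n using N_gt_1[OF en[of n]] by (simp add: w_def)
  have sw: "summable w"
    using euler_product_log_deriv(2)[OF N_gt_1 summable_powr Z_eq e, of "of_real c"] c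
    by (simp add: w_def[abs_def] t_def)
  obtain C1 where C1: "C1 > 0" "\<And>r. (\<Sum>\<sigma>\<in>sing_block Z r. sing_mult Z \<sigma>) \<le> C1 * (1 + real r) powr (d1 + 1)"
    using block_count_bound[OF zero_less_one] by blast
  \<comment> \<open>\<open>K\<close> is for Hadamard's expansion, 2 for the continuity of the
    truncated powers, and \<open>d1 + 3\<close> for absolute convergence: an annulus contains at
    most about \<open>r powr (d1 + 1)\<close> points, and division by \<open>r ^ k\<close> has to
    leave \<open>r powr (- 2)\<close>.\<close>
  define k0 where "k0 = max (max K 2) (nat \<lceil>d1 + 3\<rceil>)"
  let ?T = "\<lambda>\<sigma>. \<sigma> - complex_of_real c"
  have M: "summable (\<lambda>r. \<Sum>\<sigma>\<in>sing_block Z r. sing_mult Z \<sigma> / norm (?T \<sigma>) ^ k)" if k: "k \<ge> k0" for k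
  proof (rule summable_comparison_test'[OF summable_mult[OF summable_powr_neg[OF zero_less_one], of "C1 * (c + 2) ^ k"]])
    fix r
    have "(\<Sum>\<sigma>\<in>sing_block Z r. sing_mult Z \<sigma> / norm (?T \<sigma>) ^ k) \<le> (\<Sum>\<sigma>\<in>sing_block Z r. sing_mult Z \<sigma> * ((c + 2) / (1 + real r)) ^ k)"
    proof (rule sum_mono)
      fix \<sigma> assume s: "\<sigma> \<in> sing_block Z r"
      note b = shifted_norm_bounds[OF s c]
      have "1 / norm (?T \<sigma>) \<le> (c + 2) / (1 + real r)" using b(1,2) c by (simp add: divide_simps mult.commute)
      then have "(1 / norm (?T \<sigma>)) ^ k \<le> ((c + 2) / (1 + real r)) ^ k" by (intro power_mono) auto
      then have "sing_mult Z \<sigma> * (1 / norm (?T \<sigma>)) ^ k \<le> sing_mult Z \<sigma> * ((c + 2) / (1 + real r)) ^ k"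
        by (rule mult_left_mono) simp
      then show "sing_mult Z \<sigma> / norm (?T \<sigma>) ^ k \<le> sing_mult Z \<sigma> * ((c + 2) / (1 + real r)) ^ k"
        by (simp add: power_divide)
    qed
    also have "\<dots> = (\<Sum>\<sigma>\<in>sing_block Z r. sing_mult Z \<sigma>) * ((c + 2) / (1 + real r)) ^ k"
      by (simp only: sum_distrib_right)
    also have "\<dots> \<le> C1 * (1 + real r) powr (d1 + 1) * ((c + 2) / (1 + real r)) ^ k"
      using c by (intro mult_right_mono C1) auto
    also have "\<dots> = C1 * (c + 2) ^ k * ((1 + real r) powr (d1 + 1) * (1 + real r) powr (- real k))"
      by (simp add: power_divide powr_minus_divide powr_realpow)
    also have "\<dots> \<le> C1 * (c + 2) ^ k * (1 + real r) powr (- 1 - 1)"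
    proof (rule mult_left_mono)
      have "d1 + 3 \<le> real k" using k unfolding k0_def by linarith
      then show "(1 + real r) powr (d1 + 1) * (1 + real r) powr (- real k) \<le> (1 + real r) powr (- 1 - 1)"
        unfolding powr_add[symmetric] by (intro powr_mono) auto
    qed (use C1 c in simp)
    finally show "norm (\<Sum>\<sigma>\<in>sing_block Z r. sing_mult Z \<sigma> / norm (?T \<sigma>) ^ k) \<le> C1 * (c + 2) ^ k * (1 + real r) powr (- 1 - 1)"
      by (simp add: sum_nonneg)
  qed
  have main: "summable (\<lambda>j. w j * fdiffs h k (\<lambda>v. max 0 v ^ (k - 1) / fact (k - 1)) (u - t j)) \<and>
    (\<lambda>R. \<Sum>r<R. \<Sum>\<sigma>\<in>sing_block Z r. of_int (zorder Z \<sigma>) * ((exp (?T \<sigma> * of_real h) - 1) / ?T \<sigma>) ^ k * exp (?T \<sigma> * of_real u))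
      \<longlonglongrightarrow> - of_real (\<Sum>j. w j * fdiffs h k (\<lambda>v. max 0 v ^ (k - 1) / fact (k - 1)) (u - t j))"
    if k: "k \<ge> k0" and h: "h > 0" and u: "u > 0" for k h u
  proof -
    have k2: "k \<ge> 2" "k \<ge> K" using k by (auto simp: k0_def)
    obtain q where q0: "\<forall>n::nat. \<forall>s. s = of_real (c + real n * \<theta>) \<longrightarrow>
      (\<lambda>R. deriv Z s / Z s - (\<Sum>\<sigma> \<in> singular_points Z \<inter> {\<sigma>. norm \<sigma> < real R}.
         of_int (zorder Z \<sigma>) * ((s - of_real c) ^ k / ((\<sigma> - of_real c) ^ k * (s - \<sigma>)))))
       \<longlonglongrightarrow> (\<Sum>i<k. q i * (s - of_real c) ^ i)"
      using exp_lim[OF k2(2)] by (elim exE) (erule that)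
    note q = q0[rule_format]
    define b where "b \<sigma> = of_int (zorder Z \<sigma>) / ?T \<sigma> ^ k" for \<sigma>
    have nb: "norm (b \<sigma>) = sing_mult Z \<sigma> / norm (?T \<sigma>) ^ k" for \<sigma>
      by (simp add: b_def norm_divide norm_power)
    have Mb: "summable (\<lambda>r. \<Sum>\<sigma>\<in>sing_block Z r. norm (b \<sigma>))" unfolding nb by (rule M[OF k])
    have Re: "Re (?T \<sigma>) \<le> 0" if "\<sigma> \<in> sing_block Z r" for r \<sigma> by (rule shifted_norm_bounds(3)[OF that c])
    have lim: "(\<lambda>R. \<Sum>r<R. \<Sum>\<sigma>\<in>sing_block Z r. b \<sigma> * (of_real s ^ k / (of_real s - ?T \<sigma>))) \<longlonglongrightarrow>
        - of_real (\<Sum>j. w j * exp (- s * t j)) - (\<Sum>i<k. q i * of_real s ^ i)"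
      if n: "n \<ge> 1" and s: "s = real n * \<theta>" for n s
    proof -
      \<comment> \<open>Evaluating the logarithmic derivative at \<open>c + s\<close> puts
        \<open>exp (- c * t j)\<close> into the weights \<open>w j\<close> and leaves the kernel
        \<open>exp (- s * t j)\<close>. These points lie to the right of 1, where the Euler product
        represents \<open>Z\<close>.\<close>
      define z where "z = complex_of_real (c + real n * \<theta>)"
      have zc: "z - of_real c = of_real s" by (simp add: z_def s)
      have "real n * \<theta> \<ge> 0" using th by simp
      then have Rez: "Re z > 1" using c by (simp add: z_def)
      have ld: "deriv Z z / Z z = - of_real (\<Sum>j. w j * exp (- s * t j))"
      proof -
        have "of_real (ln (N (fst (e j)))) * exp (- z * of_real (pp_log N (e j))) = complex_of_real (w j * exp (- s * t j))" for j
        proof -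
          have "exp (- z * of_real (t j)) = complex_of_real (exp (- c * t j) * exp (- s * t j))"
            by (simp add: z_def s exp_of_real[symmetric] exp_add[symmetric] algebra_simps)
          then show ?thesis by (simp add: w_def t_def)
        qed
        moreover have "summable (\<lambda>j. w j * exp (- s * t j))"
        proof (rule summable_comparison_test'[OF sw])
          fix j
          have "w j * exp (- s * t j) \<le> w j * 1"
            using w0[of j] t0[of j] th by (intro mult_left_mono) (auto simp: s)
          then show "norm (w j * exp (- s * t j)) \<le> w j" using w0[of j] by simp
        qed
        ultimately show ?thesis
          using euler_product_log_deriv(1)[OF N_gt_1 summable_powr Z_eq e Rez] by (simp add: suminf_of_real)
      qed
      have "(\<lambda>R. deriv Z z / Z z - (deriv Z z / Z z - (\<Sum>\<sigma> \<in> singular_points Z \<inter> {\<sigma>. norm \<sigma> < real R}.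
         of_int (zorder Z \<sigma>) * ((z - of_real c) ^ k / ((\<sigma> - of_real c) ^ k * (z - \<sigma>))))))
       \<longlonglongrightarrow> deriv Z z / Z z - (\<Sum>i<k. q i * (z - of_real c) ^ i)"
        by (intro tendsto_diff tendsto_const q[OF z_def])
      moreover have "(\<Sum>\<sigma> \<in> singular_points Z \<inter> {\<sigma>. norm \<sigma> < real R}.
         of_int (zorder Z \<sigma>) * ((z - of_real c) ^ k / ((\<sigma> - of_real c) ^ k * (z - \<sigma>)))) =
         (\<Sum>r<R. \<Sum>\<sigma>\<in>sing_block Z r. b \<sigma> * (of_real s ^ k / (of_real s - ?T \<sigma>)))" for R
      proof -
        have "of_int (zorder Z \<sigma>) * ((z - of_real c) ^ k / ((\<sigma> - of_real c) ^ k * (z - \<sigma>))) = b \<sigma> * (of_real s ^ k / (of_real s - ?T \<sigma>))" for \<sigma>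
        proof -
          have "z - \<sigma> = of_real s - ?T \<sigma>" using zc by (simp add: algebra_simps)
          then show ?thesis unfolding zc b_def by simp
        qed
        then show ?thesis by (simp only: sum_sing_blocks[OF fin_sing])
      qed
      ultimately show ?thesis by (simp add: ld zc)
    qed
    note ident = laplace_explicit_formula[OF t0 w0 sw k2(1) Re Mb th lim]
    have k1: "k \<ge> 1" using k2 by simp
    note D = fdiffs_laplace_explicit[OF t0 w0 sw Re Mb less_imp_le[OF h] k1 ident u]
    let ?X = "\<Sum>j. w j * fdiffs h k (\<lambda>v. max 0 v ^ (k - 1) / fact (k - 1)) (u - t j)"
    let ?Y = "\<lambda>r. \<Sum>\<sigma>\<in>sing_block Z r. b \<sigma> * ((exp (?T \<sigma> * of_real h) - 1) ^ k * exp (?T \<sigma> * of_real u))"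
    have D1: "summable (\<lambda>j. w j * fdiffs h k (\<lambda>v. max 0 v ^ (k - 1) / fact (k - 1)) (u - t j))" by (rule D(1))
    have D2: "summable ?Y" by (rule D(2))
    have D3: "complex_of_real ?X = - (\<Sum>r. ?Y r)" by (rule D(3))
    have S: "(\<Sum>r. ?Y r) = - of_real ?X" unfolding D3 by (rule minus_minus[symmetric])
    have "(\<lambda>R. \<Sum>r<R. ?Y r) \<longlonglongrightarrow> - of_real ?X"
      using summable_LIMSEQ[OF D2] unfolding S .
    moreover have "b \<sigma> * ((exp (?T \<sigma> * of_real h) - 1) ^ k * exp (?T \<sigma> * of_real u)) =
      of_int (zorder Z \<sigma>) * ((exp (?T \<sigma> * of_real h) - 1) / ?T \<sigma>) ^ k * exp (?T \<sigma> * of_real u)" for \<sigma>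
      by (simp add: b_def power_divide)
    ultimately have "(\<lambda>R. \<Sum>r<R. \<Sum>\<sigma>\<in>sing_block Z r. of_int (zorder Z \<sigma>) *
        ((exp (?T \<sigma> * of_real h) - 1) / ?T \<sigma>) ^ k * exp (?T \<sigma> * of_real u)) \<longlonglongrightarrow> - of_real ?X"
      by (simp only:)
    then show ?thesis using D1 by (intro conjI)
  qed
  show ?thesis
    by (rule that[of c e k0]) (use c e M main in \<open>auto simp: w_def t_def\<close>)
qed

end

section \<open>The mean square of the spectral side\<close>

lemma sum_squares_le_square_sum:
  fixes f :: "'b \<Rightarrow> real"
  assumes "finite S" "\<And>x. x \<in> S \<Longrightarrow> f x \<ge> 0"
  shows "(\<Sum>x\<in>S. (f x)\<^sup>2) \<le> (\<Sum>x\<in>S. f x)\<^sup>2"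
  using assms
proof (induction rule: finite_induct)
  case (insert x F)
  have "sum f F \<ge> 0" "f x \<ge> 0" using insert.prems by (auto intro: sum_nonneg)
  then have "0 \<le> 2 * f x * sum f F" by simp
  then show ?case using insert by (simp add: power2_sum)
qed simp

lemma has_integral_indicator_interval:
  fixes a b :: real
  assumes "{p..q} \<subseteq> {a..b}" "p \<le> q"
  shows "((\<lambda>u. y * indicator {p..q} u) has_integral y * (q - p)) {a..b}"
proof -
  have "((\<lambda>u. y) has_integral (q - p) *\<^sub>R y) {p..q}"
    using has_integral_const_real[of y p q] assms by simp
  then have "((\<lambda>u. if u \<in> {p..q} then y else 0) has_integral (q - p) *\<^sub>R y) {a..b}"
    by (subst has_integral_restrict[OF assms(1)])
  moreover have "(if u \<in> {p..q} then y else 0) = y * indicator {p..q} u" for u by simp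
  ultimately show ?thesis by (simp only: real_scaleR_def mult.commute)
qed

context zeta_setup
begin

text \<open>The finitely many points \<open>Fs\<close> of real part at least \<rho> are estimated
  trivially, by \<open>h ^ k * exp u\<close> times the multiplicity; the others, in the sets
  \<open>B r\<close>, by \<open>series_mean_square\<close>. The constant \<open>C\<close> is chosen
  before \<open>h\<close>, \<open>a\<close>, \<open>b\<close> and \<open>E\<close>. The estimate is
  passed on through a majorant \<open>G\<close> of the square of \<open>V\<close>, built from
  \<open>L\<close>, whose squared norm is integrable by dominated convergence.\<close>

lemma spectral_mean_square:
  fixes c :: real and k :: nat
  assumes e: "\<epsilon> > 0" and c: "c \<ge> 2" and k: "d + 2 * \<epsilon> \<le> real k" "d1 + 2 * \<epsilon> \<le> real k"
    and M: "summable (\<lambda>r. \<Sum>\<sigma>\<in>sing_block Z r. sing_mult Z \<sigma> / norm (\<sigma> - of_real c) ^ k)"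
  obtains C where "C > 0" "\<And>h a b E V. 0 < h \<Longrightarrow> h \<le> 1 \<Longrightarrow> 0 < a \<Longrightarrow> a \<le> b \<Longrightarrow>
      (\<And>u. u \<in> {a..b} \<Longrightarrow> exp (2 * \<rho> * u) \<le> E) \<Longrightarrow>
      (\<And>u. u \<in> {a..b} \<Longrightarrow> (\<lambda>R. \<Sum>r<R. \<Sum>\<sigma>\<in>sing_block Z r. of_int (zorder Z \<sigma>) *
         ((exp ((\<sigma> - of_real c) * of_real h) - 1) / (\<sigma> - of_real c)) ^ k * exp (\<sigma> * of_real u))
        \<longlonglongrightarrow> - complex_of_real (V u)) \<Longrightarrow>
      \<exists>G. G integrable_on {a..b} \<and> (\<forall>u\<in>{a..b}. (V u)\<^sup>2 \<le> G u) \<and>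
        integral {a..b} G \<le> C * (1 + (b - a)) * h ^ (2 * k) * (E * h powr (- (d + d1 + 4 * \<epsilon>)) + exp (2 * b))"
proof -
  define B where "B r = {\<sigma> \<in> sing_block Z r. Re \<sigma> < \<rho>}" for r
  define Fs where "Fs = singular_points Z \<inter> {s. Re s \<ge> \<rho>}"
  have finFs: "finite Fs" unfolding Fs_def by (rule fin_right)
  have finB: "finite (B r)" for r unfolding B_def using finite_sing_block[OF fin_sing, of r] by simp
  have BA: "B r \<subseteq> sing_block Z r" for r by (auto simp: B_def)
  define cc where "cc r = (\<Sum>\<sigma>\<in>B r. sing_mult Z \<sigma>)" for r
  have ccle: "cc r \<le> (\<Sum>\<sigma>\<in>sing_block Z r. sing_mult Z \<sigma>)" for r
    unfolding cc_def by (rule sum_mono2[OF finite_sing_block[OF fin_sing] BA]) simp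
  have cc0: "cc r \<ge> 0" for r unfolding cc_def by (intro sum_nonneg) simp
  obtain C1 where C1: "C1 > 0" "\<And>r. (\<Sum>\<sigma>\<in>sing_block Z r. sing_mult Z \<sigma>) \<le> C1 * (1 + real r) powr (d1 + \<epsilon>)"
    using block_count_bound[OF e] by blast
  obtain C2 where C2: "C2 > 0" "\<And>R. (\<Sum>r<R. \<Sum>\<sigma>\<in>sing_block Z r. sing_mult Z \<sigma>) \<le> C2 * (1 + real R) powr (d + \<epsilon>)"
    using total_count_bound[OF e] by blast
  have cc1: "cc r \<le> C1 * (1 + real r) powr (d1 + \<epsilon>)" for r using ccle C1(2) by (rule order_trans)
  have cc2: "(\<Sum>r<R. cc r) \<le> C2 * (1 + real R) powr (d + \<epsilon>)" for R
    by (rule order_trans[OF sum_mono[OF ccle] C2(2)])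
  have de: "d + \<epsilon> \<ge> 0" using d_nonneg e by simp
  obtain K where K: "K \<ge> 0" "\<And>R. (\<Sum>r<R. \<Sum>r'<R. cc r * (1 + real r) powr (- (d + \<epsilon> + \<epsilon>)) * (cc r' * (1 + real r') powr (- (d1 + \<epsilon> + \<epsilon>)))
    / (1 + \<bar>real r - real r'\<bar>)) \<le> K"
    using double_sum_bound[OF cc0 cc2 de cc1 e] by blast
  \<comment> \<open>One \<epsilon> comes from the counting bound, the other makes the double sum
    converge; \<open>x\<close> and \<open>x'\<close> add up to
    \<open>d + d1 + 4 * \<epsilon>\<close>.\<close>
  define x where "x = d + \<epsilon> + \<epsilon>"
  define x' where "x' = d1 + \<epsilon> + \<epsilon>"
  have xk: "0 \<le> x" "x \<le> real k" "0 \<le> x'" "x' \<le> real k"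
    using k d_nonneg d1_nonneg e by (auto simp: x_def x'_def)
  define M1 where "M1 = (\<Sum>\<sigma>\<in>Fs. sing_mult Z \<sigma>)"
  define \<kappa> where "\<kappa> = 2 * (c + 2)"
  define Mtot where "Mtot = (\<Sum>r. \<Sum>\<sigma>\<in>sing_block Z r. sing_mult Z \<sigma> / norm (\<sigma> - of_real c) ^ k)"
  \<comment> \<open>32 collects a factor 2 from squaring \<open>L + V1\<close>, a factor 2 from
    passing to block indices, and 8 from \<open>2 * (b - a) + 4 \<le> 8 * (1 + (b - a))\<close>. The
    summand with \<open>M1\<close> belongs to \<open>Fs\<close>, and 1 makes \<open>C\<close>
    positive.\<close>
  define C where "C = 32 * \<kappa> powr (x + x') * K + 2 * M1\<^sup>2 + 1"
  have C0: "C > 0" unfolding C_def using K(1) by (intro add_nonneg_pos add_nonneg_nonneg) auto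
  have "\<exists>G. G integrable_on {a..b} \<and> (\<forall>u\<in>{a..b}. (V u)\<^sup>2 \<le> G u) \<and>
        integral {a..b} G \<le> C * (1 + (b - a)) * h ^ (2 * k) * (E * h powr (- (d + d1 + 4 * \<epsilon>)) + exp (2 * b))"
    if h: "0 < h" "h \<le> 1" and ab: "0 < a" "a \<le> b" and E: "\<And>u. u \<in> {a..b} \<Longrightarrow> exp (2 * \<rho> * u) \<le> E"
      and V: "\<And>u. u \<in> {a..b} \<Longrightarrow> (\<lambda>R. \<Sum>r<R. \<Sum>\<sigma>\<in>sing_block Z r. of_int (zorder Z \<sigma>) *
         ((exp ((\<sigma> - of_real c) * of_real h) - 1) / (\<sigma> - of_real c)) ^ k * exp (\<sigma> * of_real u))
        \<longlonglongrightarrow> - complex_of_real (V u)" for h a b E V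
  proof -
    define y where "y \<sigma> = of_int (zorder Z \<sigma>) * ((exp ((\<sigma> - of_real c) * of_real h) - 1) / (\<sigma> - of_real c)) ^ k" for \<sigma>
    have yb: "norm (y \<sigma>) \<le> h ^ k * (\<kappa> / h) powr x0 * (sing_mult Z \<sigma> * (1 + real r) powr (- x0))"
      if s: "\<sigma> \<in> sing_block Z r" and x0: "0 \<le> x0" "x0 \<le> real k" for \<sigma> r x0
    proof -
      note sn = shifted_norm_bounds[OF s c]
      have "\<sigma> - of_real c \<noteq> 0" using sn(1) by auto
      from cexp_quotient_power_bound[OF sn(3) this h(1) _ sn(2) x0]
      have "norm (((exp ((\<sigma> - of_real c) * of_real h) - 1) / (\<sigma> - of_real c)) ^ k) \<le> h ^ k * (\<kappa> / h) powr x0 * (1 + real r) powr (- x0)"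
        by (simp add: \<kappa>_def)
      then have "sing_mult Z \<sigma> * norm (((exp ((\<sigma> - of_real c) * of_real h) - 1) / (\<sigma> - of_real c)) ^ k) \<le>
        sing_mult Z \<sigma> * (h ^ k * (\<kappa> / h) powr x0 * (1 + real r) powr (- x0))" by (rule mult_left_mono) simp
      moreover have "norm (y \<sigma>) = sing_mult Z \<sigma> * norm (((exp ((\<sigma> - of_real c) * of_real h) - 1) / (\<sigma> - of_real c)) ^ k)"
        by (simp add: y_def norm_mult)
      ultimately show ?thesis by (simp add: mult_ac)
    qed
    have \<kappa>h: "\<kappa> / h > 0" using c h by (simp add: \<kappa>_def)
    have inblock: "\<sigma> \<in> sing_block Z (nat \<lfloor>norm \<sigma>\<rfloor>)" if "\<sigma> \<in> singular_points Z" for \<sigma>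
      using that unfolding sing_block_def by (simp add: of_nat_nat)
    \<comment> \<open>Exponent 0 in \<open>yb\<close> gives the plain bound \<open>h ^ k\<close>
      times the multiplicity, without decay.\<close>
    have yFs: "norm (y \<sigma>) \<le> h ^ k * sing_mult Z \<sigma>" if "\<sigma> \<in> Fs" for \<sigma>
    proof -
      define r where "r = nat \<lfloor>norm \<sigma>\<rfloor>"
      have "\<sigma> \<in> sing_block Z r" unfolding r_def using that by (intro inblock) (simp add: Fs_def)
      from yb[OF this order_refl of_nat_0_le_iff]
      have "norm (y \<sigma>) \<le> h ^ k * (\<kappa> / h) powr 0 * (sing_mult Z \<sigma> * (1 + real r) powr (- 0))" .
      moreover have "(\<kappa> / h) powr 0 = 1" using \<kappa>h by (metis less_irrefl powr_zero_eq_one)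
      moreover have "(1 + real r) powr (- 0) = 1" by simp
      ultimately show ?thesis by (simp only: mult_1_right)
    qed
    define V1 where "V1 u = (\<Sum>\<sigma>\<in>Fs. y \<sigma> * exp (\<sigma> * of_real u))" for u :: real
    define L where "L u = - complex_of_real (V u) - V1 u" for u
    have V1b: "norm (V1 u) \<le> h ^ k * M1 * exp u" if u: "u \<in> {a..b}" for u
    proof -
      have "norm (V1 u) \<le> (\<Sum>\<sigma>\<in>Fs. h ^ k * sing_mult Z \<sigma> * exp u)" unfolding V1_def
      proof (rule sum_norm_le)
        fix \<sigma> assume s: "\<sigma> \<in> Fs"
        have "Re \<sigma> * u \<le> 1 * u" using Re_sing_le_1[of \<sigma>] s u ab by (intro mult_right_mono) (auto simp: Fs_def)
        then show "norm (y \<sigma> * exp (\<sigma> * of_real u)) \<le> h ^ k * sing_mult Z \<sigma> * exp u"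
          unfolding norm_mult using yFs[OF s] h by (intro mult_mono mult_nonneg_nonneg) auto
      qed
      then show ?thesis by (simp add: M1_def sum_distrib_left sum_distrib_right)
    qed
    have split: "(\<Sum>r<R. \<Sum>\<sigma>\<in>B r. y \<sigma> * exp (\<sigma> * of_real u)) =
      (\<Sum>r<R. \<Sum>\<sigma>\<in>sing_block Z r. y \<sigma> * exp (\<sigma> * of_real u)) - (\<Sum>\<sigma> \<in> Fs \<inter> {\<sigma>. norm \<sigma> < real R}. y \<sigma> * exp (\<sigma> * of_real u))" for R and u :: real
    proof -
      define f where "f \<sigma> = y \<sigma> * exp (\<sigma> * of_real u)" for \<sigma>
      have finR: "finite (singular_points Z \<inter> {\<sigma>. norm \<sigma> < real R})"
        by (rule finite_subset[OF _ fin_sing[of "real R"]]) auto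
      have "(\<Sum>r<R. \<Sum>\<sigma>\<in>sing_block Z r. f \<sigma>) - (\<Sum>r<R. \<Sum>\<sigma>\<in>B r. f \<sigma>) = (\<Sum>r<R. \<Sum>\<sigma>\<in>sing_block Z r. if Re \<sigma> \<ge> \<rho> then f \<sigma> else 0)"
        unfolding sum_subtractf[symmetric]
      proof (rule sum.cong[OF refl])
        fix r
        have "(\<Sum>\<sigma>\<in>B r. f \<sigma>) = (\<Sum>\<sigma>\<in>sing_block Z r. if Re \<sigma> < \<rho> then f \<sigma> else 0)"
          unfolding B_def by (rule sum.inter_filter[OF finite_sing_block[OF fin_sing]])
        then show "(\<Sum>\<sigma>\<in>sing_block Z r. f \<sigma>) - (\<Sum>\<sigma>\<in>B r. f \<sigma>) = (\<Sum>\<sigma>\<in>sing_block Z r. if Re \<sigma> \<ge> \<rho> then f \<sigma> else 0)"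
          by (simp add: sum_subtractf[symmetric]) (rule sum.cong, auto)
      qed
      also have "\<dots> = (\<Sum>\<sigma> \<in> singular_points Z \<inter> {\<sigma>. norm \<sigma> < real R}. if Re \<sigma> \<ge> \<rho> then f \<sigma> else 0)"
        by (rule sum_sing_blocks[OF fin_sing, symmetric])
      also have "\<dots> = (\<Sum>\<sigma> \<in> {\<sigma> \<in> singular_points Z \<inter> {\<sigma>. norm \<sigma> < real R}. Re \<sigma> \<ge> \<rho>}. f \<sigma>)"
        by (rule sum.inter_filter[OF finR, symmetric])
      also have "{\<sigma> \<in> singular_points Z \<inter> {\<sigma>. norm \<sigma> < real R}. Re \<sigma> \<ge> \<rho>} = Fs \<inter> {\<sigma>. norm \<sigma> < real R}"
        by (auto simp: Fs_def)
      finally show ?thesis unfolding f_def by (simp add: algebra_simps)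
    qed
    have Llim: "(\<lambda>R. \<Sum>r<R. \<Sum>\<sigma>\<in>B r. y \<sigma> * exp (\<sigma> * of_real u)) \<longlonglongrightarrow> L u" if u: "u \<in> {a..b}" for u
    proof -
      have "\<forall>\<^sub>F R in sequentially. real R > (\<Sum>\<sigma>\<in>Fs. norm \<sigma>)"
        by (rule eventually_compose_filterlim[OF eventually_gt_at_top filterlim_real_sequentially])
      then have "\<forall>\<^sub>F R in sequentially. V1 u = (\<Sum>\<sigma> \<in> Fs \<inter> {\<sigma>. norm \<sigma> < real R}. y \<sigma> * exp (\<sigma> * of_real u))"
      proof eventually_elim
        case (elim R)
        have "Fs \<inter> {\<sigma>. norm \<sigma> < real R} = Fs"
        proof safe
          fix \<sigma> assume "\<sigma> \<in> Fs"
          then have "norm \<sigma> \<le> (\<Sum>\<sigma>\<in>Fs. norm \<sigma>)" using finFs by (intro member_le_sum) auto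
          then show "norm \<sigma> < real R" using elim by simp
        qed
        then show ?case by (simp add: V1_def)
      qed
      then have "(\<lambda>R. \<Sum>\<sigma> \<in> Fs \<inter> {\<sigma>. norm \<sigma> < real R}. y \<sigma> * exp (\<sigma> * of_real u)) \<longlonglongrightarrow> V1 u"
        by (rule Lim_transform_eventually[OF tendsto_const])
      from tendsto_diff[OF V[OF u] this] show ?thesis
        unfolding split L_def by (simp add: y_def)
    qed
    have nB: "real r \<le> norm \<sigma> \<and> norm \<sigma> < real r + 1" if "\<sigma> \<in> B r" for r \<sigma>
      using that by (auto simp: B_def sing_block_def)
    have RB: "Re \<sigma> \<le> \<rho>" if "\<sigma> \<in> B r" for r \<sigma> using that by (auto simp: B_def)
    \<comment> \<open>A crude bound, uniform in \<open>u\<close> and \<open>R\<close>, to dominate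
      the partial sums; it does not enter the final estimate.\<close>
    have Qb: "norm (\<Sum>r<R. \<Sum>\<sigma>\<in>B r. y \<sigma> * exp (\<sigma> * of_real u)) \<le> 2 ^ k * exp b * Mtot" if u: "u \<in> {a..b}" for u R
    proof -
      have "norm (\<Sum>r<R. \<Sum>\<sigma>\<in>B r. y \<sigma> * exp (\<sigma> * of_real u)) \<le>
        (\<Sum>r<R. \<Sum>\<sigma>\<in>B r. 2 ^ k * exp b * (sing_mult Z \<sigma> / norm (\<sigma> - of_real c) ^ k))"
      proof (intro sum_norm_le)
        fix r \<sigma> assume s: "\<sigma> \<in> B r"
        then have s': "\<sigma> \<in> sing_block Z r" using BA by auto
        have "Re ((\<sigma> - of_real c) * of_real h) \<le> 0"
          using shifted_norm_bounds(3)[OF s' c] h by (simp add: mult_nonpos_nonneg)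
        from norm_cexp_minus_one_le(2)[OF this]
        have 1: "norm (exp ((\<sigma> - of_real c) * of_real h) - 1) ^ k \<le> 2 ^ k" by (intro power_mono) auto
        have "Re \<sigma> * u \<le> 1 * u" using Re_sing_le_1[of \<sigma>] s' u ab
          by (intro mult_right_mono) (auto simp: sing_block_def)
        then have 2: "norm (exp (\<sigma> * of_real u)) \<le> exp b" using u by simp
        have "norm (y \<sigma> * exp (\<sigma> * of_real u)) = (sing_mult Z \<sigma> / norm (\<sigma> - of_real c) ^ k) * (norm (exp ((\<sigma> - of_real c) * of_real h) - 1) ^ k * norm (exp (\<sigma> * of_real u)))"
          by (simp add: y_def norm_mult norm_power norm_divide power_divide)
        also have "\<dots> \<le> (sing_mult Z \<sigma> / norm (\<sigma> - of_real c) ^ k) * (2 ^ k * exp b)"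
          by (intro mult_left_mono mult_mono 1 2) auto
        finally show "norm (y \<sigma> * exp (\<sigma> * of_real u)) \<le> 2 ^ k * exp b * (sing_mult Z \<sigma> / norm (\<sigma> - of_real c) ^ k)"
          by (simp only: mult.commute)
      qed
      also have "\<dots> \<le> (\<Sum>r<R. \<Sum>\<sigma>\<in>sing_block Z r. 2 ^ k * exp b * (sing_mult Z \<sigma> / norm (\<sigma> - of_real c) ^ k))"
        by (intro sum_mono sum_mono2 finite_sing_block fin_sing BA) auto
      also have "\<dots> = 2 ^ k * exp b * (\<Sum>r<R. \<Sum>\<sigma>\<in>sing_block Z r. sing_mult Z \<sigma> / norm (\<sigma> - of_real c) ^ k)"
        by (simp only: sum_distrib_left)
      also have "\<dots> \<le> 2 ^ k * exp b * Mtot" unfolding Mtot_def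
        by (intro mult_left_mono sum_le_suminf M) (auto intro!: sum_nonneg)
      finally show ?thesis .
    qed
    define G1 where "G1 = h ^ k * (\<kappa> / h) powr x"
    define G2 where "G2 = h ^ k * (\<kappa> / h) powr x'"
    have G0: "G1 \<ge> 0" "G2 \<ge> 0" using h by (auto simp: G1_def G2_def)
    have y1: "norm (y \<sigma>) \<le> G1 * (sing_mult Z \<sigma> * (1 + real r) powr (- x))" if "\<sigma> \<in> B r" for r \<sigma>
      unfolding G1_def using that BA xk by (intro yb) auto
    have y2: "norm (y \<sigma>) \<le> G2 * (sing_mult Z \<sigma> * (1 + real r) powr (- x'))" if "\<sigma> \<in> B r" for r \<sigma>
      unfolding G2_def using that BA xk by (intro yb) auto
    note ms = series_mean_square[OF finB nB RB y1 y2 K(2)[unfolded cc_def, folded x_def x'_def] G0 less_imp_le[OF ab(1)] ab(2) E Llim Qb]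
    define G where "G u = 2 * (norm (L u))\<^sup>2 + 2 * (h ^ k * M1 * exp b)\<^sup>2" for u
    have LI: "(\<lambda>u. (norm (L u))\<^sup>2) integrable_on {a..b}" by (rule ms(1))
    have LB: "integral {a..b} (\<lambda>u. (norm (L u))\<^sup>2) \<le> E * (2 * (b - a) + 4) * (2 * G1 * G2 * K)" by (rule ms(2))
    have GI: "(G has_integral (2 * integral {a..b} (\<lambda>u. (norm (L u))\<^sup>2) + (b - a) * (2 * (h ^ k * M1 * exp b)\<^sup>2))) {a..b}"
      unfolding G_def
      using has_integral_add[OF has_integral_mult_right[OF integrable_integral[OF LI], of 2] has_integral_const_real[of "2 * (h ^ k * M1 * exp b)\<^sup>2" a b]] ab
      by simp
    have VG: "(V u)\<^sup>2 \<le> G u" if u: "u \<in> {a..b}" for u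
    proof -
      have "\<bar>V u\<bar> = norm (L u + V1 u)" by (simp add: L_def)
      also have "\<dots> \<le> norm (L u) + norm (V1 u)" by (rule norm_triangle_ineq)
      finally have "(V u)\<^sup>2 \<le> (norm (L u) + norm (V1 u))\<^sup>2" by (rule power2_le_iff_abs_le[THEN iffD2, rotated]) simp
      also have "\<dots> \<le> 2 * (norm (L u))\<^sup>2 + 2 * (norm (V1 u))\<^sup>2"
        using zero_le_power2[of "norm (L u) - norm (V1 u)"] by (simp add: power2_sum power2_diff)
      also have "(norm (V1 u))\<^sup>2 \<le> (h ^ k * M1 * exp b)\<^sup>2"
      proof (rule power_mono)
        have "M1 \<ge> 0" unfolding M1_def by (intro sum_nonneg) simp
        then have "h ^ k * M1 * exp u \<le> h ^ k * M1 * exp b" using u h by (intro mult_left_mono) auto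
        then show "norm (V1 u) \<le> h ^ k * M1 * exp b" using V1b[OF u] by linarith
      qed simp
      finally show ?thesis by (simp add: G_def)
    qed
    have E0: "E \<ge> 0" using E[of a] ab by (meson atLeastAtMost_iff exp_ge_zero order_refl order_trans)
    define T where "T = E * h powr (- (d + d1 + 4 * \<epsilon>))"
    have T0: "T \<ge> 0" using E0 by (simp add: T_def)
    have "G1 * G2 = h ^ (2 * k) * (\<kappa> powr (x + x') * h powr (- (d + d1 + 4 * \<epsilon>)))"
    proof -
      have "(\<kappa> / h) powr x * (\<kappa> / h) powr x' = (\<kappa> / h) powr (x + x')" by (simp add: powr_add)
      also have "\<dots> = \<kappa> powr (x + x') * h powr (- (x + x'))"
        by (simp only: powr_divide powr_minus_divide times_divide_eq_right mult_1_right)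
      finally have 1: "(\<kappa> / h) powr x * (\<kappa> / h) powr x' = \<kappa> powr (x + x') * h powr (- (x + x'))" .
      have 2: "x + x' = d + d1 + 4 * \<epsilon>" by (simp add: x_def x'_def)
      have "G1 * G2 = h ^ (2 * k) * ((\<kappa> / h) powr x * (\<kappa> / h) powr x')"
        by (simp add: G1_def G2_def mult_2 power_add)
      then show ?thesis unfolding 1 2 .
    qed
    then have GG: "E * (G1 * G2) = h ^ (2 * k) * (\<kappa> powr (x + x') * T)" by (simp add: T_def)
    have "2 * (E * (2 * (b - a) + 4) * (2 * G1 * G2 * K)) = (2 * (b - a) + 4) * (4 * K * (E * (G1 * G2)))"
      by (simp only: mult_ac)
    also have "\<dots> \<le> (8 * (1 + (b - a))) * (4 * K * (E * (G1 * G2)))"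
      using ab K(1) E0 G0 by (intro mult_right_mono mult_nonneg_nonneg) auto
    also have "\<dots> = (1 + (b - a)) * h ^ (2 * k) * ((32 * \<kappa> powr (x + x') * K) * T)"
      unfolding GG by simp
    also have "\<dots> \<le> (1 + (b - a)) * h ^ (2 * k) * (C * T)"
      using ab h K(1) T0 by (intro mult_left_mono mult_right_mono) (auto simp: C_def)
    finally have A1: "2 * (E * (2 * (b - a) + 4) * (2 * G1 * G2 * K)) \<le> (1 + (b - a)) * h ^ (2 * k) * (C * T)" .
    have "(h ^ k * M1 * exp b)\<^sup>2 = h ^ (2 * k) * (M1\<^sup>2 * exp (2 * b))"
    proof -
      have "(h ^ k)\<^sup>2 = h ^ (2 * k)" by (simp add: power_mult[symmetric] mult.commute)
      then show ?thesis unfolding exp_double power_mult_distrib by simp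
    qed
    then have "(b - a) * (2 * (h ^ k * M1 * exp b)\<^sup>2) = (b - a) * h ^ (2 * k) * (2 * M1\<^sup>2 * exp (2 * b))" by simp
    also have "\<dots> \<le> (1 + (b - a)) * h ^ (2 * k) * (C * exp (2 * b))"
      using ab h K(1) by (intro mult_mono mult_right_mono) (auto simp: C_def)
    finally have A2: "(b - a) * (2 * (h ^ k * M1 * exp b)\<^sup>2) \<le> (1 + (b - a)) * h ^ (2 * k) * (C * exp (2 * b))" .
    have "integral {a..b} G = 2 * integral {a..b} (\<lambda>u. (norm (L u))\<^sup>2) + (b - a) * (2 * (h ^ k * M1 * exp b)\<^sup>2)"
      using GI by (rule integral_unique)
    also have "\<dots> \<le> 2 * (E * (2 * (b - a) + 4) * (2 * G1 * G2 * K)) + (b - a) * (2 * (h ^ k * M1 * exp b)\<^sup>2)"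
      by (intro add_right_mono mult_left_mono LB) auto
    also have "\<dots> \<le> (1 + (b - a)) * h ^ (2 * k) * (C * T) + (1 + (b - a)) * h ^ (2 * k) * (C * exp (2 * b))"
      by (rule add_mono[OF A1 A2])
    also have "\<dots> = C * (1 + (b - a)) * h ^ (2 * k) * (T + exp (2 * b))"
      by (simp add: algebra_simps)
    finally have "integral {a..b} G \<le> C * (1 + (b - a)) * h ^ (2 * k) * (E * h powr (- (d + d1 + 4 * \<epsilon>)) + exp (2 * b))"
      unfolding T_def .
    then show ?thesis using GI VG by (intro exI[of _ G]) (auto simp: has_integral_integrable)
  qed
  then show ?thesis using C0 by (intro that[of C]) auto
qed

end

section \<open>Comparison with the multiplicities\<close>

lemma fdiffs_spline_nonneg:
  assumes "k \<ge> 2" "h \<ge> 0"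
  shows "fdiffs h k (\<lambda>v::real. max 0 v ^ (k - 1) / fact (k - 1)) v \<ge> 0"
proof -
  obtain n where k: "k = Suc (Suc n)" using assms(1) by (metis add_2_eq_Suc le_Suc_ex)
  have "(\<lambda>v::real. max 0 v ^ (k - 1) / fact (k - 1)) = (\<lambda>v. (1 / fact (k - 1)) * max 0 v ^ Suc n)" by (simp add: k)
  then show ?thesis using fdiffs_max_power_nonneg[OF assms(2), of n v] unfolding k
    by (simp only: fdiffs_cmult) (rule mult_nonneg_nonneg, auto)
qed

text \<open>The spline is supported between \<open>- k * h\<close> and 0. On its leftmost piece it
  is a multiple of a power of \<open>v + k * h\<close>, and on the right half of this piece that
  base is at least \<open>h / 2\<close>.\<close>

lemma fdiffs_spline_lower:
  assumes k: "k \<ge> 2" and h: "h \<ge> 0" and v: "v \<ge> - (real k - 1 / 2) * h" "v \<le> - (real k - 1) * h"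
  shows "fdiffs h k (\<lambda>v::real. max 0 v ^ (k - 1) / fact (k - 1)) v \<ge> (h / 2) ^ (k - 1) / fact (k - 1)"
proof -
  have "fdiffs h k (\<lambda>v::real. max 0 v ^ (k - 1) / fact (k - 1)) v = max 0 (v + real k * h) ^ (k - 1) / fact (k - 1)"
    by (rule fdiffs_left_end[OF _ h v(2)]) (use k in auto)
  moreover have "h / 2 \<le> v + real k * h" using v(1) by (simp add: algebra_simps)
  then have "h / 2 \<le> max 0 (v + real k * h)" by (rule max.coboundedI2)
  ultimately show ?thesis using h by (simp add: divide_right_mono power_mono)
qed

context zeta_setup
begin

lemma mult_square_sum_diff:
  assumes "Y \<le> X"
  shows "mult_square_sum P N X - mult_square_sum P N Y = (\<Sum>n \<in> {n \<in> N ` P. Y \<le> n \<and> n < X}. (real (norm_mult P N n))\<^sup>2)"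
    and "finite {n \<in> N ` P. n < X}"
proof -
  have "{n \<in> N ` P. n < X} = N ` {p \<in> P. N p < X}" by auto
  then show fin: "finite {n \<in> N ` P. n < X}" using finite_norm_less by simp
  have un: "{n \<in> N ` P. n < X} = {n \<in> N ` P. n < Y} \<union> {n \<in> N ` P. Y \<le> n \<and> n < X}" using assms by auto
  have f1: "finite {n \<in> N ` P. n < Y}" by (rule finite_subset[OF _ fin]) (use assms in auto)
  have f2: "finite {n \<in> N ` P. Y \<le> n \<and> n < X}" by (rule finite_subset[OF _ fin]) auto
  have disj: "{n \<in> N ` P. n < Y} \<inter> {n \<in> N ` P. Y \<le> n \<and> n < X} = {}" by auto
  show "mult_square_sum P N X - mult_square_sum P N Y = (\<Sum>n \<in> {n \<in> N ` P. Y \<le> n \<and> n < X}. (real (norm_mult P N n))\<^sup>2)"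
    unfolding mult_square_sum_def un sum.union_disjoint[OF f1 f2 disj] by simp
qed

lemma mult_square_sum_nonneg: "mult_square_sum P N X \<ge> 0"
  unfolding mult_square_sum_def by (intro sum_nonneg) simp

text \<open>All terms are non-negative, so only the first powers of \<open>p\<close> with
  \<open>Y \<le> N p < X\<close> are kept. The \<open>norm_mult P N n\<close> elements of norm
  \<open>n\<close> contribute at least \<open>l\<close> each when \<open>u\<close> lies in an
  interval of length \<open>h / 2\<close>, and the square of the sum over \<open>n\<close> is at
  least the sum of the squares.\<close>

lemma multiplicities_lower_bound:
  fixes e :: "nat \<Rightarrow> 'a \<times> nat"
  assumes e: "bij_betw e UNIV (P \<times> UNIV)" and c: "c \<ge> 2" and k: "k \<ge> 2" and h: "0 < h" "h \<le> 1" and Y: "exp 1 \<le> Y"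
    and sm: "summable (\<lambda>n. ln (N (fst (e n))) * exp (- c * pp_log N (e n)) *
        fdiffs h k (\<lambda>v. max 0 v ^ (k - 1) / fact (k - 1)) (u - pp_log N (e n)))"
  defines "l \<equiv> exp (- c * real k) * ((h / 2) ^ (k - 1) / fact (k - 1))"
    and "V \<equiv> exp (c * u) * (\<Sum>n. ln (N (fst (e n))) * exp (- c * pp_log N (e n)) *
        fdiffs h k (\<lambda>v. max 0 v ^ (k - 1) / fact (k - 1)) (u - pp_log N (e n)))"
  shows "(\<Sum>n \<in> {n \<in> N ` P. Y \<le> n \<and> n < X}. (real (norm_mult P N n))\<^sup>2 * l\<^sup>2 *
      indicator {ln n - (real k - 1 / 2) * h .. ln n - (real k - 1) * h} u) \<le> V\<^sup>2"
proof -
  define \<phi> where "\<phi> = fdiffs h k (\<lambda>v::real. max 0 v ^ (k - 1) / fact (k - 1))"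
  define I where "I n = {ln n - (real k - 1 / 2) * h .. ln n - (real k - 1) * h}" for n :: real
  define T where "T i = ln (N (fst i)) * exp (- c * pp_log N i) * \<phi> (u - pp_log N i)" for i
  have \<phi>0: "\<phi> v \<ge> 0" for v unfolding \<phi>_def by (rule fdiffs_spline_nonneg[OF k]) (use h in simp)
  have en: "fst (e n) \<in> P" for n using bij_betwE[OF e] by (auto simp: mem_Times_iff)
  have T0: "T (e n) \<ge> 0" for n
    unfolding T_def using N_gt_1[OF en[of n]] by (intro mult_nonneg_nonneg \<phi>0) auto
  have l0: "l \<ge> 0" unfolding l_def using h by simp
  define PS where "PS = {p \<in> P. Y \<le> N p \<and> N p < X}"
  have finPS: "finite PS" unfolding PS_def by (rule finite_subset[OF _ finite_norm_less[of X]]) auto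
  have NPS: "N ` PS = {n \<in> N ` P. Y \<le> n \<and> n < X}" by (auto simp: PS_def)
  \<comment> \<open>The positions in the enumeration of the first powers \<open>(p, 0)\<close>; the
    sum over them is a lower bound for the series.\<close>
  define J where "J = (\<lambda>p. inv_into UNIV e (p, 0)) ` PS"
  have einv: "e (inv_into UNIV e (p, 0)) = (p, 0)" if "p \<in> PS" for p
  proof -
    have "(p, 0) \<in> e ` UNIV" using that bij_betw_imp_surj_on[OF e] by (auto simp: PS_def)
    then show ?thesis by (rule f_inv_into_f)
  qed
  have inj: "inj_on (\<lambda>p. inv_into UNIV e (p, 0)) PS"
    by (rule inj_onI) (metis einv prod.inject)
  have sm': "summable (\<lambda>n. T (e n))" using sm by (simp add: T_def \<phi>_def)
  have "(\<Sum>p\<in>PS. l * indicator (I (N p)) u) \<le> (\<Sum>p\<in>PS. exp (c * u) * T (p, 0))"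
  proof (rule sum_mono)
    fix p assume p: "p \<in> PS"
    then have Np: "N p \<ge> exp 1" "N p > 0" using Y by (auto simp: PS_def intro: order_trans less_le_trans[OF exp_gt_zero])
    \<comment> \<open>\<open>Y \<ge> exp 1\<close> allows the weight \<open>ln (N p)\<close> to be
      dropped.\<close>
    have lnN: "ln (N p) \<ge> 1" using Np ln_ge_iff by auto
    have pl: "pp_log N (p, 0) = ln (N p)" by (simp add: pp_log_def)
    have eq: "exp (c * u) * T (p, 0) = ln (N p) * exp (c * (u - ln (N p))) * \<phi> (u - ln (N p))"
      by (simp add: T_def pl right_diff_distrib exp_diff exp_minus field_simps)
    show "l * indicator (I (N p)) u \<le> exp (c * u) * T (p, 0)"
    proof (cases "u \<in> I (N p)")
      case True
      define v where "v = u - ln (N p)"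
      have "ln (N p) - (real k - 1 / 2) * h \<le> u" "u \<le> ln (N p) - (real k - 1) * h" using True by (auto simp: I_def)
      then have v: "v \<ge> - (real k - 1 / 2) * h" "v \<le> - (real k - 1) * h" by (simp_all add: v_def algebra_simps)
      \<comment> \<open>As \<open>h \<le> 1\<close>, the window reaches back by at most
        \<open>k\<close>, so the factor \<open>exp (c * v)\<close> loses at most the constant
        \<open>exp (- c * k)\<close> in \<open>l\<close>.\<close>
      have "real k * h \<le> real k * 1" using h by (intro mult_left_mono) auto
      then have "v \<ge> - real k" using v(1) h by (simp add: algebra_simps)
      then have "c * v \<ge> c * (- real k)" using c by (intro mult_left_mono) auto
      then have "exp (- c * real k) \<le> exp (c * v)" by simp
      moreover have "(h / 2) ^ (k - 1) / fact (k - 1) \<le> \<phi> v"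
        unfolding \<phi>_def by (rule fdiffs_spline_lower[OF k _ v]) (use h in simp)
      ultimately have "l \<le> exp (c * v) * \<phi> v" unfolding l_def using h by (intro mult_mono) auto
      also have "\<dots> \<le> ln (N p) * (exp (c * v) * \<phi> v)"
        using lnN \<phi>0[of v] mult_right_mono[of 1 "ln (N p)" "exp (c * v) * \<phi> v"] by simp
      finally show ?thesis using True by (simp add: eq v_def mult.assoc)
    next
      case False
      have "0 \<le> ln (N p) * exp (c * (u - ln (N p))) * \<phi> (u - ln (N p))"
        using lnN by (intro mult_nonneg_nonneg \<phi>0) auto
      then show ?thesis using False eq by simp
    qed
  qed
  also have "\<dots> = exp (c * u) * (\<Sum>j\<in>J. T (e j))"
    unfolding J_def by (simp add: sum.reindex[OF inj] einv sum_distrib_left)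
  also have "\<dots> \<le> exp (c * u) * (\<Sum>n. T (e n))"
    using finPS T0 by (intro mult_left_mono sum_le_suminf sm') (auto simp: J_def)
  also have "\<dots> = V" by (simp add: V_def T_def \<phi>_def)
  finally have 1: "(\<Sum>p\<in>PS. l * indicator (I (N p)) u) \<le> V" .
  have 2: "(\<Sum>p\<in>PS. l * indicator (I (N p)) u) = (\<Sum>n\<in>N ` PS. real (norm_mult P N n) * (l * indicator (I n) u))"
  proof -
    have "(\<Sum>p\<in>PS. l * indicator (I (N p)) u) = (\<Sum>n\<in>N ` PS. \<Sum>p\<in>{p \<in> PS. N p = n}. l * indicator (I (N p)) u)"
      by (rule sum.image_gen[OF finPS])
    also have "\<dots> = (\<Sum>n\<in>N ` PS. real (norm_mult P N n) * (l * indicator (I n) u))"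
    proof (rule sum.cong[OF refl])
      fix n assume n: "n \<in> N ` PS"
      have "{p \<in> PS. N p = n} = {p \<in> P. N p = n}" using n by (auto simp: PS_def)
      then have "card {p \<in> PS. N p = n} = norm_mult P N n" by (simp add: norm_mult_def)
      moreover have "(\<Sum>p\<in>{p \<in> PS. N p = n}. l * indicator (I (N p)) u) = (\<Sum>p\<in>{p \<in> PS. N p = n}. l * indicator (I n) u)"
        by (rule sum.cong) auto
      ultimately show "(\<Sum>p\<in>{p \<in> PS. N p = n}. l * indicator (I (N p)) u) = real (norm_mult P N n) * (l * indicator (I n) u)"
        by simp
    qed
    finally show ?thesis .
  qed
  have "(\<Sum>n\<in>N ` PS. (real (norm_mult P N n) * (l * indicator (I n) u))\<^sup>2) \<le> (\<Sum>n\<in>N ` PS. real (norm_mult P N n) * (l * indicator (I n) u))\<^sup>2"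
    using finPS l0 by (intro sum_squares_le_square_sum) auto
  also have "\<dots> \<le> V\<^sup>2" unfolding 2[symmetric] using l0 by (intro power_mono 1 sum_nonneg) auto
  finally have "(\<Sum>n\<in>N ` PS. (real (norm_mult P N n) * (l * indicator (I n) u))\<^sup>2) \<le> V\<^sup>2" .
  moreover have "(real (norm_mult P N n) * (l * indicator (I n) u))\<^sup>2 = (real (norm_mult P N n))\<^sup>2 * l\<^sup>2 * indicator (I n) u" for n
    by (simp add: power_mult_distrib indicator_def)
  ultimately show ?thesis by (simp only: NPS I_def)
qed

text \<open>Integrating the lower bound over \<open>u\<close>, every \<open>n\<close> contributes
  its squared multiplicity times \<open>l\<^sup>2 * (h / 2)\<close>, which is of order
  \<open>h ^ (2 * k - 1)\<close>. The spectral bound carries \<open>h ^ (2 * k)\<close>, so one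
  factor \<open>h\<close> survives: hence the exponent \<open>1 - D\<close> and the term
  \<open>h * X\<^sup>2\<close>.\<close>

lemma key_inequality:
  assumes e: "\<epsilon> > 0"
  obtains C Y0 where "C > 0" "Y0 \<ge> 1" "\<And>h X Y. 0 < h \<Longrightarrow> h \<le> 1 \<Longrightarrow> Y0 \<le> Y \<Longrightarrow> Y \<le> X \<Longrightarrow>
    mult_square_sum P N X - mult_square_sum P N Y \<le>
      C * (1 + ln X) * ((X powr (2 * \<rho>) + Y powr (2 * \<rho>)) * h powr (1 - (d + d1 + 4 * \<epsilon>)) + h * X\<^sup>2)"
proof (rule explicit_formula)
  fix c :: real and k0 :: nat and en :: "nat \<Rightarrow> 'a \<times> nat"
  assume c: "c \<ge> 2" and en: "bij_betw en UNIV (P \<times> UNIV)" and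
    M: "\<And>k. k \<ge> k0 \<Longrightarrow> summable (\<lambda>r. \<Sum>\<sigma>\<in>sing_block Z r. sing_mult Z \<sigma> / norm (\<sigma> - of_real c) ^ k)" and
    S: "\<And>k h u. k \<ge> k0 \<Longrightarrow> h > 0 \<Longrightarrow> u > 0 \<Longrightarrow>
      summable (\<lambda>n. ln (N (fst (en n))) * exp (- c * pp_log N (en n)) *
        fdiffs h k (\<lambda>v. max 0 v ^ (k - 1) / fact (k - 1)) (u - pp_log N (en n)))" and
    L: "\<And>k h u. k \<ge> k0 \<Longrightarrow> h > 0 \<Longrightarrow> u > 0 \<Longrightarrow>
      (\<lambda>R. \<Sum>r<R. \<Sum>\<sigma>\<in>sing_block Z r. of_int (zorder Z \<sigma>) *
         ((exp ((\<sigma> - of_real c) * of_real h) - 1) / (\<sigma> - of_real c)) ^ k * exp ((\<sigma> - of_real c) * of_real u))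
      \<longlonglongrightarrow> - of_real (\<Sum>n. ln (N (fst (en n))) * exp (- c * pp_log N (en n)) *
        fdiffs h k (\<lambda>v. max 0 v ^ (k - 1) / fact (k - 1)) (u - pp_log N (en n)))"
  define D where "D = d + d1 + 4 * \<epsilon>"
  \<comment> \<open>Large enough for both decay exponents of \<open>spectral_mean_square\<close> to
    be at most \<open>k\<close>.\<close>
  define k where "k = max (max k0 2) (nat \<lceil>d + d1 + 2 * \<epsilon>\<rceil>)"
  have k: "k \<ge> k0" "k \<ge> 2" by (auto simp: k_def)
  have "d + d1 + 2 * \<epsilon> \<le> real k" unfolding k_def by linarith
  then have kd: "d + 2 * \<epsilon> \<le> real k" "d1 + 2 * \<epsilon> \<le> real k" using d_nonneg d1_nonneg by auto
  obtain C0 where C0: "C0 > 0" and sp: "\<And>h a b E V. 0 < h \<Longrightarrow> h \<le> 1 \<Longrightarrow> 0 < a \<Longrightarrow> a \<le> b \<Longrightarrow>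
      (\<And>u. u \<in> {a..b} \<Longrightarrow> exp (2 * \<rho> * u) \<le> E) \<Longrightarrow>
      (\<And>u. u \<in> {a..b} \<Longrightarrow> (\<lambda>R. \<Sum>r<R. \<Sum>\<sigma>\<in>sing_block Z r. of_int (zorder Z \<sigma>) *
         ((exp ((\<sigma> - of_real c) * of_real h) - 1) / (\<sigma> - of_real c)) ^ k * exp (\<sigma> * of_real u))
        \<longlonglongrightarrow> - complex_of_real (V u)) \<Longrightarrow>
      \<exists>G. G integrable_on {a..b} \<and> (\<forall>u\<in>{a..b}. (V u)\<^sup>2 \<le> G u) \<and>
        integral {a..b} G \<le> C0 * (1 + (b - a)) * h ^ (2 * k) * (E * h powr (- (d + d1 + 4 * \<epsilon>)) + exp (2 * b))"
    using spectral_mean_square[OF e c kd M[OF k(1)]] by blast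
  define l0 where "l0 = exp (- c * real k) * ((1 / 2) ^ (k - 1) / fact (k - 1))"
  have l0: "l0 > 0" unfolding l0_def by simp
  define e0 where "e0 = exp (2 * \<bar>\<rho>\<bar> * real k)"
  have e0: "e0 \<ge> 1" unfolding e0_def by simp
  define C where "C = 2 / l0\<^sup>2 * C0 * (real k + 1) * e0"
  have Cpos: "C > 0" unfolding C_def using l0 C0 e0 by simp
  have "mult_square_sum P N X - mult_square_sum P N Y \<le>
      C * (1 + ln X) * ((X powr (2 * \<rho>) + Y powr (2 * \<rho>)) * h powr (1 - (d + d1 + 4 * \<epsilon>)) + h * X\<^sup>2)"
    if h: "0 < h" "h \<le> 1" and Y: "exp (real k + 1) \<le> Y" and XY: "Y \<le> X" for h X Y
  proof -
    have Y1: "Y > 0" "exp 1 \<le> Y"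
      using Y by (auto intro: less_le_trans[OF exp_gt_zero] order_trans[of "exp 1" "exp (real k + 1)"])
    have X0: "X > 0" using Y1 XY by simp
    \<comment> \<open>The window of \<open>n\<close> lies to the left of \<open>ln n\<close> by at
      most \<open>k * h \<le> k\<close>. Starting \<open>k\<close> before \<open>ln Y\<close>
      includes all windows, and \<open>Y \<ge> exp (k + 1)\<close> keeps \<open>a\<close>
      positive.\<close>
    define a where "a = ln Y - real k"
    define b where "b = ln X"
    have lnY: "ln Y \<ge> real k + 1" using Y Y1 ln_ge_iff by blast
    have lnXY: "ln Y \<le> ln X" using Y1 XY by simp
    have ab: "0 < a" "a \<le> b" using lnY lnXY by (auto simp: a_def b_def)
    \<comment> \<open>The maximum of \<open>exp (2 * \<rho> * u)\<close> is at the right or at the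
      left end according to the sign of \<rho>; the sum covers both, and \<open>e0\<close> pays for
      the shift by \<open>k\<close> in \<open>a\<close>.\<close>
    define E where "E = e0 * (X powr (2 * \<rho>) + Y powr (2 * \<rho>))"
    have E: "exp (2 * \<rho> * u) \<le> E" if u: "u \<in> {a..b}" for u
    proof (cases "\<rho> \<ge> 0")
      case True
      have "exp (2 * \<rho> * u) \<le> X powr (2 * \<rho>)" using u True X0 by (simp add: powr_def b_def mult_left_mono)
      also have "\<dots> \<le> 1 * (X powr (2 * \<rho>) + Y powr (2 * \<rho>))" by simp
      also have "\<dots> \<le> E" unfolding E_def using e0 by (intro mult_right_mono) auto
      finally show ?thesis .
    next
      case False
      have "2 * \<rho> * u \<le> 2 * \<rho> * a" using u False by (intro mult_left_mono_neg) auto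
      then have "exp (2 * \<rho> * u) \<le> exp (2 * \<rho> * a)" by simp
      also have "\<dots> = e0 * Y powr (2 * \<rho>)"
        using False Y1 by (simp add: a_def e0_def powr_def exp_add[symmetric] algebra_simps)
      also have "\<dots> \<le> E" unfolding E_def using e0 by (intro mult_left_mono) auto
      finally show ?thesis .
    qed
    define V where "V u = exp (c * u) * (\<Sum>n. ln (N (fst (en n))) * exp (- c * pp_log N (en n)) *
        fdiffs h k (\<lambda>v. max 0 v ^ (k - 1) / fact (k - 1)) (u - pp_log N (en n)))" for u
    have Vlim: "(\<lambda>R. \<Sum>r<R. \<Sum>\<sigma>\<in>sing_block Z r. of_int (zorder Z \<sigma>) *
         ((exp ((\<sigma> - of_real c) * of_real h) - 1) / (\<sigma> - of_real c)) ^ k * exp (\<sigma> * of_real u))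
        \<longlonglongrightarrow> - complex_of_real (V u)" if u: "u \<in> {a..b}" for u
    proof -
      have u0: "u > 0" using u ab by simp
      have ex: "exp (of_real (c * u)) * exp ((\<sigma> - of_real c) * of_real u) = exp (\<sigma> * complex_of_real u)" for \<sigma>
        by (simp add: exp_add[symmetric] algebra_simps)
      have "exp (of_real (c * u)) * (\<Sum>r<R. \<Sum>\<sigma>\<in>sing_block Z r. of_int (zorder Z \<sigma>) *
         ((exp ((\<sigma> - of_real c) * of_real h) - 1) / (\<sigma> - of_real c)) ^ k * exp ((\<sigma> - of_real c) * of_real u)) =
        (\<Sum>r<R. \<Sum>\<sigma>\<in>sing_block Z r. of_int (zorder Z \<sigma>) *
         ((exp ((\<sigma> - of_real c) * of_real h) - 1) / (\<sigma> - of_real c)) ^ k * exp (\<sigma> * complex_of_real u))" for R :: nat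
        unfolding sum_distrib_left
        by (intro sum.cong refl) (simp only: mult.left_commute[of "exp (of_real (c * u))"] ex)
      moreover have "exp (of_real (c * u)) * - complex_of_real (\<Sum>n. ln (N (fst (en n))) * exp (- c * pp_log N (en n)) *
        fdiffs h k (\<lambda>v. max 0 v ^ (k - 1) / fact (k - 1)) (u - pp_log N (en n))) = - complex_of_real (V u)"
        unfolding V_def exp_of_real by (simp only: of_real_mult mult_minus_right)
      ultimately show ?thesis
        using tendsto_mult_left[OF L[OF k(1) h(1) u0], of "exp (of_real (c * u))"] by (simp only:)
    qed
    obtain G where G: "G integrable_on {a..b}" "\<And>u. u \<in> {a..b} \<Longrightarrow> (V u)\<^sup>2 \<le> G u"
      "integral {a..b} G \<le> C0 * (1 + (b - a)) * h ^ (2 * k) * (E * h powr (- (d + d1 + 4 * \<epsilon>)) + exp (2 * b))"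
      using sp[OF h ab E Vlim] by blast
    define l where "l = exp (- c * real k) * ((h / 2) ^ (k - 1) / fact (k - 1))"
    define Ns where "Ns = {n \<in> N ` P. Y \<le> n \<and> n < X}"
    have finNs: "finite Ns" unfolding Ns_def by (rule finite_subset[OF _ mult_square_sum_diff(2)[OF XY]]) auto
    define m where "m n = (real (norm_mult P N n))\<^sup>2" for n
    let ?p = "\<lambda>n. ln n - (real k - 1 / 2) * h"
    let ?q = "\<lambda>n. ln n - (real k - 1) * h"
    have low: "(\<Sum>n\<in>Ns. m n * l\<^sup>2 * indicator {?p n .. ?q n} u) \<le> G u" if u: "u \<in> {a..b}" for u
    proof -
      have "u > 0" using u ab by simp
      from multiplicities_lower_bound[OF en c k(2) h Y1(2) S[OF k(1) h(1) this], of X]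
      show ?thesis using G(2)[OF u] unfolding V_def l_def Ns_def m_def by linarith
    qed
    have "((\<lambda>u. \<Sum>n\<in>Ns. m n * l\<^sup>2 * indicator {?p n .. ?q n} u) has_integral (\<Sum>n\<in>Ns. m n * l\<^sup>2 * (?q n - ?p n))) {a..b}"
    proof (rule has_integral_sum[OF finNs has_integral_indicator_interval])
      fix n assume n: "n \<in> Ns"
      then have n': "Y \<le> n" "n < X" by (auto simp: Ns_def)
      show "?p n \<le> ?q n" using h by (simp add: algebra_simps)
      have "ln Y \<le> ln n" "ln n \<le> ln X" using n' Y1 by simp_all
      moreover have "(real k - 1 / 2) * h \<le> real k * 1" using h k by (intro mult_mono) auto
      moreover have "0 \<le> (real k - 1) * h" using h k by (intro mult_nonneg_nonneg) auto
      ultimately show "{?p n .. ?q n} \<subseteq> {a..b}" by (auto simp: a_def b_def)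
    qed
    from has_integral_le[OF this integrable_integral[OF G(1)] low]
    have int_le: "(\<Sum>n\<in>Ns. m n * l\<^sup>2 * (?q n - ?p n)) \<le> integral {a..b} G" .
    have "(\<Sum>n\<in>Ns. m n) * (l\<^sup>2 * (h / 2)) = (\<Sum>n\<in>Ns. m n * l\<^sup>2 * (?q n - ?p n))"
      unfolding sum_distrib_right by (rule sum.cong[OF refl]) (simp add: algebra_simps)
    with int_le have "(\<Sum>n\<in>Ns. m n) * (l\<^sup>2 * (h / 2)) \<le> integral {a..b} G" by linarith
    also have "l\<^sup>2 * (h / 2) = (l0\<^sup>2 / 2) * h ^ (2 * k - 1)"
    proof -
      have l: "l = l0 * h ^ (k - 1)" by (simp add: l_def l0_def power_divide)
      have "2 * k - 1 = Suc (2 * (k - 1))" using k by simp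
      then have "h ^ (2 * k - 1) = (h ^ (k - 1))\<^sup>2 * h" by (simp add: power_mult[symmetric] mult.commute)
      then show ?thesis unfolding l by (simp add: power_mult_distrib)
    qed
    finally have r1: "(\<Sum>n\<in>Ns. m n) * ((l0\<^sup>2 / 2) * h ^ (2 * k - 1)) \<le> integral {a..b} G" .
    have hk: "h ^ (2 * k) = h * h ^ (2 * k - 1)" using k by (cases "2 * k") auto
    have "(\<Sum>n\<in>Ns. m n) * (l0\<^sup>2 / 2) * h ^ (2 * k - 1) \<le> integral {a..b} G"
      using r1 by (simp only: mult.assoc)
    also have "\<dots> \<le> C0 * (1 + (b - a)) * h ^ (2 * k) * (E * h powr (- D) + exp (2 * b))"
      unfolding D_def by (rule G(3))
    also have "\<dots> = C0 * (1 + (b - a)) * (E * (h * h powr (- D)) + h * exp (2 * b)) * h ^ (2 * k - 1)"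
      unfolding hk by (simp only: distrib_left distrib_right mult_ac)
    finally have "(\<Sum>n\<in>Ns. m n) * (l0\<^sup>2 / 2) \<le> C0 * (1 + (b - a)) * (E * (h * h powr (- D)) + h * exp (2 * b))"
      by (rule mult_right_le_imp_le) (use h in simp)
    also have "h * h powr (- D) = h powr (1 - D)" using h by (simp add: powr_diff powr_minus_divide)
    also have "exp (2 * b) = X\<^sup>2" using X0 by (simp add: b_def exp_double)
    also have "C0 * (1 + (b - a)) * (E * h powr (1 - D) + h * X\<^sup>2) \<le>
      C0 * ((real k + 1) * (1 + ln X)) * (e0 * ((X powr (2 * \<rho>) + Y powr (2 * \<rho>)) * h powr (1 - D) + h * X\<^sup>2))"
    proof (intro mult_mono mult_left_mono)
      have "1 + (b - a) \<le> 1 + ln X + real k" using lnY by (simp add: a_def b_def)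
      also have "\<dots> \<le> (real k + 1) * (1 + ln X)" using lnY lnXY by (simp add: algebra_simps)
      finally show "1 + (b - a) \<le> (real k + 1) * (1 + ln X)" .
      have "1 * (h * X\<^sup>2) \<le> e0 * (h * X\<^sup>2)" using e0 h by (intro mult_right_mono) auto
      then show "E * h powr (1 - D) + h * X\<^sup>2 \<le> e0 * ((X powr (2 * \<rho>) + Y powr (2 * \<rho>)) * h powr (1 - D) + h * X\<^sup>2)"
        by (simp add: E_def algebra_simps)
    qed (use C0 h lnY lnXY e0 ab in \<open>auto simp: E_def\<close>)
    finally have r2: "(\<Sum>n\<in>Ns. m n) * (l0\<^sup>2 / 2) \<le>
      C0 * ((real k + 1) * (1 + ln X)) * (e0 * ((X powr (2 * \<rho>) + Y powr (2 * \<rho>)) * h powr (1 - D) + h * X\<^sup>2))" .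
    have "(\<Sum>n\<in>Ns. m n) = (\<Sum>n\<in>Ns. m n) * (l0\<^sup>2 / 2) * (2 / l0\<^sup>2)" using l0 by simp
    also have "\<dots> \<le> C0 * ((real k + 1) * (1 + ln X)) * (e0 * ((X powr (2 * \<rho>) + Y powr (2 * \<rho>)) * h powr (1 - D) + h * X\<^sup>2)) * (2 / l0\<^sup>2)"
      by (rule mult_right_mono[OF r2]) simp
    also have "\<dots> = C * (1 + ln X) * ((X powr (2 * \<rho>) + Y powr (2 * \<rho>)) * h powr (1 - D) + h * X\<^sup>2)"
      unfolding C_def by (simp only: mult_ac)
    finally have "(\<Sum>n\<in>Ns. m n) \<le> C * (1 + ln X) * ((X powr (2 * \<rho>) + Y powr (2 * \<rho>)) * h powr (1 - D) + h * X\<^sup>2)" .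
    then show ?thesis unfolding mult_square_sum_diff(1)[OF XY] Ns_def m_def D_def .
  qed
  then show thesis using Cpos by (intro that[of C "exp (real k + 1)"]) auto
qed

end

section \<open>Choice of the parameters\<close>

context zeta_setup
begin

text \<open>If \<open>d + d1 < 1\<close>, the exponent of \<open>h\<close> in
  \<open>key_inequality\<close> is positive for small \<epsilon>. With \<open>X\<close> fixed and
  \<open>Y = Y0\<close>, letting \<open>h\<close> tend to 0 shows that
  \<open>mult_square_sum P N\<close> does not grow beyond \<open>Y0\<close>, against
  \<open>low\<close>.\<close>

lemma order_sum_ge_1:
  fixes \<alpha> :: real
  assumes \<alpha>: "1 \<le> \<alpha>" and low: "(\<lambda>x::real. x powr (\<alpha> - 1 / 2)) \<in> O[at_top](mult_square_sum P N)"
  shows "1 \<le> d + d1"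
proof (rule ccontr)
  assume "\<not> 1 \<le> d + d1"
  \<comment> \<open>Half of the gap \<open>1 - (d + d1)\<close> is spent on
    \<open>4 * \<epsilon>\<close>; the other half is \<eta>.\<close>
  define \<epsilon> where "\<epsilon> = (1 - (d + d1)) / 8"
  have e: "\<epsilon> > 0" using \<open>\<not> 1 \<le> d + d1\<close> by (simp add: \<epsilon>_def)
  define \<eta> where "\<eta> = 1 - (d + d1 + 4 * \<epsilon>)"
  have eta: "\<eta> > 0" using \<open>\<not> 1 \<le> d + d1\<close> by (simp add: \<eta>_def \<epsilon>_def field_simps)
  obtain C Y0 where C: "C > 0" "Y0 \<ge> 1" and key: "\<And>h X Y. 0 < h \<Longrightarrow> h \<le> 1 \<Longrightarrow> Y0 \<le> Y \<Longrightarrow> Y \<le> X \<Longrightarrow>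
    mult_square_sum P N X - mult_square_sum P N Y \<le>
      C * (1 + ln X) * ((X powr (2 * \<rho>) + Y powr (2 * \<rho>)) * h powr \<eta> + h * X\<^sup>2)"
    using key_inequality[OF e] unfolding \<eta>_def by blast
  have bdd: "mult_square_sum P N X \<le> mult_square_sum P N Y0" if X: "X \<ge> Y0" for X
  proof -
    have "((\<lambda>h. C * (1 + ln X) * ((X powr (2 * \<rho>) + Y0 powr (2 * \<rho>)) * h powr \<eta> + h * X\<^sup>2)) \<longlongrightarrow> 
        C * (1 + ln X) * ((X powr (2 * \<rho>) + Y0 powr (2 * \<rho>)) * 0 + 0 * X\<^sup>2)) (at_right 0)"
    proof (intro tendsto_intros)
      show "((\<lambda>h. h powr \<eta>) \<longlongrightarrow> 0) (at_right 0)" using eta by real_asymp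
    qed
    moreover have "\<forall>\<^sub>F h in at_right 0. mult_square_sum P N X - mult_square_sum P N Y0 \<le>
       C * (1 + ln X) * ((X powr (2 * \<rho>) + Y0 powr (2 * \<rho>)) * h powr \<eta> + h * X\<^sup>2)"
      unfolding eventually_at_right_field by (rule exI[of _ 1]) (use key[of _ Y0 X] X in auto)
    ultimately have "mult_square_sum P N X - mult_square_sum P N Y0 \<le> C * (1 + ln X) * ((X powr (2 * \<rho>) + Y0 powr (2 * \<rho>)) * 0 + 0 * X\<^sup>2)"
      by (rule tendsto_lowerbound) simp
    then show ?thesis by simp
  qed
  obtain K where K: "K > 0" "eventually (\<lambda>x. norm (x powr (\<alpha> - 1 / 2)) \<le> K * norm (mult_square_sum P N x)) at_top"
    using landau_o.bigE[OF low] by blast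
  define B where "B = K * mult_square_sum P N Y0"
  have "\<forall>\<^sub>F x in at_top. x powr (1 / 2) \<le> B"
    using K(2) eventually_ge_at_top[of "max Y0 1"]
  proof eventually_elim
    case (elim x)
    have "x powr (1 / 2) \<le> x powr (\<alpha> - 1 / 2)" using elim \<alpha> by (intro powr_mono) auto
    also have "\<dots> \<le> K * mult_square_sum P N x" using elim mult_square_sum_nonneg[of x] by simp
    also have "\<dots> \<le> B" unfolding B_def using bdd[of x] elim K(1) by (intro mult_left_mono) auto
    finally show ?case .
  qed
  moreover have "filterlim (\<lambda>x::real. x powr (1 / 2)) at_top at_top" by real_asymp
  then have "\<forall>\<^sub>F x in at_top. B < (x::real) powr (1 / 2)" by (simp add: filterlim_at_top_dense)
  ultimately have "\<forall>\<^sub>F x :: real in at_top. False" by eventually_elim simp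
  then show False by simp
qed

text \<open>Take \<open>h = X powr (- (2 - \<alpha>) - s)\<close> and
  \<open>Y = X powr (1 - s)\<close> with small \<open>s\<close>. Then \<open>h * X\<^sup>2\<close>
  and the part below \<open>Y\<close> fall short of \<open>X powr \<alpha>\<close> by a power of
  \<open>X\<close>, and so does the spectral term, whose exponent is about
  \<open>\<alpha> - \<gamma>\<close>, if \<gamma> is positive. The product form of the conclusion
  also covers \<alpha> = 2.\<close>

lemma order_sum_mult_bound:
  fixes \<alpha> :: real
  assumes \<alpha>: "1 \<le> \<alpha>" "\<alpha> \<le> 2"
    and low: "\<And>\<epsilon>. \<epsilon> > 0 \<Longrightarrow> (\<lambda>x::real. x powr (\<alpha> - \<epsilon>)) \<in> O[at_top](mult_square_sum P N)"
    and up: "\<And>\<epsilon>. \<epsilon> > 0 \<Longrightarrow> mult_square_sum P N \<in> O[at_top](\<lambda>x::real. x powr (\<alpha> + \<epsilon>))"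
  shows "2 - 2 * \<rho> \<le> (2 - \<alpha>) * (d + d1)"
proof (rule ccontr)
  define \<gamma> where "\<gamma> = 2 - 2 * \<rho> - (2 - \<alpha>) * (d + d1)"
  assume "\<not> 2 - 2 * \<rho> \<le> (2 - \<alpha>) * (d + d1)"
  then have g: "\<gamma> > 0" by (simp add: \<gamma>_def)
  \<comment> \<open>Collects the coefficients of \<open>s\<close> in the exponent:
    \<open>2 * \<bar>\<rho>\<bar>\<close> from replacing \<open>X\<close> by \<open>Y\<close>;
    \<open>\<bar>d + d1 - 1\<bar>\<close>, 4 and 2 from expanding
    \<open>(- (2 - \<alpha>) - s) * (1 - D)\<close>; and 3 in reserve.\<close>
  define M where "M = 2 * \<bar>\<rho>\<bar> + \<bar>d + d1 - 1\<bar> + 9"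
  have M: "M > 0" by (simp add: M_def add_nonneg_pos)
  define s where "s = min (1 / 2) (\<gamma> / (2 * M))"
  have s: "0 < s" "s \<le> 1 / 2" "s * M \<le> \<gamma> / 2"
  proof -
    show "0 < s" "s \<le> 1 / 2" using g M by (auto simp: s_def)
    have "s * M \<le> \<gamma> / (2 * M) * M" using M by (intro mult_right_mono) (auto simp: s_def)
    then show "s * M \<le> \<gamma> / 2" using M by simp
  qed
  define D where "D = d + d1 + 4 * s"
  obtain C Y0 where C: "C > 0" "Y0 \<ge> 1" and key: "\<And>h X Y. 0 < h \<Longrightarrow> h \<le> 1 \<Longrightarrow> Y0 \<le> Y \<Longrightarrow> Y \<le> X \<Longrightarrow>
    mult_square_sum P N X - mult_square_sum P N Y \<le>
      C * (1 + ln X) * ((X powr (2 * \<rho>) + Y powr (2 * \<rho>)) * h powr (1 - D) + h * X\<^sup>2)"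
    using key_inequality[OF s(1)] unfolding D_def by blast
  have s4: "s / 4 > 0" using s by simp
  obtain K1 where K1: "K1 > 0" "eventually (\<lambda>x. norm (x powr (\<alpha> - s / 4)) \<le> K1 * norm (mult_square_sum P N x)) at_top"
    using landau_o.bigE[OF low[OF s4]] by blast
  obtain K2 x2 where K2: "K2 > 0" "x2 \<ge> 1" "\<And>x. x \<ge> x2 \<Longrightarrow> \<bar>mult_square_sum P N x\<bar> \<le> K2 * x powr (\<alpha> + s / 4)"
    using bigo_powr_bound[OF up[OF s4]] by blast
  define A where "A = \<alpha> - s / 4"
  \<comment> \<open>The common saving: each of the three terms is at most a constant and a logarithm
    times \<open>X powr (A - g1)\<close>. The spectral term limits it by
    \<open>\<gamma> / 2\<close>, the part below \<open>Y\<close> by \<open>s / 2\<close>.\<close>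
  define g1 where "g1 = min (\<gamma> / 2) (s / 2)"
  have g1: "g1 > 0" "g1 \<le> \<gamma> / 2" "g1 \<le> s / 2" using g s by (auto simp: g1_def)
  have ev: "\<forall>\<^sub>F X in at_top. 1 / K1 \<le> K2 * X powr (- g1) + C * (1 + ln X) * (3 * X powr (- g1))"
  proof -
    have "filterlim (\<lambda>X::real. X powr (1 - s)) at_top at_top" using s by real_asymp
    then have "\<forall>\<^sub>F X in at_top. max Y0 x2 \<le> (X::real) powr (1 - s)"
      unfolding filterlim_at_top by blast
    then show ?thesis using K1(2) eventually_ge_at_top[of "1::real"]
    proof eventually_elim
      case (elim X)
      define Y where "Y = X powr (1 - s)"
      define h where "h = X powr (- (2 - \<alpha>) - s)"
      have X1: "X \<ge> 1" by fact
      have Y: "Y0 \<le> Y" "x2 \<le> Y" using elim by (auto simp: Y_def)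
      have YX: "Y \<le> X" using powr_mono[of "1 - s" 1 X] X1 s by (simp add: Y_def)
      have h: "0 < h" "h \<le> 1" using X1 s \<alpha> powr_mono[of "- (2 - \<alpha>) - s" 0 X] by (auto simp: h_def)
      have low': "X powr A \<le> K1 * mult_square_sum P N X"
        using elim mult_square_sum_nonneg[of X] by (simp add: A_def)
      have mono: "X powr p \<le> X powr (A - g1)" if "p \<le> A - g1" for p
        using that X1 by (intro powr_mono) auto
      have SY: "mult_square_sum P N Y \<le> K2 * X powr (A - g1)"
      proof -
        have "mult_square_sum P N Y \<le> K2 * Y powr (\<alpha> + s / 4)" using K2(3)[OF Y(2)] by simp
        also have "Y powr (\<alpha> + s / 4) = X powr ((1 - s) * (\<alpha> + s / 4))" by (simp add: Y_def powr_powr)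
        also have "\<dots> \<le> X powr (A - g1)"
        proof (rule mono)
          have "s * 1 \<le> s * \<alpha>" using \<alpha> s by (intro mult_left_mono) auto
          moreover have "0 \<le> s * (s / 4)" using s by simp
          moreover have "(1 - s) * (\<alpha> + s / 4) = \<alpha> + s / 4 - s * \<alpha> - s * (s / 4)" by (simp add: field_simps)
          ultimately have "(1 - s) * (\<alpha> + s / 4) \<le> \<alpha> + s / 4 - s" by linarith
          then show "(1 - s) * (\<alpha> + s / 4) \<le> A - g1" using g1(3) by (simp add: A_def)
        qed
        finally show ?thesis using K2 by (simp add: mult_left_mono)
      qed
      have hh: "h powr (1 - D) = X powr ((- (2 - \<alpha>) - s) * (1 - D))" by (simp add: h_def powr_powr)
      have expo: "2 * \<rho> + 2 * \<bar>\<rho>\<bar> * s + (- (2 - \<alpha>) - s) * (1 - D) \<le> A - g1"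
      proof -
        have "(- (2 - \<alpha>) - s) * (1 - D) = (2 - \<alpha>) * (d + d1) - (2 - \<alpha>) + s * (d + d1 - 1) + s * (4 * (2 - \<alpha>)) + s * (4 * s)"
          by (simp add: D_def algebra_simps)
        moreover have "s * (d + d1 - 1) \<le> s * \<bar>d + d1 - 1\<bar>" using s by (intro mult_left_mono) auto
        moreover have "s * (4 * (2 - \<alpha>)) \<le> s * 4" using s \<alpha> by (intro mult_left_mono) auto
        moreover have "s * (4 * s) \<le> s * 2" using s by (intro mult_left_mono) auto
        ultimately have "2 * \<rho> + 2 * \<bar>\<rho>\<bar> * s + (- (2 - \<alpha>) - s) * (1 - D) \<le>
          2 * \<rho> + (2 - \<alpha>) * (d + d1) - (2 - \<alpha>) + s * (2 * \<bar>\<rho>\<bar> + \<bar>d + d1 - 1\<bar> + 6)"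
          by (simp add: algebra_simps)
        also have "\<dots> = \<alpha> - \<gamma> + s * M - 3 * s" by (simp add: \<gamma>_def M_def algebra_simps)
        also have "\<dots> \<le> A - g1" using s g1 by (simp add: A_def)
        finally show ?thesis .
      qed
      have rho: "Y powr (2 * \<rho>) \<le> X powr (2 * \<rho> + 2 * \<bar>\<rho>\<bar> * s)" "X powr (2 * \<rho>) \<le> X powr (2 * \<rho> + 2 * \<bar>\<rho>\<bar> * s)"
      proof -
        have "Y powr (2 * \<rho>) = X powr ((1 - s) * (2 * \<rho>))" by (simp add: Y_def powr_powr)
        also have "\<dots> \<le> X powr (2 * \<rho> + 2 * \<bar>\<rho>\<bar> * s)"
        proof (rule powr_mono[OF _ X1])
          have "- \<rho> * s \<le> \<bar>\<rho>\<bar> * s" using s by (intro mult_right_mono) auto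
          then show "(1 - s) * (2 * \<rho>) \<le> 2 * \<rho> + 2 * \<bar>\<rho>\<bar> * s" by (simp add: algebra_simps)
        qed
        finally show "Y powr (2 * \<rho>) \<le> X powr (2 * \<rho> + 2 * \<bar>\<rho>\<bar> * s)" .
        show "X powr (2 * \<rho>) \<le> X powr (2 * \<rho> + 2 * \<bar>\<rho>\<bar> * s)" using s X1 by (intro powr_mono) auto
      qed
      have t1: "(X powr (2 * \<rho>) + Y powr (2 * \<rho>)) * h powr (1 - D) \<le> 2 * X powr (A - g1)"
      proof -
        have "(X powr (2 * \<rho>) + Y powr (2 * \<rho>)) * h powr (1 - D) \<le> (2 * X powr (2 * \<rho> + 2 * \<bar>\<rho>\<bar> * s)) * h powr (1 - D)"
          using rho by (intro mult_right_mono) auto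
        also have "\<dots> = 2 * X powr (2 * \<rho> + 2 * \<bar>\<rho>\<bar> * s + (- (2 - \<alpha>) - s) * (1 - D))"
          by (simp only: hh powr_add mult.assoc)
        also have "\<dots> \<le> 2 * X powr (A - g1)" by (intro mult_left_mono mono expo) auto
        finally show ?thesis .
      qed
      have t2: "h * X\<^sup>2 \<le> X powr (A - g1)"
      proof -
        have "h * X\<^sup>2 = X powr (- (2 - \<alpha>) - s) * X powr 2" using X1 by (simp add: h_def powr_numeral)
        also have "\<dots> = X powr (\<alpha> - s)" by (simp only: powr_add[symmetric]) simp
        also have "\<dots> \<le> X powr (A - g1)" using g1(3) s by (intro mono) (simp add: A_def)
        finally show ?thesis .
      qed
      have "X powr A * (1 / K1) \<le> mult_square_sum P N X" using low' K1(1) by (simp add: field_simps)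
      also have "\<dots> \<le> mult_square_sum P N Y + C * (1 + ln X) * ((X powr (2 * \<rho>) + Y powr (2 * \<rho>)) * h powr (1 - D) + h * X\<^sup>2)"
        using key[OF h Y(1) YX] by simp
      also have "\<dots> \<le> K2 * X powr (A - g1) + C * (1 + ln X) * (2 * X powr (A - g1) + X powr (A - g1))"
        using C X1 by (intro add_mono SY mult_left_mono t1 t2) auto
      also have "\<dots> = X powr A * (K2 * X powr (- g1) + C * (1 + ln X) * (3 * X powr (- g1)))"
      proof -
        have "X powr (A - g1) = X powr A * X powr (- g1)" by (simp add: powr_add[symmetric])
        then show ?thesis by (simp add: algebra_simps)
      qed
      finally show ?case by (rule mult_left_le_imp_le) (use X1 in simp)
    qed
  qed
  have lim: "((\<lambda>X::real. K2 * X powr (- g1) + C * (1 + ln X) * (3 * X powr (- g1))) \<longlongrightarrow> 0) at_top"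
    using g1(1) by real_asymp
  have "1 / K1 \<le> 0" by (rule tendsto_lowerbound[OF lim ev]) simp
  then show False using K1(1) by simp
qed

end

theorem theorem1:
  fixes P :: "'a set" and N :: "'a \<Rightarrow> real" and Z :: "complex \<Rightarrow> complex"
    and d d1 \<rho> \<alpha> :: real
  assumes "infinite P" and "countable P"
    and "\<And>p. p \<in> P \<Longrightarrow> N p > 1"
    and "abscissa_set P N \<noteq> {}" and "Inf (abscissa_set P N) = 1"
    \<comment> \<open>\<open>Z\<close> is the meromorphic continuation of the zeta function of \<open>P\<close>\<close>
    and "\<And>s. Re s > 1 \<Longrightarrow> Z s = euler_product P N s"
    and "Z analytic_on ({s. Re s \<ge> 1} - {1})"
    and "\<And>s. Re s \<ge> 1 \<Longrightarrow> s \<noteq> 1 \<Longrightarrow> Z s \<noteq> 0"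
    and "is_pole Z 1" and "zorder Z 1 = -1"
    and "d \<ge> 0" and "meromorphic_of_order Z d"
    and "0 \<le> d1" and "d1 \<le> d"
    and "\<And>\<epsilon>. \<epsilon> > 0 \<Longrightarrow>
           (\<lambda>T::real. real (sing_count Z {\<sigma>. T - 1 < norm \<sigma> \<and> norm \<sigma> < T + 1}))
             \<in> O[at_top](\<lambda>T. T powr (d1 + \<epsilon>))"
    and "\<rho> \<le> 1" and "1 \<le> \<alpha>" and "\<alpha> \<le> 2"
    and "finite (singular_points Z \<inter> {s. Re s \<ge> \<rho>})"
    and "\<And>\<epsilon>. \<epsilon> > 0 \<Longrightarrow>
           (\<lambda>x::real. x powr (\<alpha> - \<epsilon>)) \<in> O[at_top](mult_square_sum P N)"
    and "\<And>\<epsilon>. \<epsilon> > 0 \<Longrightarrow>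
           mult_square_sum P N \<in> O[at_top](\<lambda>x::real. x powr (\<alpha> + \<epsilon>))"
  \<comment> \<open>in \<^typ>\<open>ereal\<close>, a positive number divided by 0 is \<open>\<infinity>\<close>, and 0 divided by 0 is 0\<close>
  shows "ereal (d + d1) \<ge> max 1 (ereal (2 - 2 * \<rho>) / ereal (2 - \<alpha>))"
proof -
  interpret zeta_setup P N Z d d1 \<rho>
    using assms(1-9,11-13,15,19) by unfold_locales
  have "(\<lambda>x::real. x powr (\<alpha> - 1 / 2)) \<in> O[at_top](mult_square_sum P N)" by (rule assms(20)) simp
  then have 1: "1 \<le> d + d1" by (rule order_sum_ge_1[OF assms(17)])
  have 2: "2 - 2 * \<rho> \<le> (2 - \<alpha>) * (d + d1)"
    by (rule order_sum_mult_bound[OF assms(17,18,20,21)])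
  have "ereal (2 - 2 * \<rho>) / ereal (2 - \<alpha>) \<le> ereal (d + d1)"
  proof (cases "\<alpha> = 2")
    case True
    \<comment> \<open>For \<alpha> = 2 the bound \<open>2\<close> leaves
      \<open>2 - 2 * \<rho> \<le> 0\<close>, so \<rho> = 1 and the quotient is 0 / 0, which is
      0.\<close>
    then have "2 - 2 * \<rho> = 0" using 2 assms(16) by simp
    then show ?thesis using 1 by (simp add: zero_ereal_def[symmetric])
  next
    case False
    then have "(2 - 2 * \<rho>) / (2 - \<alpha>) \<le> d + d1" using 2 assms(18) by (simp add: field_simps)
    then show ?thesis using False by simp
  qed
  then show ?thesis using 1 by (simp add: one_ereal_def)
qed

end
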